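(* Let $m,n\ge1$ be integers. (i) Let $p,q,r\ge1$. Suppose that for some $\alpha\ge0$ there is a constant $C$ such that $$\left\|e^{it\Delta_{\mathbb{T}^m\times\mathbb{R}^n}}f\right\|_{L^q(\mathbb{T}^m\times\mathbb{R}^n,\,L^r[0,1])}\le C\,\|f\|_{W^{\alpha,p}(\mathbb{T}^m\times\mathbb{R}^n)}$$ holds for all $f$. Then $$\alpha\ge(m+n)\left(\frac12-\frac1q\right)+n\left(\frac12-\frac1p\right)-\frac2r.$$ In particular, when $p=q=r$, one has $\alpha\ge(m+2n)\left(\frac12-\frac1p\right)-\frac2p$; when $p=2$ and $q=r$, one has $\alpha\ge(m+n)\left(\frac12-\frac1q\right)-\frac2q$. (ii) Let $p,q\ge1$. Suppose that for some $\alpha$ there is a constant $C$ such that $$\left\|e^{it\Delta_{\mathbb{T}^m\times\mathbb{R}^n}}f\right\|_{L^p(\mathbb{T}^m\times\mathbb{R}^n\times[0,1])}\le C\,\|f\|_{M^\alpha_{p,q}(\mathbb{T}^m\times\mathbb{R}^n)}$$ holds for all $f$. Then $$\alpha\ge\max\left\{0,\ (m+n)\left(1-\frac1p-\frac1q\right)-\frac2p\right\}.$$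
   Context: $\mathbb{T}^m$ is identified with the periodic cube $[0,2\pi]^m$. For functions $f(x,y)$ on $\mathbb{T}^m\times\mathbb{R}^n$ the Fourier transform is $$\hat f(k,\xi)=\frac{1}{(2\pi)^{m+n}}\int_{\mathbb{T}^m\times\mathbb{R}^n}f(x,y)e^{-i(k\cdot x+\xi\cdot y)}\,dx\,dy,\qquad k\in\mathbb{Z}^m,\ \xi\in\mathbb{R}^n,$$ so that $f(x,y)=\sum_{k\in\mathbb{Z}^m}\int_{\mathbb{R}^n}\hat f(k,\xi)e^{i(k\cdot x+\xi\cdot y)}\,d\xi$ for sufficiently good $f$. The Schrödinger propagator is $$e^{it\Delta_{\mathbb{T}^m\times\mathbb{R}^n}}f(x,y)=\sum_{k\in\mathbb{Z}^m}\int_{\mathbb{R}^n}\hat f(k,\xi)e^{i(k\cdot x+\xi\cdot y)}e^{-it(|k|^2+|\xi|^2)}\,d\xi.$$ The mixed norm $\|F\|_{L^q(\mathbb{T}^m\times\mathbb{R}^n,\,L^r[0,1])}$ of a function $F(x,y,t)$ is obtained by taking first the $L^r$ norm in $t\in[0,1]$ and then the $L^q$ norm in $(x,y)\in\mathbb{T}^m\times\mathbb{R}^n$. For $\alpha\ge0$ the Sobolev norm is $\|f\|_{W^{\alpha,p}(\mathbb{T}^m\times\mathbb{R}^n)}=\|(1-\Delta_{\mathbb{T}^m\times\mathbb{R}^n})^{\alpha/2}f\|_{L^p(\mathbb{T}^m\times\mathbb{R}^n)}$, where $(1-\Delta_{\mathbb{T}^m\times\mathbb{R}^n})^{\alpha/2}$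 is the Fourier multiplier operator with symbol $(1+|k|^2+|\xi|^2)^{\alpha/2}$. Modulation spaces: let $\{\sigma_K\}_{K\in\mathbb{Z}^{m+n}}\subset C_c^\infty(\mathbb{R}^{m+n})$ be a (fixed) smooth partition of unity on $\mathbb{R}^{m+n}$ adapted to the translated unit cubes $Q_K=K+[-\frac12,\frac12)^{m+n}$, with $\operatorname{supp}\sigma_0\subset[-\frac34,\frac34)^{m+n}$ and $\sigma_K(\cdot)=\sigma_0(\cdot-K)$. For $f$ on $\mathbb{T}^m\times\mathbb{R}^n$, $\square_Kf$ is defined by $\widehat{\square_Kf}(k,\xi)=\sigma_K(k,\xi)\hat f(k,\xi)$ for $k\in\mathbb{Z}^m$, $\xi\in\mathbb{R}^n$. With $\langle K\rangle=(1+|K|^2)^{1/2}$, $$\|f\|_{M^\alpha_{p,q}(\mathbb{T}^m\times\mathbb{R}^n)}=\Big(\sum_{K\in\mathbb{Z}^{m+n}}\langle K\rangle^{q\alpha}\|\square_Kf\|_{L^p(\mathbb{T}^m\times\mathbb{R}^n)}^q\Big)^{1/q}.$$ In (ii), $\alpha$ is a real number and the norm is defined by this formula. Here $f$ ranges over sufficiently good functions, concretely Schwartz functions on $\mathbb{T}^m\times\mathbb{R}^n$ (smooth, with all derivatives rapidly decreasing in $y$). *)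

theory Defs
  imports "HOL-Analysis.Analysis" "HOL-Probability.Essential_Supremum"
begin

text \<open>
  Functions on \<open>\<T>\<^sup>m \<times> \<real>\<^sup>n\<close> are functions on \<open>\<real>\<^sup>m \<times> \<real>\<^sup>n\<close> that are \<open>2\<pi>\<close>-periodic in each of the first
  \<open>m\<close> coordinates, where \<open>m = CARD('m)\<close> and \<open>n = CARD('n)\<close>; both are at least 1 since types are
  nonempty.  The group \<open>\<int>\<^sup>m\<^sup>+\<^sup>n\<close> is \<open>(int^'m) \<times> (int^'n)\<close>.
\<close>

fun iter_partial :: "'a::euclidean_space list \<Rightarrow> ('a \<Rightarrow> 'b::real_normed_vector) \<Rightarrow> 'a \<Rightarrow> 'b" where
  "iter_partial [] f = f"
| "iter_partial (v # vs) f = (\<lambda>z. frechet_derivative (iter_partial vs f) (at z) v)"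

text \<open>Every iterated partial derivative exists and is again totally differentiable, hence continuous;
  this is \<open>C\<^sup>\<infinity>\<close>.\<close>

definition smooth :: "('a::euclidean_space \<Rightarrow> 'b::real_normed_vector) \<Rightarrow> bool" where
  "smooth f \<longleftrightarrow> (\<forall>vs. set vs \<subseteq> Basis \<longrightarrow> (\<forall>z. iter_partial vs f differentiable (at z)))"

definition periodic_fst :: "((real^'m) \<times> (real^'n) \<Rightarrow> 'b) \<Rightarrow> bool" where
  "periodic_fst f \<longleftrightarrow> (\<forall>x y i. f (x + (2 * pi) *\<^sub>R axis i 1, y) = f (x, y))"

definition schwartz :: "((real^'m) \<times> (real^'n) \<Rightarrow> complex) \<Rightarrow> bool" where
  "schwartz f \<longleftrightarrow> periodic_fst f \<and> smooth f \<and>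
     (\<forall>vs N. set vs \<subseteq> Basis \<longrightarrow>
        (\<exists>B. \<forall>x y. (1 + norm y) ^ N * norm (iter_partial vs f (x, y)) \<le> B))"

definition ivec :: "int^'m \<Rightarrow> real^'m" where
  "ivec k = (\<chi> i. real_of_int (k $ i))"

definition waveguide :: "((real^'m) \<times> (real^'n)) measure" where
  "waveguide = restrict_space lborel (cbox 0 (\<chi> i. 2 * pi) \<times> UNIV)"

definition fourier :: "((real^'m) \<times> (real^'n) \<Rightarrow> complex) \<Rightarrow> int^'m \<Rightarrow> real^'n \<Rightarrow> complex" where
  "fourier f k \<xi> = 1 / (2 * complex_of_real pi) ^ (CARD('m) + CARD('n)) *
     (LINT z|waveguide. f z * exp (- \<i> * complex_of_real ((ivec k, \<xi>) \<bullet> z)))"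

text \<open>The operator with symbol \<open>a\<close>, defined through the inversion formula.  In the product space,
  \<open>(k, \<xi>) \<bullet> (x, y) = k \<bullet> x + \<xi> \<bullet> y\<close> and \<open>(norm (k, \<xi>))\<^sup>2 = (norm k)\<^sup>2 + (norm \<xi>)\<^sup>2\<close>.\<close>

definition multiplier ::
  "((real^'m) \<times> (real^'n) \<Rightarrow> complex) \<Rightarrow> ((real^'m) \<times> (real^'n) \<Rightarrow> complex) \<Rightarrow> (real^'m) \<times> (real^'n) \<Rightarrow> complex" where
  "multiplier a f z = (\<Sum>\<^sub>\<infinity>k. LINT \<xi>|lborel.
     a (ivec k, \<xi>) * fourier f k \<xi> * exp (\<i> * complex_of_real ((ivec k, \<xi>) \<bullet> z)))"

definition propagator ::
  "real \<Rightarrow> ((real^'m) \<times> (real^'n) \<Rightarrow> complex) \<Rightarrow> (real^'m) \<times> (real^'n) \<Rightarrow> complex" where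
  "propagator t = multiplier (\<lambda>\<zeta>. exp (- \<i> * complex_of_real (t * (norm \<zeta>)\<^sup>2)))"

definition bessel_potential ::
  "real \<Rightarrow> ((real^'m) \<times> (real^'n) \<Rightarrow> complex) \<Rightarrow> (real^'m) \<times> (real^'n) \<Rightarrow> complex" where
  "bessel_potential \<alpha> = multiplier (\<lambda>\<zeta>. complex_of_real ((1 + (norm \<zeta>)\<^sup>2) powr (\<alpha> / 2)))"

text \<open>Real powers on \<open>[0, \<infinity>]\<close>, meant for positive exponents only.\<close>

definition epow :: "ennreal \<Rightarrow> real \<Rightarrow> ennreal" where
  "epow x a = (if x = \<infinity> then \<infinity> else ennreal (enn2real x powr a))"

text \<open>\<open>L\<^sup>p\<close> norm, \<open>1 \<le> p \<le> \<infinity>\<close>, of a nonnegative extended-valued function.  It takes values in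
  \<open>ennreal\<close>, so that mixed norms can be formed by nesting.\<close>

definition eLp :: "ennreal \<Rightarrow> 'a measure \<Rightarrow> ('a \<Rightarrow> ennreal) \<Rightarrow> ennreal" where
  "eLp p M g = (if p = \<infinity> then esssup M g
     else epow (\<integral>\<^sup>+ z. epow (g z) (enn2real p) \<partial>M) (1 / enn2real p))"

definition Lp_norm :: "ennreal \<Rightarrow> 'a measure \<Rightarrow> ('a \<Rightarrow> complex) \<Rightarrow> ennreal" where
  "Lp_norm p M f = eLp p M (\<lambda>z. ennreal (norm (f z)))"

definition unit_time :: "real measure" where
  "unit_time = restrict_space lborel {0..1}"

definition mixed_norm ::
  "ennreal \<Rightarrow> ennreal \<Rightarrow> ((real^'m) \<times> (real^'n) \<Rightarrow> real \<Rightarrow> complex) \<Rightarrow> ennreal" where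
  "mixed_norm q r F = eLp q waveguide (\<lambda>z. Lp_norm r unit_time (\<lambda>t. F z t))"

definition sobolev_norm :: "real \<Rightarrow> ennreal \<Rightarrow> ((real^'m) \<times> (real^'n) \<Rightarrow> complex) \<Rightarrow> ennreal" where
  "sobolev_norm \<alpha> p f = Lp_norm p waveguide (bessel_potential \<alpha> f)"

definition lattice_pt :: "(int^'m) \<times> (int^'n) \<Rightarrow> (real^'m) \<times> (real^'n)" where
  "lattice_pt K = (ivec (fst K), ivec (snd K))"

text \<open>\<open>\<sigma>\<close> plays the role of \<open>\<sigma>\<^sub>0\<close>; the partition of unity consists of its integer translates.\<close>

definition unit_cube_partition :: "((real^'m) \<times> (real^'n) \<Rightarrow> real) \<Rightarrow> bool" where
  "unit_cube_partition \<sigma> \<longleftrightarrow> smooth \<sigma> \<and> (\<forall>\<zeta>. 0 \<le> \<sigma> \<zeta>) \<and>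
     closure {\<zeta>. \<sigma> \<zeta> \<noteq> 0} \<subseteq>
       {(k, \<xi>). (\<forall>i. -3/4 \<le> k $ i \<and> k $ i < 3/4) \<and> (\<forall>j. -3/4 \<le> \<xi> $ j \<and> \<xi> $ j < 3/4)} \<and>
     (\<forall>\<zeta>. ((\<lambda>K. \<sigma> (\<zeta> - lattice_pt K)) has_sum 1) UNIV)"

definition box_op :: "((real^'m) \<times> (real^'n) \<Rightarrow> real) \<Rightarrow> (int^'m) \<times> (int^'n) \<Rightarrow>
    ((real^'m) \<times> (real^'n) \<Rightarrow> complex) \<Rightarrow> (real^'m) \<times> (real^'n) \<Rightarrow> complex" where
  "box_op \<sigma> K = multiplier (\<lambda>\<zeta>. complex_of_real (\<sigma> (\<zeta> - lattice_pt K)))"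

text \<open>The outer norm is the weighted \<open>\<ell>\<^sup>q\<close> norm over \<open>\<int>\<^sup>m\<^sup>+\<^sup>n\<close>, written as \<open>L\<^sup>q\<close> of the counting measure;
  for \<open>q < \<infinity>\<close> it is \<open>(\<Sum>\<^sub>K \<langle>K\<rangle>\<^bsup>q \<alpha>\<^esup> \<parallel>\<box>\<^sub>K f\<parallel>\<^sub>p\<^sup>q)\<^bsup>1/q\<^esup>\<close>.\<close>

definition modulation_norm :: "((real^'m) \<times> (real^'n) \<Rightarrow> real) \<Rightarrow> real \<Rightarrow> ennreal \<Rightarrow> ennreal \<Rightarrow>
    ((real^'m) \<times> (real^'n) \<Rightarrow> complex) \<Rightarrow> ennreal" where
  "modulation_norm \<sigma> \<alpha> p q f = eLp q (count_space UNIV)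
     (\<lambda>K. ennreal (sqrt (1 + (norm (lattice_pt K))\<^sup>2) powr \<alpha>) * Lp_norm p waveguide (box_op \<sigma> K f))"

end

theory Submission
  imports Defs "HOL-Probability.Probability"
begin

text \<open>
  (i) is tested on data that refocus at the origin at a time \<open>t\<^sub>0 = \<pi> b / N\<close>, where \<open>N = 8 b + 1\<close> and
  hence \<open>t\<^sub>0\<close> is of size 1.  The initial value is prescribed through its Bessel potential, so that no
  multiplier theorem is needed: \<open>(1 - \<Delta>)\<^bsup>\<alpha>/2\<^esup> f\<close> is the product of the Weyl sums
  \<open>\<Sum>\<^sub>k (N - \<bar>k\<bar>) e\<^bsup>i (t\<^sub>0 k\<^sup>2 + k x)\<^esup>\<close> over the torus coordinates, bounded by \<open>N\<^bsup>3/2\<^esup>\<close> each, and of the inverse transform of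
  the chirped Gaussian \<open>e\<^bsup>i t\<^sub>0 \<xi>\<^sup>2 - \<xi>\<^sup>2/N\<^sup>2\<^esup>\<close>, which has height of order 1 and width \<open>N\<close>.  At time \<open>t\<^sub>0\<close> all Fourier
  coefficients are nonnegative; hence for \<open>\<bar>x\<bar>, \<bar>y\<bar> \<lesssim> 1/N\<close> and \<open>0 \<le> t - t\<^sub>0 \<lesssim> 1/N\<^sup>2\<close> there is no
  cancellation and the solution has size \<open>N\<^bsup>2m + n - \<alpha>\<^esup>\<close>.

  (ii) is tested on data with Fourier transform \<open>\<Sum>\<^sub>l \<sigma>\<^sub>0 (0, \<xi> - l)\<close> for \<open>k \<in> P\<close>, where \<open>l\<close> ranges over \<open>L\<close>.
  Up to boundary terms the pieces \<open>\<box>\<^sub>K f\<close> are modulations of finitely many Schwartz functions.  A single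
  frequency tending to infinity yields \<open>\<alpha> \<ge> 0\<close>; the full boxes of side \<open>N\<close> yield the other bound, since there
  is again no cancellation for \<open>\<bar>x\<bar>, \<bar>y\<bar> \<lesssim> 1/N\<close> and \<open>0 \<le> t \<lesssim> 1/N\<^sup>2\<close>.
\<close>

section \<open>Schwartz functions\<close>

text \<open>In (i), data focused at time 0 would only give \<alpha> \<ge> (m+n)(1/p - 1/q) - 2/r,
  which is weaker for p > 2. Data that focus at a time of size 1 are dispersed initially, so their
  \<open>L^p\<close> norm is small; on the compact torus the gain per coordinate is only N^(1/2).
  The solution lives on a box of side about 1/N for a time of about 1/N^2, so up to constants the
  left side is at least N^(2m+n-\<alpha>-(m+n)/q-2/r) and the right side at most N^(3m/2+n/p);
  comparing exponents gives the claim. The choice 8 b = N - 1 makes \<open>b\<close> invertible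
  modulo \<open>N\<close>. The Gaussian cutoff has an explicit chirped transform, without stationary
  phase; its price is that frequencies are unbounded, so phases are controlled in weighted mean and
  not pointwise. In (ii) the sizes are N^(m+n-(m+n+2)/p) and N^(\<alpha>+(m+n)/q). There \<alpha>
  \<ge> 0 has to be settled first, since it makes the weights increase with the frequency and hence
  be of size at most N^\<alpha> on the box.\<close>

definition partial :: "'a::euclidean_space \<Rightarrow> ('a \<Rightarrow> 'b::real_normed_vector) \<Rightarrow> 'a \<Rightarrow> 'b" where
  "partial v f = (\<lambda>z. frechet_derivative f (at z) v)"

lemma iter_partial_Cons: "iter_partial (v # vs) f = partial v (iter_partial vs f)"
  by (simp add: partial_def)

text \<open>\<open>iter_partial\<close> differentiates along the head of the list last. Peeling from
  the end instead lets \<open>partial v h\<close> inherit smoothness and decay from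
  \<open>h\<close>.\<close>

lemma iter_partial_snoc: "iter_partial (vs @ [v]) f = iter_partial vs (partial v f)"
  by (induction vs) (simp_all add: partial_def)

lemma partial_eq: "(f has_derivative f') (at z) \<Longrightarrow> partial v f z = f' v"
  by (metis partial_def frechet_derivative_at)

lemma partial_eqI: "(\<And>z. (f has_derivative f' z) (at z)) \<Longrightarrow> partial v f = (\<lambda>z. f' z v)"
  using partial_eq by blast

lemma has_derivative_partial:
  "f differentiable (at z) \<Longrightarrow> (f has_derivative (\<lambda>v. partial v f z)) (at z)"
  by (simp add: partial_def frechet_derivative_works[symmetric])

lemma iter_partial_in_closed_set:
  assumes "f \<in> C" "\<And>g v. g \<in> C \<Longrightarrow> v \<in> Basis \<Longrightarrow> partial v g \<in> C" "set vs \<subseteq> Basis"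
  shows "iter_partial vs f \<in> C"
  using assms(3) by (induction vs) (auto simp: iter_partial_Cons assms(1,2) simp del: iter_partial.simps(2))

text \<open>Smoothness by coinduction: a class closed under partial derivatives is the invariant, so
  no formula for higher derivatives of products or compositions is ever written down.\<close>

lemma smooth_coinduct:
  assumes "f \<in> C" "\<And>g v. g \<in> C \<Longrightarrow> v \<in> Basis \<Longrightarrow> partial v g \<in> C"
    and "\<And>g z. g \<in> C \<Longrightarrow> g differentiable (at z)"
  shows "smooth f"
  unfolding smooth_def using iter_partial_in_closed_set[OF assms(1,2)] assms(3) by blast

definition rapid :: "('a::real_normed_vector \<Rightarrow> 'b::real_normed_vector) \<Rightarrow> bool" where
  "rapid g \<longleftrightarrow> (\<forall>N. \<exists>B. \<forall>x. (1 + norm x) ^ N * norm (g x) \<le> B)"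

lemma rapidE:
  assumes "rapid g"
  shows "\<exists>B>0. \<forall>x. (1 + norm x) ^ N * norm (g x) \<le> B"
proof -
  obtain B where "\<And>x. (1 + norm x) ^ N * norm (g x) \<le> B"
    using assms by (auto simp: rapid_def)
  then have "\<And>x. (1 + norm x) ^ N * norm (g x) \<le> max B 1"
    by (meson max.coboundedI1)
  then show ?thesis by (intro exI[of _ "max B 1"]) auto
qed

lemma rapid_le:
  assumes "rapid g" "\<And>x. norm (h x) \<le> A * (1 + norm x) ^ M * norm (g x)"
  shows "rapid h"
  unfolding rapid_def
proof
  fix N
  obtain B where B: "B > 0" "\<And>x. (1 + norm x) ^ (N + M) * norm (g x) \<le> B"
    using rapidE[OF assms(1), of "N + M"] by blast
  have "(1 + norm x) ^ N * norm (h x) \<le> \<bar>A\<bar> * B" for x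
  proof -
    have "(1 + norm x) ^ N * norm (h x) \<le> (1 + norm x) ^ N * (A * (1 + norm x) ^ M * norm (g x))"
      by (intro mult_left_mono assms(2)) auto
    also have "\<dots> = A * ((1 + norm x) ^ (N + M) * norm (g x))"
      by (simp add: power_add)
    also have "\<dots> \<le> \<bar>A\<bar> * ((1 + norm x) ^ (N + M) * norm (g x))"
      by (intro mult_right_mono) auto
    also have "\<dots> \<le> \<bar>A\<bar> * B"
      by (intro mult_left_mono B) auto
    finally show ?thesis .
  qed
  then show "\<exists>B. \<forall>x. (1 + norm x) ^ N * norm (h x) \<le> B" by blast
qed

lemma rapid_add:
  assumes "rapid f" "rapid g"
  shows "rapid (\<lambda>x. f x + g x)"
  unfolding rapid_def
proof
  fix N
  obtain B where B: "B > 0" "\<And>x. (1 + norm x) ^ N * norm (f x) \<le> B"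
    using rapidE[OF assms(1), of N] by blast
  obtain B' where B': "B' > 0" "\<And>x. (1 + norm x) ^ N * norm (g x) \<le> B'"
    using rapidE[OF assms(2), of N] by blast
  have "(1 + norm x) ^ N * norm (f x + g x) \<le> B + B'" for x
  proof -
    have "(1 + norm x) ^ N * norm (f x + g x) \<le> (1 + norm x) ^ N * (norm (f x) + norm (g x))"
      by (intro mult_left_mono norm_triangle_ineq) auto
    then show ?thesis using B(2)[of x] B'(2)[of x] by (simp add: algebra_simps)
  qed
  then show "\<exists>B. \<forall>x. (1 + norm x) ^ N * norm (f x + g x) \<le> B" by blast
qed

lemma rapid_cmult: "rapid f \<Longrightarrow> rapid (\<lambda>x. c * f x :: complex)"
  by (rule rapid_le[where M=0 and A="norm c"]) (auto simp: norm_mult)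

lemma rapid_coord: "rapid f \<Longrightarrow> rapid (\<lambda>x. of_real (x \<bullet> v) * f x :: complex)"
proof (rule rapid_le[where M=1 and A="norm v"])
  fix x
  have "\<bar>x \<bullet> v\<bar> \<le> norm v * (1 + norm x)"
    using Cauchy_Schwarz_ineq2[of x v] by (simp add: algebra_simps add_increasing)
  then show "norm (of_real (x \<bullet> v) * f x) \<le> norm v * (1 + norm x) ^ 1 * norm (f x)"
    by (simp add: norm_mult mult_right_mono)
qed

lemma rapid_mult: 
  assumes "rapid f" "rapid g" shows "rapid (\<lambda>x. f x * g x :: complex)"
proof -
  obtain B where "B > 0" "\<And>x. (1 + norm x) ^ 0 * norm (f x) \<le> B" using rapidE[OF assms(1), of 0] by blast
  then show ?thesis
    by (intro rapid_le[OF assms(2), where M=0 and A=B]) (auto simp: norm_mult intro!: mult_right_mono)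
qed

lemma rapid_shift:
  assumes "rapid f" shows "rapid (\<lambda>x. f (x - d))"
  unfolding rapid_def
proof
  fix N
  obtain B where B: "B > 0" "\<And>x. (1 + norm x) ^ N * norm (f x) \<le> B"
    using rapidE[OF assms, of N] by blast
  have "(1 + norm x) ^ N * norm (f (x - d)) \<le> (1 + norm d) ^ N * B" for x
  proof -
    \<comment> \<open>Peetre's inequality.\<close>
    have "1 + norm x \<le> (1 + norm d) * (1 + norm (x - d))"
      using norm_triangle_sub[of x d] zero_le_mult_iff[of "norm d" "norm (x - d)"]
      by (simp only: distrib_left distrib_right mult_1 mult_1_right norm_ge_zero simp_thms)
    then have "(1 + norm x) ^ N \<le> (1 + norm d) ^ N * (1 + norm (x - d)) ^ N"
      by (metis power_mono power_mult_distrib norm_ge_zero add_nonneg_nonneg zero_le_one)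
    then have "(1 + norm x) ^ N * norm (f (x - d)) \<le> (1 + norm d) ^ N * ((1 + norm (x - d)) ^ N * norm (f (x - d)))"
      by (metis mult.assoc mult_right_mono norm_ge_zero)
    also have "\<dots> \<le> (1 + norm d) ^ N * B"
      by (intro mult_left_mono B) auto
    finally show ?thesis .
  qed
  then show "\<exists>B. \<forall>x. (1 + norm x) ^ N * norm (f (x - d)) \<le> B" by blast
qed

text \<open>The Schwartz functions on a Euclidean space; \<open>schwartz\<close> is the notion on the waveguide.\<close>

definition sfun :: "('a::euclidean_space \<Rightarrow> complex) \<Rightarrow> bool" where
  "sfun h \<longleftrightarrow> smooth h \<and> (\<forall>vs. set vs \<subseteq> Basis \<longrightarrow> rapid (iter_partial vs h))"

lemma sfun_coinduct:
  assumes "f \<in> C" "\<And>g v. g \<in> C \<Longrightarrow> v \<in> Basis \<Longrightarrow> partial v g \<in> C"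
    and "\<And>g z. g \<in> C \<Longrightarrow> g differentiable (at z)" and "\<And>g. g \<in> C \<Longrightarrow> rapid g"
  shows "sfun f"
  unfolding sfun_def
  using smooth_coinduct[OF assms(1,2,3)] iter_partial_in_closed_set[OF assms(1,2)] assms(4) by blast

lemma smooth_partial: "smooth h \<Longrightarrow> v \<in> Basis \<Longrightarrow> smooth (partial v h)"
  unfolding smooth_def iter_partial_snoc[symmetric] by auto

lemma smooth_differentiable: "smooth h \<Longrightarrow> h differentiable (at z)"
  unfolding smooth_def by (drule spec[of _ "[]"]) simp

lemma sfun_partial: "sfun h \<Longrightarrow> v \<in> Basis \<Longrightarrow> sfun (partial v h)"
  unfolding sfun_def by (simp add: smooth_partial) (simp add: iter_partial_snoc[symmetric])

lemma sfun_differentiable: "sfun h \<Longrightarrow> h differentiable (at z)"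
  by (simp add: sfun_def smooth_differentiable)

lemma sfun_rapid: "sfun h \<Longrightarrow> rapid h"
  unfolding sfun_def by (elim conjE, drule spec[of _ "[]"]) simp

lemma sfun_has_derivative: "sfun h \<Longrightarrow> (h has_derivative (\<lambda>v. partial v h z)) (at z)"
  by (simp add: has_derivative_partial sfun_differentiable)

lemma sfun_continuous_on: "sfun h \<Longrightarrow> continuous_on S h"
  by (meson continuous_at_imp_continuous_on differentiable_imp_continuous_within sfun_differentiable)

lemma sfun_borel_measurable: "sfun h \<Longrightarrow> h \<in> borel_measurable borel"
  by (simp add: borel_measurable_continuous_onI sfun_continuous_on)

lemma rapid_0: "rapid (\<lambda>_. 0)"
  by (auto simp: rapid_def)

lemma sfun_0: "sfun (\<lambda>_. 0)"
  by (rule sfun_coinduct[where C="{\<lambda>_. 0}"]) (auto simp: partial_def rapid_0)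

lemma sfun_add:
  assumes "sfun f" "sfun g" shows "sfun (\<lambda>x. f x + g x)"
proof (rule sfun_coinduct[where C="{\<lambda>x. f x + g x |f g. sfun f \<and> sfun g}"], goal_cases)
  case 1 then show ?case using assms by blast
next
  case (2 h v)
  then obtain f g where fg: "h = (\<lambda>x. f x + g x)" "sfun f" "sfun g" by blast
  have "partial v h = (\<lambda>x. partial v f x + partial v g x)"
    unfolding fg(1) by (intro partial_eqI has_derivative_add sfun_has_derivative fg)
  then show ?case using fg sfun_partial 2(2) by blast
next
  case 3 then show ?case by (auto intro!: differentiable_add[OF sfun_differentiable sfun_differentiable])
next
  case 4 then show ?case by (auto intro!: rapid_add[OF sfun_rapid sfun_rapid])
qed

lemma sfun_cmult:
  assumes "sfun f" shows "sfun (\<lambda>x. c * f x)"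
proof (rule sfun_coinduct[where C="{\<lambda>x. c * f x |f. sfun f}"], goal_cases)
  case 1 then show ?case using assms by blast
next
  case (2 h v)
  then obtain f where fg: "h = (\<lambda>x. c * f x)" "sfun f" by blast
  have "partial v h = (\<lambda>x. c * partial v f x)"
    unfolding fg(1) by (intro partial_eqI has_derivative_mult_right sfun_has_derivative fg)
  then show ?case using fg sfun_partial 2(2) by blast
next
  case 3 then show ?case by (auto intro!: differentiable_mult[OF _ sfun_differentiable])
next
  case 4 then show ?case by (auto intro!: rapid_cmult[OF sfun_rapid])
qed

lemma sfun_sum:
  assumes "\<And>i. i \<in> I \<Longrightarrow> sfun (f i)" shows "sfun (\<lambda>x. \<Sum>i\<in>I. f i x)"
  using assms by (induction I rule: infinite_finite_induct) (auto intro: sfun_0 sfun_add)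

lemma sfun_shift:
  assumes "sfun f" shows "sfun (\<lambda>x. f (x - d))"
proof (rule sfun_coinduct[where C="{\<lambda>x. f (x - d) |f. sfun f}"], goal_cases)
  case 1 then show ?case using assms by blast
next
  case (2 h v)
  then obtain f where fg: "h = (\<lambda>x. f (x - d))" "sfun f" by blast
  have "(h has_derivative (\<lambda>v. partial v f (x - d))) (at x)" for x
    unfolding fg(1) by (rule has_derivative_compose[OF _ sfun_has_derivative[OF fg(2)]])
      (auto intro!: derivative_eq_intros)
  then have "partial v h = (\<lambda>x. partial v f (x - d))"
    by (rule partial_eqI)
  then show ?case using fg sfun_partial 2(2) by blast
next
  case (3 h z)
  then obtain f where fg: "h = (\<lambda>x. f (x - d))" "sfun f" by blast
  have "(h has_derivative (\<lambda>v. partial v f (z - d))) (at z)"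
    unfolding fg(1) by (rule has_derivative_compose[OF _ sfun_has_derivative[OF fg(2)]])
      (auto intro!: derivative_eq_intros)
  then show ?case by (rule differentiableI)
next
  case 4 then show ?case by (auto intro!: rapid_shift[OF sfun_rapid])
qed

lemma sfun_coord:
  assumes "sfun f" shows "sfun (\<lambda>x. of_real (x \<bullet> v) * f x)"
proof -
  have coord: "((\<lambda>x. complex_of_real (x \<bullet> v)) has_derivative (\<lambda>w. of_real (w \<bullet> v))) (at x)" for x :: 'a
    by (rule has_derivative_of_real[OF has_derivative_inner_left[OF has_derivative_ident]])
  have der: "((\<lambda>x. of_real (x \<bullet> v) * f x + g x) has_derivative
      (\<lambda>w. of_real (x \<bullet> v) * partial w f x + of_real (w \<bullet> v) * f x + partial w g x)) (at x)"
    if "sfun f" "sfun g" for f g x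
    by (rule has_derivative_add[OF has_derivative_mult[OF coord sfun_has_derivative[OF that(1)]]
          sfun_has_derivative[OF that(2)]])
  show ?thesis
  \<comment> \<open>Differentiating the coordinate leaves a term without it; the summand
    \<open>g\<close> collects these terms and closes the class.\<close>
  proof (rule sfun_coinduct[where C="{\<lambda>x. of_real (x \<bullet> v) * f x + g x |f g. sfun f \<and> sfun g}"], goal_cases)
    case 1 show ?case
      by (intro CollectI exI[of _ f] exI[of _ "\<lambda>_. 0"]) (simp add: assms sfun_0)
  next
    case (2 h w)
    then obtain f g where fg: "h = (\<lambda>x. of_real (x \<bullet> v) * f x + g x)" "sfun f" "sfun g" by blast
    have "partial w h = (\<lambda>x. of_real (x \<bullet> v) * partial w f x + (of_real (w \<bullet> v) * f x + partial w g x))"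
      unfolding fg(1) add.assoc[symmetric] by (rule partial_eqI[OF der[OF fg(2,3)]])
    moreover have "sfun (partial w f)" "sfun (\<lambda>x. of_real (w \<bullet> v) * f x + partial w g x)"
      by (rule sfun_partial[OF fg(2) 2(2)], rule sfun_add[OF sfun_cmult[OF fg(2)] sfun_partial[OF fg(3) 2(2)]])
    ultimately show ?case
      by (intro CollectI exI[of _ "partial w f"] exI[of _ "\<lambda>x. of_real (w \<bullet> v) * f x + partial w g x"] conjI)
  next
    case (3 h z)
    then obtain f g where fg: "h = (\<lambda>x. of_real (x \<bullet> v) * f x + g x)" "sfun f" "sfun g" by blast
    show ?case unfolding fg(1) by (rule differentiableI[OF der[OF fg(2,3)]])
  next
    case (4 h)
    then obtain f g where fg: "h = (\<lambda>x. of_real (x \<bullet> v) * f x + g x)" "sfun f" "sfun g" by blast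
    show ?case unfolding fg(1) by (rule rapid_add[OF rapid_coord[OF sfun_rapid] sfun_rapid]) (rule fg)+
  qed
qed

text \<open>The Leibniz rule leads out of the set of single products but not out of its closure
  under sums, which is therefore the invariant for \<open>sfun_mult\<close>.\<close>

inductive_set sfun_products :: "('a::euclidean_space \<Rightarrow> complex) set" where
  prod: "sfun f \<Longrightarrow> sfun g \<Longrightarrow> (\<lambda>x. f x * g x) \<in> sfun_products"
| add: "f \<in> sfun_products \<Longrightarrow> g \<in> sfun_products \<Longrightarrow> (\<lambda>x. f x + g x) \<in> sfun_products"

lemma sfun_products_differentiable: "h \<in> sfun_products \<Longrightarrow> h differentiable (at z)"
  by (induction rule: sfun_products.induct) (auto intro!: differentiable_mult[OF sfun_differentiable sfun_differentiable] differentiable_add)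

lemma sfun_mult:
  assumes "sfun f" "sfun g" shows "sfun (\<lambda>x. f x * g x)"
proof (rule sfun_coinduct[where C=sfun_products], goal_cases)
  case 1 then show ?case using assms by (rule sfun_products.prod)
next
  case (2 h v)
  then show ?case
  proof (induction rule: sfun_products.induct)
    case (prod f g)
    have "partial v (\<lambda>x. f x * g x) = (\<lambda>x. f x * partial v g x + partial v f x * g x)"
      by (intro partial_eqI has_derivative_mult sfun_has_derivative prod)
    then show ?case using prod by (auto intro!: sfun_products.intros sfun_partial)
  next
    case (add f g)
    have "partial v (\<lambda>x. f x + g x) = (\<lambda>x. partial v f x + partial v g x)"
      by (intro partial_eqI has_derivative_add has_derivative_partial sfun_products_differentiable add)
    then show ?case using add by (auto intro!: sfun_products.intros)
  qed
next
  case 3 then show ?case by (rule sfun_products_differentiable)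
next
  case 4 then show ?case
    by (induction rule: sfun_products.induct) (auto intro!: rapid_mult[OF sfun_rapid sfun_rapid] rapid_add)
qed

section \<open>Slices of compactly supported smooth functions\<close>

lemma iter_partial_zero_on_open:
  assumes "open U" "\<And>z. z \<in> U \<Longrightarrow> f z = 0" "z \<in> U"
  shows "iter_partial vs f z = 0"
  using assms(3)
proof (induction vs arbitrary: z)
  case (Cons v vs)
  have "((\<lambda>_. 0) has_derivative (\<lambda>_. 0)) (at z)" by simp
  then have "(iter_partial vs f has_derivative (\<lambda>_. 0)) (at z)"
    by (rule has_derivative_transform_within_open[OF _ assms(1) Cons.prems]) (simp add: Cons.IH)
  then show ?case unfolding iter_partial_Cons by (simp add: partial_eq)
qed (use assms in auto)

lemma rapid_compact_support:
  fixes f :: "'a::euclidean_space \<Rightarrow> 'b::real_normed_vector"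
  assumes "continuous_on UNIV f" "\<And>x. norm x > R \<Longrightarrow> f x = 0"
  shows "rapid f"
  unfolding rapid_def
proof
  fix N
  have "bounded ((\<lambda>x. (1 + norm x) ^ N * norm (f x)) ` cball 0 R)"
    by (intro compact_imp_bounded compact_continuous_image continuous_intros
        continuous_on_subset[OF assms(1)]) auto
  then obtain B where B: "\<forall>t \<in> (\<lambda>x. (1 + norm x) ^ N * norm (f x)) ` cball 0 R. norm t \<le> B"
    unfolding bounded_iff by blast
  have "(1 + norm x) ^ N * norm (f x) \<le> max B 0" for x
    using B assms(2)[of x] by (cases "norm x \<le> R") (auto simp: le_max_iff_disj)
  then show "\<exists>B. \<forall>x. (1 + norm x) ^ N * norm (f x) \<le> B" by blast
qed

text \<open>A derivative of the slice in direction \<open>v\<close> is the slice of the derivative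
  in direction \<open>(0, v)\<close>, so the slices of all iterated partial derivatives form an
  invariant class. Their decay is trivial because derivatives vanish wherever the function vanishes
  on an open set.\<close>

lemma sfun_section:
  fixes \<sigma> :: "'a::euclidean_space \<times> 'b::euclidean_space \<Rightarrow> real"
  assumes "smooth \<sigma>" "\<And>x. norm x > R \<Longrightarrow> \<sigma> x = 0"
  shows "sfun (\<lambda>y. complex_of_real (\<sigma> (0, y)))"
proof -
  have der: "((\<lambda>y. complex_of_real (iter_partial vs \<sigma> (0, y))) has_derivative
      (\<lambda>v. of_real (partial (0, v) (iter_partial vs \<sigma>) (0, y)))) (at y)" if "set vs \<subseteq> Basis" for vs y
  proof -
    let ?D = "\<lambda>v. partial v (iter_partial vs \<sigma>) (0, y)"
    have "(iter_partial vs \<sigma> has_derivative ?D) (at (0, y))"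
      using assms(1) that by (intro has_derivative_partial) (auto simp: smooth_def)
    moreover have "((\<lambda>y :: 'b. (0 :: 'a, y)) has_derivative (\<lambda>v. (0, v))) (at y)"
      by (intro derivative_intros)
    ultimately have "((\<lambda>y. iter_partial vs \<sigma> (0, y)) has_derivative (\<lambda>v. ?D (0, v))) (at y)"
      by (rule has_derivative_compose[of "\<lambda>y. (0, y)" "\<lambda>v. (0, v)" y UNIV "iter_partial vs \<sigma>" ?D, rotated])
    then show ?thesis by (rule has_derivative_of_real)
  qed
  show ?thesis
  proof (rule sfun_coinduct[where C="{\<lambda>y. complex_of_real (iter_partial vs \<sigma> (0, y)) |vs. set vs \<subseteq> Basis}"], goal_cases)
    case 1 show ?case by (rule CollectI, rule exI[of _ "[]"]) simp
  next
    case (2 h v)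
    then obtain vs where vs: "h = (\<lambda>y. complex_of_real (iter_partial vs \<sigma> (0, y)))" "set vs \<subseteq> Basis" by blast
    have "partial v h = (\<lambda>y. of_real (iter_partial ((0, v) # vs) \<sigma> (0, y)))"
      unfolding vs(1) iter_partial_Cons by (rule partial_eqI[OF der[OF vs(2)]])
    moreover have "set ((0, v) # vs) \<subseteq> Basis" using vs(2) 2(2) by (auto simp: Basis_prod_def)
    ultimately show ?case by (intro CollectI exI[of _ "(0, v) # vs"] conjI)
  next
    case (3 h z)
    then obtain vs where vs: "h = (\<lambda>y. complex_of_real (iter_partial vs \<sigma> (0, y)))" "set vs \<subseteq> Basis" by blast
    show ?case unfolding vs(1) by (rule differentiableI, rule der[OF vs(2)])
  next
    case (4 h)
    then obtain vs where vs: "h = (\<lambda>y. complex_of_real (iter_partial vs \<sigma> (0, y)))" "set vs \<subseteq> Basis" by blast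
    have "continuous_on UNIV h"
      unfolding vs(1) by (intro continuous_at_imp_continuous_on ballI has_derivative_continuous[OF der[OF vs(2)]])
    moreover have "h y = 0" if "norm y > R" for y
    proof -
      have "open {x :: 'a \<times> 'b. norm x > R}"
        by (intro open_Collect_less continuous_intros)
      from iter_partial_zero_on_open[OF this, of \<sigma> "(0, y)" vs] show ?thesis
        using assms(2) that by (simp add: vs(1) norm_Pair)
    qed
    ultimately show ?case by (rule rapid_compact_support)
  qed
qed

section \<open>The inverse Fourier transform\<close>

lemma nn_integral_inverse_1_plus_square: "(\<integral>\<^sup>+t. ennreal (inverse (1 + t\<^sup>2)) \<partial>lborel) < \<infinity>"
proof -
  have "set_integrable lborel UNIV (\<lambda>t :: real. inverse (1 + t\<^sup>2))"
    using integrable_inverse_1_plus_square by simp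
  then show ?thesis
    by (simp add: set_integrable_def integrable_iff_bounded)
qed

lemma norm_integral_le:
  fixes f :: "'a \<Rightarrow> 'b::{banach, second_countable_topology}"
  assumes "integrable M g" "\<And>x. norm (f x) \<le> g x"
  shows "norm (LINT x|M. f x) \<le> (LINT x|M. g x)"
proof -
  have "norm (LINT x|M. f x) \<le> (LINT x|M. norm (f x))" by (rule integral_norm_bound)
  also have "\<dots> \<le> (LINT x|M. g x)"
    using assms order_trans[OF norm_ge_zero assms(2)] by (intro integral_mono') auto
  finally show ?thesis .
qed

text \<open>Each factor 1 + x_b^2 is at most (1 + |x|)^2, so the function lies below a product of
  one-dimensional integrable functions. This is the origin of the decay exponent
  \<open>2 * DIM('a)\<close> used throughout, and it avoids polar coordinates.\<close>

lemma integrable_polynomial_decay: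
  "integrable lborel (\<lambda>x :: 'a::euclidean_space. 1 / (1 + norm x) ^ (2 * DIM('a)))"
proof (rule Bochner_Integration.integrable_bound)
  let ?w = "\<lambda>x :: 'a. \<Prod>b\<in>Basis. inverse (1 + (x \<bullet> b)\<^sup>2)"
  have "(\<integral>\<^sup>+x. ennreal (?w x) \<partial>lborel) = (\<integral>\<^sup>+x. (\<Prod>b\<in>Basis. ennreal (inverse (1 + (x \<bullet> b)\<^sup>2))) \<partial>(lborel :: 'a measure))"
    by (simp add: prod_ennreal)
  also have "\<dots> = (\<Prod>b\<in>(Basis :: 'a set). \<integral>\<^sup>+t. ennreal (inverse (1 + t\<^sup>2)) \<partial>lborel)"
    by (subst nn_integral_lborel_prod[where f="\<lambda>_ t. ennreal (inverse (1 + t\<^sup>2))"]) auto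
  also have "\<dots> < \<infinity>"
    using nn_integral_inverse_1_plus_square by (simp add: ennreal_prod_eq_top less_top[symmetric] power_eq_top_ennreal)
  finally show "integrable lborel ?w"
    by (intro integrableI_bounded) (auto simp: prod_nonneg)
  show "AE x in lborel. norm (1 / (1 + norm x) ^ (2 * DIM('a))) \<le> norm (?w x)"
  proof (rule AE_I2)
    fix x :: 'a
    have "inverse ((1 + norm x)\<^sup>2) \<le> inverse (1 + (x \<bullet> b)\<^sup>2)" if "b \<in> Basis" for b
    proof (rule le_imp_inverse_le)
      have "(x \<bullet> b)\<^sup>2 \<le> (norm x)\<^sup>2"
        using Basis_le_norm[OF that, of x] by (simp add: abs_le_square_iff[symmetric])
      then show "1 + (x \<bullet> b)\<^sup>2 \<le> (1 + norm x)\<^sup>2" by (simp add: power2_sum add_increasing2)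
    qed (simp add: add_pos_nonneg)
    then have "(\<Prod>b\<in>(Basis :: 'a set). inverse ((1 + norm x)\<^sup>2)) \<le> ?w x"
      by (intro prod_mono) auto
    then show "norm (1 / (1 + norm x) ^ (2 * DIM('a))) \<le> norm (?w x)"
      by (simp add: prod_nonneg power_mult inverse_eq_divide power_one_over abs_of_nonneg)
  qed
qed auto

lemma integrable_rapid:
  fixes h :: "'a::euclidean_space \<Rightarrow> 'b::{banach, second_countable_topology}"
  assumes "rapid h" "h \<in> borel_measurable borel"
  shows "integrable lborel h"
proof -
  obtain B where B: "B > 0" "\<And>x. (1 + norm x) ^ (2 * DIM('a)) * norm (h x) \<le> B"
    using rapidE[OF assms(1), of "2 * DIM('a)"] by blast
  show ?thesis
  proof (rule Bochner_Integration.integrable_bound)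
    show "integrable lborel (\<lambda>x :: 'a. B * (1 / (1 + norm x) ^ (2 * DIM('a))))"
      by (intro integrable_mult_right integrable_polynomial_decay)
    show "AE x in lborel. norm (h x) \<le> norm (B * (1 / (1 + norm x) ^ (2 * DIM('a))))"
    proof (rule AE_I2)
      fix x :: 'a
      have "(1 + norm x) ^ (2 * DIM('a)) > 0" by (simp add: add_pos_nonneg)
      then show "norm (h x) \<le> norm (B * (1 / (1 + norm x) ^ (2 * DIM('a))))"
        using B(2)[of x] B(1) by (simp add: field_simps)
    qed
  qed (use assms in simp)
qed

lemma sfun_integrable: "sfun h \<Longrightarrow> integrable lborel h"
  by (simp add: integrable_rapid sfun_rapid sfun_borel_measurable)

text \<open>The inverse Fourier transform, without a factor, since \<open>fourier\<close> carries all powers of \<open>2\<pi>\<close>.\<close>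

definition ift :: "('a::euclidean_space \<Rightarrow> complex) \<Rightarrow> 'a \<Rightarrow> complex" where
  "ift h y = (LINT \<xi>|lborel. h \<xi> * cis (\<xi> \<bullet> y))"

lemma borel_measurable_cis [measurable (raw)]:
  "f \<in> borel_measurable M \<Longrightarrow> (\<lambda>x. cis (f x)) \<in> borel_measurable M"
  using measurable_compose[of f M borel cis borel]
  by (simp add: borel_measurable_continuous_onI continuous_on_cis)

lemma integrable_mult_cis:
  assumes "integrable M h" "f \<in> borel_measurable M"
  shows "integrable M (\<lambda>x. h x * cis (f x))"
  by (rule Bochner_Integration.integrable_bound[OF assms(1)]) (use assms in \<open>auto simp: norm_mult\<close>)

lemma integrable_ift [intro]: "integrable lborel h \<Longrightarrow> integrable lborel (\<lambda>\<xi>. h \<xi> * cis (\<xi> \<bullet> y))"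
  by (rule integrable_mult_cis) auto

lemma norm_ift_le: "norm (ift h y) \<le> (LINT \<xi>|lborel. norm (h \<xi>))"
  unfolding ift_def by (rule order_trans[OF integral_norm_bound]) (simp add: norm_mult)

lemma ift_add:
  assumes "integrable lborel f" "integrable lborel g"
  shows "ift (\<lambda>\<xi>. f \<xi> + g \<xi>) y = ift f y + ift g y"
  unfolding ift_def
  by (simp add: distrib_right Bochner_Integration.integral_add[OF integrable_ift[OF assms(1)] integrable_ift[OF assms(2)]])

lemma ift_cmult: "ift (\<lambda>\<xi>. c * f \<xi>) y = c * ift f y"
  unfolding ift_def by (simp add: mult.assoc)

lemma ift_sum:
  assumes "\<And>i. i \<in> I \<Longrightarrow> integrable lborel (f i)"
  shows "ift (\<lambda>\<xi>. \<Sum>i\<in>I. f i \<xi>) y = (\<Sum>i\<in>I. ift (f i) y)"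
  unfolding ift_def sum_distrib_right
  by (rule Bochner_Integration.integral_sum) (use assms in auto)

lemma norm_cis_taylor2: "norm (cis b - 1 - \<i> * of_real b) \<le> b\<^sup>2"
proof -
  have "cmod (cis b - 1 - \<i> * of_real b) \<le> b\<^sup>2 / 2"
    using iexp_approx1[of b 1] by (simp add: cis_conv_exp numeral_2_eq_2 algebra_simps)
  then show ?thesis using zero_le_power2[of b] by linarith
qed

lemma rapid_norm_power:
  "rapid h \<Longrightarrow> rapid (\<lambda>x. norm x ^ M * norm (h x))"
proof (rule rapid_le[where A=1 and M=M])
  fix x
  show "norm (norm x ^ M * norm (h x)) \<le> 1 * (1 + norm x) ^ M * norm (h x)"
    by (auto intro!: mult_right_mono power_mono)
qed

lemma sfun_integrable_norm_power:
  assumes "sfun h" shows "integrable lborel (\<lambda>x. norm x ^ M * norm (h x))"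
  by (intro integrable_rapid rapid_norm_power sfun_rapid assms)
    (use sfun_borel_measurable[OF assms] in measurable)

text \<open>The second-order Taylor remainder of \<open>cis\<close> bounds the error by the second
  moment of \<open>h\<close> times the square of the increment, so total differentiability follows
  at once and not merely the existence of partial derivatives.\<close>

lemma ift_has_derivative:
  assumes h: "sfun h"
  shows "(ift h has_derivative (\<lambda>v. ift (\<lambda>\<xi>. \<i> * (of_real (\<xi> \<bullet> v) * h \<xi>)) y)) (at y)"
proof -
  let ?D = "\<lambda>v. ift (\<lambda>\<xi>. \<i> * (of_real (\<xi> \<bullet> v) * h \<xi>)) y"
  let ?K = "LINT \<xi>|lborel. norm \<xi> ^ 2 * norm (h \<xi>)"
  have int: "integrable lborel (\<lambda>\<xi>. \<i> * (of_real (\<xi> \<bullet> v) * h \<xi>))" for v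
    by (intro sfun_integrable sfun_cmult sfun_coord h)
  have lin: "linear ?D"
  proof (rule linearI)
    show "?D (u + v) = ?D u + ?D v" for u v
      by (subst ift_add[OF int int, symmetric]) (simp add: inner_add_right algebra_simps)
    show "?D (r *\<^sub>R v) = r *\<^sub>R ?D v" for r v
      unfolding scaleR_conv_of_real by (subst ift_cmult[symmetric]) (simp add: algebra_simps)
  qed
  show ?thesis
  proof (rule has_derivativeI_sandwich[where e=1 and H="\<lambda>z. ?K * norm (z - y)"])
    show "bounded_linear ?D" using lin by (simp add: linear_conv_bounded_linear)
    fix z assume z: "z \<noteq> y"
    have *: "ift h z - ift h y - ?D (z - y) =
        (LINT \<xi>|lborel. h \<xi> * cis (\<xi> \<bullet> y) * (cis (\<xi> \<bullet> (z - y)) - 1 - \<i> * of_real (\<xi> \<bullet> (z - y))))"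
      unfolding ift_def
      apply (subst Bochner_Integration.integral_diff[symmetric])
      apply (intro integrable_ift sfun_integrable h)
      apply (intro integrable_ift sfun_integrable h)
      apply (subst Bochner_Integration.integral_diff[symmetric])
      apply (intro Bochner_Integration.integrable_diff integrable_ift sfun_integrable h)
      apply (intro integrable_ift int)
      apply (intro Bochner_Integration.integral_cong refl)
      apply (simp add: algebra_simps cis_mult inner_diff_right)
      done
    have "norm (ift h z - ift h y - ?D (z - y)) \<le> (LINT \<xi>|lborel. (norm (z - y))\<^sup>2 * (norm \<xi> ^ 2 * norm (h \<xi>)))"
      unfolding *
    proof (rule norm_integral_le)
      show "integrable lborel (\<lambda>\<xi>. (norm (z - y))\<^sup>2 * (norm \<xi> ^ 2 * norm (h \<xi>)))"
        by (intro integrable_mult_right sfun_integrable_norm_power h)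
      fix \<xi>
      have "norm (cis (\<xi> \<bullet> (z - y)) - 1 - \<i> * of_real (\<xi> \<bullet> (z - y))) \<le> (\<xi> \<bullet> (z - y))\<^sup>2"
        by (rule norm_cis_taylor2)
      also have "\<dots> \<le> (norm \<xi> * norm (z - y))\<^sup>2"
        by (simp add: abs_le_square_iff[symmetric] abs_mult Cauchy_Schwarz_ineq2)
      finally show "norm (h \<xi> * cis (\<xi> \<bullet> y) * (cis (\<xi> \<bullet> (z - y)) - 1 - \<i> * of_real (\<xi> \<bullet> (z - y))))
           \<le> (norm (z - y))\<^sup>2 * ((norm \<xi>)\<^sup>2 * cmod (h \<xi>))"
        by (simp add: norm_mult power_mult_distrib mult.commute mult_left_mono mult.left_commute)
    qed
    then have "norm (ift h z - ift h y - ?D (z - y)) \<le> (?K * norm (z - y)) * norm (z - y)"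
      by (subst (asm) integral_mult_right_zero) (simp add: power2_eq_square mult_ac)
    then show "norm (ift h z - ift h y - ?D (z - y)) / norm (z - y) \<le> ?K * norm (z - y)"
      using z by (subst pos_divide_le_eq) simp_all
  next
    show "((\<lambda>z. ?K * norm (z - y)) \<longlongrightarrow> 0) (at y)"
      by (auto intro!: tendsto_eq_intros)
  qed auto
qed

lemma continuous_on_ift: "sfun h \<Longrightarrow> continuous_on S (ift h)"
  by (intro continuous_at_imp_continuous_on ballI has_derivative_continuous[OF ift_has_derivative])

lemma borel_measurable_ift: "sfun h \<Longrightarrow> ift h \<in> borel_measurable borel"
  by (intro borel_measurable_continuous_onI continuous_on_ift)

lemma integral_lborel_shift:
  fixes f :: "'a::euclidean_space \<Rightarrow> 'b::{banach, second_countable_topology}"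
  assumes [measurable]: "f \<in> borel_measurable borel"
  shows "(LINT x|lborel. f (c + x)) = (LINT x|lborel. f x)"
  using integral_distr[of "(+) c" lborel borel f] by (simp add: lborel_distr_plus)

lemma integral_lborel_scale:
  fixes f :: "'a::euclidean_space \<Rightarrow> 'b::{banach, second_countable_topology}"
  assumes [measurable]: "f \<in> borel_measurable borel" and "c > 0"
  shows "(LINT x|lborel. f x) = c ^ DIM('a) *\<^sub>R (LINT x|lborel. f (c *\<^sub>R x))"
  by (subst lborel_affine[of c 0]) (use assms(2) in \<open>simp_all add: integral_density integral_distr\<close>)


lemma sfun_has_vector_derivative_line:
  assumes h: "sfun h"
  shows "((\<lambda>t. h (x + t *\<^sub>R v)) has_vector_derivative partial v h (x + t *\<^sub>R v)) (at t)"
proof -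
  have 1: "((\<lambda>t. x + t *\<^sub>R v) has_derivative (\<lambda>u. u *\<^sub>R v)) (at t)"
    by (auto intro!: derivative_eq_intros)
  have "((\<lambda>t. h (x + t *\<^sub>R v)) has_derivative (\<lambda>u. partial (u *\<^sub>R v) h (x + t *\<^sub>R v))) (at t)"
    by (rule has_derivative_compose[OF 1 sfun_has_derivative[OF h]])
  moreover have "partial (u *\<^sub>R v) h z = u *\<^sub>R partial v h z" for u z
    by (rule linear_cmul[OF has_derivative_linear[OF sfun_has_derivative[OF h]]])
  ultimately show ?thesis by (simp add: has_vector_derivative_def)
qed

lemma has_vector_derivative_difference_quotient:
  assumes "(f has_vector_derivative D) (at 0)" "filterlim s (at 0) F"
  shows "((\<lambda>n. (f (s n) - f 0) /\<^sub>R s n) \<longlongrightarrow> D) F"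
proof -
  have "((\<lambda>t. norm (f (0 + t) - f 0 - t *\<^sub>R D) / norm t) \<longlongrightarrow> 0) (at 0)"
    using assms(1) by (simp add: has_vector_derivative_def has_derivative_at)
  then have "((\<lambda>t. norm ((f t - f 0) /\<^sub>R t - D)) \<longlongrightarrow> 0) (at 0)"
  proof (rule Lim_transform_eventually)
    show "\<forall>\<^sub>F t in at 0. norm (f (0 + t) - f 0 - t *\<^sub>R D) / norm t = norm ((f t - f 0) /\<^sub>R t - D)"
    proof (rule eventually_at_filter[THEN iffD2], rule always_eventually, intro allI impI)
      fix t :: real assume "t \<noteq> 0"
      then have "(f t - f 0) /\<^sub>R t - D = (f t - f 0 - t *\<^sub>R D) /\<^sub>R t"
        by (simp add: scaleR_diff_right)
      then show "norm (f (0 + t) - f 0 - t *\<^sub>R D) / norm t = norm ((f t - f 0) /\<^sub>R t - D)"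
        by (simp add: divide_inverse)
    qed
  qed
  then have "((\<lambda>t. (f t - f 0) /\<^sub>R t) \<longlongrightarrow> D) (at 0)"
    by (rule LIM_zero_cancel[OF tendsto_norm_zero_cancel])
  then show ?thesis by (rule filterlim_compose[OF _ assms(2)])
qed

lemma norm_diff_le_partial:
  assumes h: "sfun h" and "0 \<le> s"
    and B: "\<And>t. 0 \<le> t \<Longrightarrow> t \<le> s \<Longrightarrow> norm (partial v h (x + t *\<^sub>R v)) \<le> B"
  shows "norm (h (x + s *\<^sub>R v) - h x) \<le> B * s"
proof (cases "s = 0")
  case False
  then have "0 < s" using assms(2) by simp
  note der = sfun_has_vector_derivative_line[OF h, of x v]
  have "norm (h (x + s *\<^sub>R v) - h (x + 0 *\<^sub>R v)) \<le> B * s - B * 0"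
  proof (rule differentiable_bound_general[OF \<open>0 < s\<close>, where \<phi>="\<lambda>t. B * t"])
    show "continuous_on {0..s} (\<lambda>t. h (x + t *\<^sub>R v))"
      using der by (intro continuous_at_imp_continuous_on ballI has_vector_derivative_continuous)
    show "((\<lambda>t. B * t) has_vector_derivative B) (at t)" for t
      by (auto intro!: derivative_eq_intros)
  qed (use der B in \<open>auto intro!: continuous_intros\<close>)
  then show ?thesis by simp
qed simp

lemma ift_shift: 
  assumes [measurable]: "h \<in> borel_measurable borel"
  shows "ift (\<lambda>\<xi>. h (\<xi> + a)) y = cis (- (a \<bullet> y)) * ift h y"
proof -
  have "ift h y = (LINT \<xi>|lborel. h (a + \<xi>) * cis ((a + \<xi>) \<bullet> y))"
    unfolding ift_def by (rule integral_lborel_shift[symmetric]) measurable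
  also have "\<dots> = (LINT \<xi>|lborel. cis (a \<bullet> y) * (h (\<xi> + a) * cis (\<xi> \<bullet> y)))"
    by (intro Bochner_Integration.integral_cong refl) (simp add: inner_add_left cis_mult add.commute mult.left_commute)
  also have "\<dots> = cis (a \<bullet> y) * ift (\<lambda>\<xi>. h (\<xi> + a)) y"
    unfolding ift_def by simp
  finally show ?thesis by (simp add: cis_mult mult.assoc[symmetric])
qed

text \<open>Integration by parts obtained from translation: \<open>ift_shift\<close> evaluates the
  transform of a difference quotient exactly, and both sides are passed to the limit, the left one
  by dominated convergence.\<close>

lemma ift_partial:
  assumes h: "sfun h" and v: "v \<in> Basis"
  shows "ift (partial v h) y = - \<i> * of_real (y \<bullet> v) * ift h y"
proof -
  let ?s = "\<lambda>n. inverse (real (Suc n))"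
  let ?M = "2 * DIM('a)"
  from rapidE[OF sfun_rapid[OF sfun_partial[OF h v]], of ?M]
  obtain B where "B > 0 \<and> (\<forall>x. (1 + norm x) ^ ?M * norm (partial v h x) \<le> B)" by (rule exE)
  then have B: "B > 0" "\<And>x. (1 + norm x) ^ ?M * norm (partial v h x) \<le> B" by simp_all
  have h_m: "(\<lambda>x. h (x + c)) \<in> borel_measurable borel" for c
    using sfun_borel_measurable[OF sfun_shift[OF h, of "- c"]] by simp
  have cis_m: "(\<lambda>x. cis (x \<bullet> y)) \<in> borel_measurable borel"
    by (intro borel_measurable_cis borel_measurable_continuous_onI continuous_intros)
  have bound: "norm (h (x + s *\<^sub>R v) - h x) \<le> 2 ^ ?M * B * (1 / (1 + norm x) ^ ?M) * s" if "0 \<le> s" "s \<le> 1" for s x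
  proof (rule norm_diff_le_partial[OF h that(1)])
    fix t :: real assume t: "0 \<le> t" "t \<le> s"
    have "norm x \<le> norm (x + t *\<^sub>R v) + t"
      using norm_triangle_ineq4[of "x + t *\<^sub>R v" "t *\<^sub>R v"] t v by simp
    \<comment> \<open>Moving by at most 1 changes 1 + |x| by a factor of at most 2; this gives one
      integrable majorant for all difference quotients.\<close>
    then have "1 + norm x \<le> 2 * (1 + norm (x + t *\<^sub>R v))"
      using t that norm_ge_zero[of "x + t *\<^sub>R v"] by argo
    then have "(1 + norm x) ^ ?M \<le> (2 * (1 + norm (x + t *\<^sub>R v))) ^ ?M"
      by (intro power_mono) auto
    then have "(1 + norm x) ^ ?M * norm (partial v h (x + t *\<^sub>R v))
      \<le> (2 * (1 + norm (x + t *\<^sub>R v))) ^ ?M * norm (partial v h (x + t *\<^sub>R v))"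
      by (rule mult_right_mono) simp
    also have "\<dots> = 2 ^ ?M * ((1 + norm (x + t *\<^sub>R v)) ^ ?M * norm (partial v h (x + t *\<^sub>R v)))"
      by (simp only: power_mult_distrib mult.assoc)
    also have "\<dots> \<le> 2 ^ ?M * B"
      by (intro mult_left_mono B) auto
    finally show "norm (partial v h (x + t *\<^sub>R v)) \<le> 2 ^ ?M * B * (1 / (1 + norm x) ^ ?M)"
      by (simp add: field_simps add_pos_nonneg)
  qed
  let ?q = "\<lambda>n \<xi>. (h (\<xi> + ?s n *\<^sub>R v) - h \<xi>) / of_real (?s n)"
  have s0: "filterlim ?s (at 0) sequentially"
    using LIMSEQ_inverse_real_of_nat by (auto simp: filterlim_at)
  have lim1: "(\<lambda>n. ift (?q n) y) \<longlonglongrightarrow> ift (partial v h) y"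
    unfolding ift_def
  proof (rule integral_dominated_convergence[where w="\<lambda>x. 2 ^ ?M * B * (1 / (1 + norm x) ^ ?M)"])
    show "integrable lborel (\<lambda>x :: 'a. 2 ^ ?M * B * (1 / (1 + norm x) ^ ?M))"
      by (intro integrable_mult_right integrable_polynomial_decay)
    show "AE x in lborel. norm (?q n x * cis (x \<bullet> y)) \<le> 2 ^ ?M * B * (1 / (1 + norm x) ^ ?M)" for n
    proof (rule AE_I2)
      fix x
      have "?s n \<le> 1" "0 < ?s n" by (auto simp: field_simps)
      then show "norm (?q n x * cis (x \<bullet> y)) \<le> 2 ^ ?M * B * (1 / (1 + norm x) ^ ?M)"
        using bound[of "?s n" x] by (simp add: norm_mult norm_divide norm_inverse pos_divide_le_eq norm_of_nat del: of_nat_Suc)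
    qed
    show "AE x in lborel. (\<lambda>n. ?q n x * cis (x \<bullet> y)) \<longlonglongrightarrow> partial v h x * cis (x \<bullet> y)"
    proof (rule AE_I2)
      fix x
      have "((\<lambda>t. h (x + t *\<^sub>R v)) has_vector_derivative partial v h x) (at 0)"
        using sfun_has_vector_derivative_line[OF h, of x v 0] by simp
      from has_vector_derivative_difference_quotient[OF this s0]
      have "(\<lambda>n. (h (x + ?s n *\<^sub>R v) - h x) /\<^sub>R ?s n) \<longlonglongrightarrow> partial v h x"
        by simp
      then have "(\<lambda>n. ?q n x) \<longlonglongrightarrow> partial v h x"
        by (simp add: scaleR_conv_of_real divide_inverse mult.commute del: of_nat_Suc)
      then show "(\<lambda>n. ?q n x * cis (x \<bullet> y)) \<longlonglongrightarrow> partial v h x * cis (x \<bullet> y)"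
        by (intro tendsto_mult tendsto_const)
    qed
    show "(\<lambda>x. partial v h x * cis (x \<bullet> y)) \<in> borel_measurable lborel"
      by (simp, intro borel_measurable_times cis_m sfun_borel_measurable sfun_partial h v)
    show "(\<lambda>x. ?q n x * cis (x \<bullet> y)) \<in> borel_measurable lborel" for n
      by (simp only: measurable_lborel2, intro borel_measurable_times borel_measurable_divide
          borel_measurable_diff borel_measurable_const cis_m h_m sfun_borel_measurable h)
  qed
  have eq: "ift (?q n) y = (cis (- (?s n * (v \<bullet> y))) - 1) /\<^sub>R ?s n * ift h y" for n
  proof -
    have int: "integrable lborel h" "integrable lborel (\<lambda>\<xi>. h (\<xi> + ?s n *\<^sub>R v))"
      using sfun_integrable[OF h] sfun_integrable[OF sfun_shift[OF h], of "- ?s n *\<^sub>R v"] by simp_all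
    have "ift (?q n) y = inverse (of_real (?s n)) * ift (\<lambda>\<xi>. h (\<xi> + ?s n *\<^sub>R v) + (- 1) * h \<xi>) y"
      by (subst ift_cmult[symmetric]) (simp add: divide_inverse mult.commute del: of_nat_Suc)
    also have "ift (\<lambda>\<xi>. h (\<xi> + ?s n *\<^sub>R v) + (- 1) * h \<xi>) y = cis (- (?s n * (v \<bullet> y))) * ift h y - ift h y"
      using int by (subst ift_add) (simp_all add: ift_cmult[of "-1", simplified] ift_shift sfun_borel_measurable[OF h] del: of_nat_Suc)
    finally show ?thesis by (simp add: scaleR_conv_of_real algebra_simps del: of_nat_Suc)
  qed
  have lim2: "(\<lambda>n. (cis (- (?s n * (v \<bullet> y))) - 1) /\<^sub>R ?s n * ift h y) \<longlonglongrightarrow> - \<i> * of_real (y \<bullet> v) * ift h y"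
  proof (intro tendsto_mult_right)
    have "((\<lambda>t. cis (- (t * (v \<bullet> y)))) has_vector_derivative - \<i> * of_real (y \<bullet> v)) (at 0)"
      unfolding has_vector_derivative_def
      by (rule has_derivative_eq_rhs) (auto intro!: derivative_eq_intros simp: scaleR_conv_of_real inner_commute)
    from has_vector_derivative_difference_quotient[OF this s0]
    show "(\<lambda>n. (cis (- (?s n * (v \<bullet> y))) - 1) /\<^sub>R ?s n) \<longlonglongrightarrow> - \<i> * of_real (y \<bullet> v)"
      by simp
  qed
  show ?thesis by (rule LIMSEQ_unique[OF lim1[unfolded eq] lim2])
qed

text \<open>By \<open>ift_partial\<close> a coordinate factor in \<open>y\<close> costs one
  derivative of \<open>h\<close>. Bounding |y| by the sum of its coordinates gives the induction on
  \<open>N\<close>, which must hold for all \<open>h\<close> at once.\<close>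

lemma rapid_ift:
  assumes "sfun h" shows "rapid (ift h)"
proof -
  have "\<exists>B. \<forall>y. (1 + norm y) ^ N * norm (ift h y) \<le> B" for N
    using assms
  proof (induction N arbitrary: h)
    case 0
    then show ?case using norm_ift_le by auto
  next
    case (Suc N)
    obtain B where B: "\<And>y. (1 + norm y) ^ N * norm (ift h y) \<le> B"
      using Suc.IH[OF Suc.prems] by blast
    have "\<forall>v\<in>Basis. \<exists>B. \<forall>y. (1 + norm y) ^ N * norm (ift (partial v h) y) \<le> B"
      using Suc.IH[OF sfun_partial[OF Suc.prems]] by blast
    then obtain B' where B': "\<And>v y. v \<in> Basis \<Longrightarrow> (1 + norm y) ^ N * norm (ift (partial v h) y) \<le> B' v"
      by metis
    have "(1 + norm y) ^ Suc N * norm (ift h y) \<le> B + sum B' Basis" for y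
    proof -
      have "(1 + norm y) ^ Suc N * norm (ift h y) = (1 + norm y) * ((1 + norm y) ^ N * norm (ift h y))"
        by simp
      also have "\<dots> \<le> (1 + (\<Sum>v\<in>Basis. \<bar>y \<bullet> v\<bar>)) * ((1 + norm y) ^ N * norm (ift h y))"
        by (intro mult_right_mono add_left_mono norm_le_l1) auto
      also have "\<dots> = (1 + norm y) ^ N * norm (ift h y) +
          (\<Sum>v\<in>Basis. (1 + norm y) ^ N * norm (ift (partial v h) y))"
        unfolding distrib_right sum_distrib_right mult_1
        by (intro arg_cong2[of _ _ _ _ "(+)"] sum.cong refl)
          (simp add: ift_partial[OF Suc.prems] norm_mult mult_ac)
      also have "\<dots> \<le> B + sum B' Basis"
        by (intro add_mono sum_mono B B')
      finally show ?thesis .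
    qed
    then show ?case by blast
  qed
  then show ?thesis by (simp add: rapid_def)
qed

section \<open>Finite sums of waves\<close>

text \<open>The function with Fourier transform \<open>h k\<close> at the torus frequency
  \<open>k \<in> P\<close> and 0 elsewhere (\<open>fourier_wave\<close>). All test data have this
  form with finite \<open>P\<close>, so that every sum over the lattice becomes finite.\<close>

definition wave :: "(int^'m) set \<Rightarrow> (int^'m \<Rightarrow> real^'n \<Rightarrow> complex) \<Rightarrow> (real^'m) \<times> (real^'n) \<Rightarrow> complex" where
  "wave P h z = (\<Sum>k\<in>P. cis (ivec k \<bullet> fst z) * ift (h k) (snd z))"

text \<open>The derivative is written as a wave over the same \<open>P\<close>: the waves with
  Schwartz coefficients are then an invariant class, which yields
  \<open>wave_schwartz\<close>.\<close>

lemma wave_has_derivative: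
  assumes "\<And>k. k \<in> P \<Longrightarrow> sfun (h k)"
  shows "(wave P h has_derivative (\<lambda>v. wave P (\<lambda>k \<xi>. (\<i> * of_real (ivec k \<bullet> fst v)) * h k \<xi>
    + \<i> * (of_real (\<xi> \<bullet> snd v) * h k \<xi>)) z)) (at z)"
proof -
  let ?c = "\<lambda>k v. \<i> * of_real (ivec k \<bullet> fst v)"
  have "((\<lambda>z. cis (ivec k \<bullet> fst z) * ift (h k) (snd z)) has_derivative
      (\<lambda>v. cis (ivec k \<bullet> fst z) * ift (\<lambda>\<xi>. ?c k v * h k \<xi> + \<i> * (of_real (\<xi> \<bullet> snd v) * h k \<xi>)) (snd z))) (at z)"
    if "k \<in> P" for k
  proof -
    note h = assms[OF that]
    have lin: "((\<lambda>z :: (real^'a) \<times> (real^'b). ivec k \<bullet> fst z) has_derivative (\<lambda>v. ivec k \<bullet> fst v)) (at z)"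
      by (rule has_derivative_inner_right[OF has_derivative_fst[OF has_derivative_ident]])
    have 1: "((\<lambda>z :: (real^'a) \<times> (real^'b). cis (ivec k \<bullet> fst z)) has_derivative
        (\<lambda>v. (ivec k \<bullet> fst v) *\<^sub>R (\<i> * cis (ivec k \<bullet> fst z)))) (at z)"
      by (rule has_derivative_eq_rhs[OF has_derivative_cis[OF lin]]) simp
    have 2: "((\<lambda>z :: (real^'a) \<times> (real^'b). ift (h k) (snd z)) has_derivative
        (\<lambda>v. ift (\<lambda>\<xi>. \<i> * (of_real (\<xi> \<bullet> snd v) * h k \<xi>)) (snd z))) (at z)"
      by (rule has_derivative_compose[OF has_derivative_snd[OF has_derivative_ident] ift_has_derivative[OF h]])
    have 3: "ift (\<lambda>\<xi>. ?c k v * h k \<xi> + \<i> * (of_real (\<xi> \<bullet> snd v) * h k \<xi>)) (snd z)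
        = ?c k v * ift (h k) (snd z) + ift (\<lambda>\<xi>. \<i> * (of_real (\<xi> \<bullet> snd v) * h k \<xi>)) (snd z)" for v :: "(real^'a) \<times> (real^'b)"
      by (subst ift_add) (intro sfun_integrable sfun_cmult sfun_coord h | simp only: ift_cmult)+
    show ?thesis
      unfolding 3 by (rule has_derivative_eq_rhs[OF has_derivative_mult[OF 1 2]])
        (simp add: scaleR_conv_of_real algebra_simps fun_eq_iff)
  qed
  then show ?thesis
    unfolding wave_def[abs_def] by (rule has_derivative_sum)
qed

lemma rapid_wave:
  assumes "\<And>k. k \<in> P \<Longrightarrow> sfun (h k)"
  shows "\<exists>B. \<forall>x y. (1 + norm y) ^ N * norm (wave P h (x, y)) \<le> B"
proof -
  have "\<forall>k\<in>P. \<exists>B. \<forall>y. (1 + norm y) ^ N * norm (ift (h k) y) \<le> B"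
    using rapid_ift[OF assms] by (simp add: rapid_def)
  then obtain B where B: "\<And>k y. k \<in> P \<Longrightarrow> (1 + norm y) ^ N * norm (ift (h k) y) \<le> B k" by metis
  have "(1 + norm y) ^ N * norm (wave P h (x, y)) \<le> sum B P" for x y
  proof -
    have "norm (wave P h (x, y)) \<le> (\<Sum>k\<in>P. norm (ift (h k) y))"
      unfolding wave_def by (rule order_trans[OF norm_sum]) (simp add: norm_mult)
    then have "(1 + norm y) ^ N * norm (wave P h (x, y)) \<le> (1 + norm y) ^ N * (\<Sum>k\<in>P. norm (ift (h k) y))"
      by (rule mult_left_mono) simp
    also have "\<dots> \<le> sum B P"
      unfolding sum_distrib_left by (intro sum_mono B)
    finally show ?thesis .
  qed
  then show ?thesis by blast
qed

lemma periodic_wave: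
  fixes P :: "(int^'m) set"
  shows "periodic_fst (wave P h)"
proof -
  have "cis (ivec k \<bullet> (x + (2 * pi) *\<^sub>R axis i 1)) = cis (ivec k \<bullet> x)" for k :: "int^'m" and x i
  proof -
    have "cis (2 * pi * of_int (k $ i)) = 1" by (rule cis_multiple_2pi) simp
    then show ?thesis
      by (simp add: inner_add_right inner_axis ivec_def cis_mult[symmetric] mult.commute)
  qed
  then show ?thesis by (simp add: periodic_fst_def wave_def)
qed

lemma wave_schwartz:
  assumes "\<And>k. k \<in> P \<Longrightarrow> sfun (h k)"
  shows "schwartz (wave P h)"
proof -
  let ?C = "{wave P h |h. \<forall>k\<in>P. sfun (h k)}"
  have mem: "wave P h \<in> ?C" using assms by (intro CollectI exI[of _ h]) simp
  have partial: "partial v g \<in> ?C" if "g \<in> ?C" "v \<in> Basis" for g v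
  proof -
    obtain h where h: "g = wave P h" "\<And>k. k \<in> P \<Longrightarrow> sfun (h k)" using \<open>g \<in> ?C\<close> by blast
    let ?h = "\<lambda>k \<xi>. (\<i> * of_real (ivec k \<bullet> fst v)) * h k \<xi> + \<i> * (of_real (\<xi> \<bullet> snd v) * h k \<xi>)"
    have "partial v g = wave P ?h"
      unfolding h(1) by (rule partial_eqI[OF wave_has_derivative[OF h(2)]])
    moreover have "sfun (?h k)" if "k \<in> P" for k
      by (rule sfun_add[OF sfun_cmult[OF h(2)] sfun_cmult[OF sfun_coord[OF h(2)]]]) (rule that)+
    ultimately show ?thesis by (intro CollectI exI[of _ ?h]) simp
  qed
  have diff: "g differentiable (at z)" if g: "g \<in> ?C" for g z
  proof -
    obtain h where h: "g = wave P h" "\<And>k. k \<in> P \<Longrightarrow> sfun (h k)" using g by blast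
    show ?thesis unfolding h(1) by (rule differentiableI[OF wave_has_derivative[OF h(2)]])
  qed
  have "\<exists>B. \<forall>x y. (1 + norm y) ^ N * norm (iter_partial vs (wave P h) (x, y)) \<le> B" if "set vs \<subseteq> Basis" for vs N
  proof -
    have "iter_partial vs (wave P h) \<in> ?C"
      by (rule iter_partial_in_closed_set[OF mem partial that])
    then obtain h' where "iter_partial vs (wave P h) = wave P h'" "\<And>k. k \<in> P \<Longrightarrow> sfun (h' k)" by blast
    then show ?thesis using rapid_wave[of P h' N] by simp
  qed
  then show ?thesis
    unfolding schwartz_def using periodic_wave smooth_coinduct[OF mem partial diff] by simp
qed

text \<open>This span is closed under partial derivatives, so that \<open>sfun_coinduct\<close> applies to it.\<close>

inductive_set gauss_space :: "real \<Rightarrow> complex \<Rightarrow> ('a::euclidean_space \<Rightarrow> complex) set" for b z where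
  base: "\<gamma> \<le> 0 \<Longrightarrow> (\<lambda>\<xi>. of_real ((b + \<xi> \<bullet> \<xi>) powr \<gamma>) * exp (- z * of_real (\<xi> \<bullet> \<xi>))) \<in> gauss_space b z"
| coord: "g \<in> gauss_space b z \<Longrightarrow> (\<lambda>\<xi>. of_real (\<xi> \<bullet> v) * g \<xi>) \<in> gauss_space b z"
| cmult: "g \<in> gauss_space b z \<Longrightarrow> (\<lambda>\<xi>. c * g \<xi>) \<in> gauss_space b z"
| add: "f \<in> gauss_space b z \<Longrightarrow> g \<in> gauss_space b z \<Longrightarrow> (\<lambda>\<xi>. f \<xi> + g \<xi>) \<in> gauss_space b z"

section \<open>Gaussians with Bessel weights are Schwartz functions\<close>

lemma power_le_fact_exp:
  fixes x :: real assumes "0 \<le> x" shows "x ^ N \<le> fact N * exp x"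
proof -
  have "(\<Sum>n\<in>{N}. x ^ n /\<^sub>R fact n) \<le> (\<Sum>n. x ^ n /\<^sub>R fact n)"
    by (rule sum_le_suminf[OF sums_summable[OF exp_converges]]) (use assms in auto)
  then have "x ^ N /\<^sub>R fact N \<le> exp x"
    unfolding sums_unique[OF exp_converges, symmetric] by simp
  then show ?thesis by (simp add: field_simps)
qed

lemma rapid_gaussian:
  assumes "c > 0"
  shows "rapid (\<lambda>\<xi> :: 'a::euclidean_space. exp (- c * (\<xi> \<bullet> \<xi>)))"
  unfolding rapid_def
proof
  fix N
  have "(1 + norm \<xi>) ^ N * norm (exp (- c * (\<xi> \<bullet> \<xi>))) \<le> fact N * exp (1 + 1 / (4 * c))" for \<xi> :: 'a
  proof -
    have "(1 + norm \<xi>) ^ N * norm (exp (- c * (\<xi> \<bullet> \<xi>))) \<le> fact N * exp (1 + norm \<xi>) * exp (- c * (\<xi> \<bullet> \<xi>))"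
      by (simp add: mult_right_mono power_le_fact_exp)
    also have "\<dots> = fact N * exp (1 + norm \<xi> - c * (norm \<xi>)\<^sup>2)"
      by (simp add: exp_diff exp_minus field_simps dot_square_norm)
    also have "\<dots> \<le> fact N * exp (1 + 1 / (4 * c))"
    proof -
      have "0 \<le> (2 * c * norm \<xi> - 1)\<^sup>2" by simp
      then have "4 * c * norm \<xi> - 4 * c * (c * (norm \<xi>)\<^sup>2) \<le> 1" by (simp add: power2_eq_square algebra_simps)
      then have "norm \<xi> - c * (norm \<xi>)\<^sup>2 \<le> 1 / (4 * c)" using assms by (simp add: field_simps)
      then show ?thesis by simp
    qed
    finally show ?thesis .
  qed
  then show "\<exists>B. \<forall>\<xi> :: 'a. (1 + norm \<xi>) ^ N * norm (exp (- c * (\<xi> \<bullet> \<xi>))) \<le> B" by blast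
qed

lemma gauss_space_rapid:
  assumes "b \<ge> 1" "Re z > 0" "g \<in> gauss_space b z"
  shows "rapid g"
  using assms(3)
proof (induction rule: gauss_space.induct)
  case (base \<gamma>)
  show ?case
  proof (rule rapid_le[OF rapid_gaussian[OF assms(2)], where A=1 and M=0])
    fix \<xi> :: 'a
    have "1 \<le> b + \<xi> \<bullet> \<xi>" using assms(1) by (simp add: add_increasing2)
    then have "(b + \<xi> \<bullet> \<xi>) powr \<gamma> \<le> 1"
      using base powr_mono[of \<gamma> 0 "b + \<xi> \<bullet> \<xi>"] by simp
    then show "norm (of_real ((b + \<xi> \<bullet> \<xi>) powr \<gamma>) * exp (- z * of_real (\<xi> \<bullet> \<xi>)))
        \<le> 1 * (1 + norm \<xi>) ^ 0 * norm (exp (- Re z * (\<xi> \<bullet> \<xi>)))"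
      by (simp add: norm_mult mult_left_le_one_le)
  qed
qed (auto intro: rapid_coord rapid_cmult rapid_add)

text \<open>A derivative lowers the exponent to \<open>\<gamma> - 1\<close> and brings out a
  coordinate; this is why the generators of \<open>gauss_space\<close> range over all exponents
  \<open>\<gamma> \<le> 0\<close>.\<close>

lemma gauss_base_has_derivative:
  fixes \<xi> :: "'a::euclidean_space" and z :: complex
  assumes "b \<ge> 1"
  defines "G \<equiv> \<lambda>\<gamma> \<xi> :: 'a. of_real ((b + \<xi> \<bullet> \<xi>) powr \<gamma>) * exp (- z * of_real (\<xi> \<bullet> \<xi>))"
  shows "(G \<gamma> has_derivative (\<lambda>v. (2 * of_real \<gamma>) * (of_real (\<xi> \<bullet> v) * G (\<gamma> - 1) \<xi>)
    + (- 2 * z) * (of_real (\<xi> \<bullet> v) * G \<gamma> \<xi>))) (at \<xi>)"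
proof -
  let ?t = "\<xi> \<bullet> \<xi>"
  have "b + ?t > 0" using assms(1) by (simp add: add_pos_nonneg)
  then have "((\<lambda>t. (b + t) powr \<gamma>) has_real_derivative \<gamma> * (b + ?t) powr (\<gamma> - 1)) (at ?t)"
    by (auto intro!: derivative_eq_intros)
  then have 1: "((\<lambda>t. complex_of_real ((b + t) powr \<gamma>)) has_vector_derivative of_real (\<gamma> * (b + ?t) powr (\<gamma> - 1))) (at ?t)"
    by (rule has_vector_derivative_of_real)
  have 2: "((\<lambda>t. exp (- z * complex_of_real t)) has_vector_derivative - z * exp (- z * of_real ?t)) (at ?t)"
    using exp_scaleR_has_vector_derivative_right[of "- z" ?t UNIV]
    by (simp add: scaleR_conv_of_real mult.commute)
  have "((\<lambda>t. complex_of_real ((b + t) powr \<gamma>) * exp (- z * of_real t)) has_derivative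
      (\<lambda>s. s *\<^sub>R (of_real ((b + ?t) powr \<gamma>) * (- z * exp (- z * of_real ?t))
        + of_real (\<gamma> * (b + ?t) powr (\<gamma> - 1)) * exp (- z * of_real ?t)))) (at ?t)"
    using has_vector_derivative_mult[OF 1 2] unfolding has_vector_derivative_def .
  moreover have "((\<lambda>\<xi> :: 'a. \<xi> \<bullet> \<xi>) has_derivative (\<lambda>v. 2 * (\<xi> \<bullet> v))) (at \<xi>)"
    by (auto intro!: derivative_eq_intros simp: inner_commute)
  ultimately have "(G \<gamma> has_derivative
      (\<lambda>v. (2 * (\<xi> \<bullet> v)) *\<^sub>R (of_real ((b + ?t) powr \<gamma>) * (- z * exp (- z * of_real ?t))
        + of_real (\<gamma> * (b + ?t) powr (\<gamma> - 1)) * exp (- z * of_real ?t)))) (at \<xi>)"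
    unfolding G_def by (rule has_derivative_compose[rotated])
  then show ?thesis
    by (rule has_derivative_eq_rhs) (simp add: G_def scaleR_conv_of_real algebra_simps fun_eq_iff)
qed

lemma gauss_space_derivative:
  fixes g :: "'a::euclidean_space \<Rightarrow> complex"
  assumes "b \<ge> 1" "g \<in> gauss_space b z"
  shows "(\<forall>\<xi>. g differentiable (at \<xi>)) \<and> (\<forall>v. partial v g \<in> gauss_space b z)"
  using assms(2)
proof (induction rule: gauss_space.induct)
  case (base \<gamma>)
  note der = gauss_base_has_derivative[OF assms(1), where z=z and \<gamma>=\<gamma>]
  show ?case
    unfolding partial_eqI[OF der]
    by (intro conjI allI differentiableI[OF der] gauss_space.add gauss_space.cmult gauss_space.coord gauss_space.base)
      (use base in auto)
next
  case (coord g w)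
  have lin: "((\<lambda>x. complex_of_real (x \<bullet> w)) has_derivative (\<lambda>v. of_real (v \<bullet> w))) (at x)" for x :: 'a
    by (rule has_derivative_of_real[OF has_derivative_inner_left[OF has_derivative_ident]])
  note der = has_derivative_mult[OF lin has_derivative_partial]
  have d: "g differentiable (at \<xi>)" for \<xi> using coord by blast
  show ?case
    unfolding partial_eqI[OF der[OF d]] using differentiableI[OF der[OF d]] coord
    by (auto intro!: gauss_space.intros)
next
  case (cmult g c)
  have d: "g differentiable (at \<xi>)" for \<xi> using cmult by blast
  note der = has_derivative_mult_right[OF has_derivative_partial[OF d]]
  show ?case
    unfolding partial_eqI[OF der] using differentiableI[OF der] cmult by (auto intro!: gauss_space.intros)
next
  case (add f g)
  have d: "f differentiable (at \<xi>)" "g differentiable (at \<xi>)" for \<xi> using add by blast+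
  note der = has_derivative_add[OF has_derivative_partial[OF d(1)] has_derivative_partial[OF d(2)]]
  show ?case
    unfolding partial_eqI[OF der] using differentiableI[OF der] add by (auto intro!: gauss_space.intros)
qed

lemma gauss_space_sfun:
  assumes "b \<ge> 1" "Re z > 0" "g \<in> gauss_space b z"
  shows "sfun g"
proof (rule sfun_coinduct[where C="gauss_space b z"])
  show "partial v g \<in> gauss_space b z" if "g \<in> gauss_space b z" for v g
    using gauss_space_derivative[OF assms(1) that] by blast
  show "g differentiable (at \<xi>)" if "g \<in> gauss_space b z" for g \<xi>
    using gauss_space_derivative[OF assms(1) that] by blast
qed (use assms(3) gauss_space_rapid[OF assms(1,2)] in simp_all)

section \<open>Fourier inversion and Gaussians\<close>

lemma integrable_pair_mult:
  fixes F :: "'a::euclidean_space \<Rightarrow> complex" and G :: "'b::euclidean_space \<Rightarrow> complex"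
  assumes "integrable lborel F" "integrable lborel G"
  shows "integrable (lborel \<Otimes>\<^sub>M lborel) (\<lambda>(x, y). F x * G y)"
proof (rule lborel_pair.Fubini_integrable)
  have [measurable]: "F \<in> borel_measurable borel" "G \<in> borel_measurable borel"
    using assms borel_measurable_integrable by force+
  show "(\<lambda>(x, y). F x * G y) \<in> borel_measurable (lborel \<Otimes>\<^sub>M lborel)"
    by measurable
  show "integrable lborel (\<lambda>x. LINT y|lborel. norm (case (x, y) of (x, y) \<Rightarrow> F x * G y))"
    using assms(1) by (simp add: norm_mult)
  show "AE x in lborel. integrable lborel (\<lambda>y. case (x, y) of (x, y) \<Rightarrow> F x * G y)"
    using assms(2) by simp
qed

lemma integral_pair_mult:
  fixes F :: "'a::euclidean_space \<Rightarrow> complex" and G :: "'b::euclidean_space \<Rightarrow> complex"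
  assumes "integrable lborel F" "integrable lborel G"
  shows "(LINT z|lborel. F (fst z) * G (snd z)) = (LINT x|lborel. F x) * (LINT y|lborel. G y)"
proof -
  have "(LINT z|lborel. F (fst z) * G (snd z)) = (LINT z|(lborel \<Otimes>\<^sub>M lborel). (case z of (x, y) \<Rightarrow> F x * G y))"
    by (simp add: lborel_prod case_prod_unfold)
  also have "\<dots> = (LINT x|lborel. LINT y|lborel. F x * G y)"
    by (subst lborel_pair.integral_fst'[OF integrable_pair_mult[OF assms], symmetric]) simp
  also have "\<dots> = (LINT x|lborel. F x) * (LINT y|lborel. G y)"
    by simp
  finally show ?thesis .
qed

lemma ift_multiplication_formula:
  fixes a b :: "'a::euclidean_space \<Rightarrow> complex"
  assumes "integrable lborel a" "integrable lborel b"
  shows "(LINT y|lborel. ift a y * b y) = (LINT \<xi>|lborel. a \<xi> * ift b \<xi>)"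
proof -
  have [measurable]: "a \<in> borel_measurable borel" "b \<in> borel_measurable borel"
    using assms borel_measurable_integrable by force+
  have "integrable (lborel \<Otimes>\<^sub>M lborel) (\<lambda>z. (case z of (\<xi>, y) \<Rightarrow> a \<xi> * b y) * cis (fst z \<bullet> snd z))"
    by (rule integrable_mult_cis[OF integrable_pair_mult[OF assms]]) measurable
  then have "integrable (lborel \<Otimes>\<^sub>M lborel) (\<lambda>(\<xi>, y). a \<xi> * b y * cis (\<xi> \<bullet> y))"
    by (simp add: case_prod_unfold)
  from lborel_pair.Fubini_integral[OF this]
  have "(LINT y|lborel. LINT \<xi>|lborel. a \<xi> * b y * cis (\<xi> \<bullet> y)) = (LINT \<xi>|lborel. LINT y|lborel. a \<xi> * b y * cis (\<xi> \<bullet> y))"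
    by simp
  moreover have "(LINT \<xi>|lborel. a \<xi> * b y * cis (\<xi> \<bullet> y)) = ift a y * b y" for y
    unfolding ift_def by (subst integral_mult_left_zero[symmetric]) (simp add: mult_ac)
  moreover have "(LINT y|lborel. a \<xi> * b y * cis (\<xi> \<bullet> y)) = a \<xi> * ift b \<xi>" for \<xi>
    unfolding ift_def by (subst integral_mult_right_zero[symmetric]) (simp add: mult_ac inner_commute)
  ultimately show ?thesis by simp
qed

section \<open>Transforms of complex Gaussians and inversion\<close>

definition gauss :: "complex \<Rightarrow> 'a::euclidean_space \<Rightarrow> complex" where
  "gauss z \<xi> = exp (- z * of_real (\<xi> \<bullet> \<xi>))"

lemma gauss_eq_base:
  "gauss z = (\<lambda>\<xi> :: 'a::euclidean_space. of_real ((1 + \<xi> \<bullet> \<xi>) powr 0) * exp (- z * of_real (\<xi> \<bullet> \<xi>)))"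
proof
  fix \<xi> :: 'a
  have "1 + \<xi> \<bullet> \<xi> > 0" by (simp add: add_pos_nonneg)
  then show "gauss z \<xi> = of_real ((1 + \<xi> \<bullet> \<xi>) powr 0) * exp (- z * of_real (\<xi> \<bullet> \<xi>))"
    by (simp add: gauss_def)
qed

lemma sfun_gauss: "Re z > 0 \<Longrightarrow> sfun (gauss z)"
  unfolding gauss_eq_base by (rule gauss_space_sfun[OF order_refl _ gauss_space.base]) auto

lemma partial_gauss: "partial v (gauss z) = (\<lambda>\<xi>. (- 2 * z) * (of_real (\<xi> \<bullet> v) * gauss z \<xi>))"
  using partial_eqI[OF gauss_base_has_derivative[OF order_refl, where \<gamma>=0 and z=z]]
  unfolding gauss_eq_base by simp

lemma norm_gauss: "norm (gauss z \<xi>) = exp (- Re z * (\<xi> \<bullet> \<xi>))"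
  by (simp add: gauss_def)

text \<open>The gradient of \<open>gauss z\<close>, computed directly and by integration by parts,
  gives a first-order differential equation for the transform; hence the transform times the
  reciprocal \<open>?G\<close> of the expected Gaussian has derivative 0. No contour is shifted for
  complex \<open>z\<close>, and the constant is left unevaluated.\<close>

lemma ift_gauss:
  fixes y :: "'a::euclidean_space"
  assumes "Re z > 0"
  shows "ift (gauss z) y = ift (gauss z) (0 :: 'a) * gauss (1 / (4 * z)) y"
proof -
  have z: "z \<noteq> 0" using assms by auto
  let ?J = "ift (gauss z) :: 'a \<Rightarrow> complex"
  let ?G = "gauss (- 1 / (4 * z)) :: 'a \<Rightarrow> complex"
  have J: "(?J has_derivative (\<lambda>v. ift (\<lambda>\<xi>. \<i> * (of_real (\<xi> \<bullet> v) * gauss z \<xi>)) y)) (at y)" for y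
    by (rule ift_has_derivative[OF sfun_gauss[OF assms]])
  have G: "(?G has_derivative (\<lambda>v. (1 / (2 * z)) * (of_real (y \<bullet> v) * ?G y))) (at y)" for y
    using gauss_base_has_derivative[OF order_refl, where \<gamma>=0 and z="- 1 / (4 * z)" and \<xi>=y]
    unfolding gauss_eq_base by simp
  have JG: "((\<lambda>y. ?J y * ?G y) has_derivative (\<lambda>v. 0)) (at y)" for y
  proof -
    let ?D = "\<lambda>v. ?J y * ((1 / (2 * z)) * (of_real (y \<bullet> v) * ?G y)) + ift (\<lambda>\<xi>. \<i> * (of_real (\<xi> \<bullet> v) * gauss z \<xi>)) y * ?G y"
    have D: "((\<lambda>y. ?J y * ?G y) has_derivative ?D) (at y)"
      by (rule has_derivative_mult[OF J G])
    have "?D v = 0" if "v \<in> Basis" for v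
    proof -
      let ?I = "ift (\<lambda>\<xi>. of_real (\<xi> \<bullet> v) * gauss z \<xi>) y"
      have "- 2 * z * ?I = - \<i> * of_real (y \<bullet> v) * ?J y"
        using ift_partial[OF sfun_gauss[OF assms] that, of y] unfolding partial_gauss by (simp only: ift_cmult)
      then have "2 * z * ?I = \<i> * of_real (y \<bullet> v) * ?J y" by simp
      then have "?I = \<i> * of_real (y \<bullet> v) * ?J y / (2 * z)" using z by (simp add: field_simps)
      then have "\<i> * ?I = - (of_real (y \<bullet> v) * ?J y) / (2 * z)" by (simp add: mult.assoc[symmetric])
      then show ?thesis unfolding ift_cmult by simp
    qed
    then have "?D = (\<lambda>v. 0)"
      by (intro linear_eq_stdbasis[OF has_derivative_linear[OF D]]) (auto simp: linear_zero)
    then show ?thesis using D by simp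
  qed
  have 1: "?J y * ?G y = ?J 0 * ?G 0"
    using has_derivative_zero_unique[of UNIV "\<lambda>y. ?J y * ?G y" y 0] JG by auto
  have 2: "?G y * gauss (1 / (4 * z)) y = 1" and 3: "?G 0 = 1"
    by (simp_all add: gauss_def exp_add[symmetric])
  have "?J y = ?J y * (?G y * gauss (1 / (4 * z)) y)"
    unfolding 2 by simp
  then show ?thesis
    unfolding mult.assoc[symmetric] 1 3 by simp
qed

lemma std_gauss_integral: "ift (gauss (1/2)) (0 :: 'a::euclidean_space) = of_real (sqrt (2 * pi)) ^ DIM('a)"
proof -
  let ?g = "\<lambda>t :: real. exp (- t\<^sup>2 / 2)"
  have int: "has_bochner_integral lborel ?g (sqrt (2 * pi))"
  proof -
    have "has_bochner_integral lborel (\<lambda>x. sqrt (2 * pi) * std_normal_density x) (sqrt (2 * pi) * 1)"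
      by (intro has_bochner_integral_mult_right) (simp add: has_bochner_integral_iff)
    then show ?thesis by (simp add: std_normal_density_def)
  qed
  then have 1: "(\<integral>\<^sup>+t. ennreal (?g t) \<partial>lborel) = ennreal (sqrt (2 * pi))"
    by (subst nn_integral_eq_integral) (auto simp: has_bochner_integral_iff)
  have eq: "exp (- (x \<bullet> x) / 2) = (\<Prod>b\<in>Basis. ?g (x \<bullet> b))" for x :: 'a
    by (subst euclidean_inner) (simp add: exp_sum[symmetric] sum_negf sum_divide_distrib power2_eq_square)
  have "(\<integral>\<^sup>+x. ennreal (exp (- (x \<bullet> x) / 2)) \<partial>(lborel :: 'a measure)) = (\<integral>\<^sup>+x. (\<Prod>b\<in>Basis. ennreal (?g (x \<bullet> b))) \<partial>(lborel :: 'a measure))"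
    unfolding eq by (simp add: prod_ennreal)
  also have "\<dots> = ennreal (sqrt (2 * pi) ^ DIM('a))"
    by (subst nn_integral_lborel_prod[where f="\<lambda>_ t. ennreal (?g t)"]) (auto simp: 1[simplified] ennreal_power)
  finally have "(LINT x|(lborel :: 'a measure). exp (- (x \<bullet> x) / 2)) = sqrt (2 * pi) ^ DIM('a)"
    by (subst integral_eq_nn_integral) auto
  then have "of_real (LINT x|(lborel :: 'a measure). exp (- (x \<bullet> x) / 2)) = (of_real (sqrt (2 * pi)) ^ DIM('a) :: complex)"
    by simp
  moreover have "gauss (1/2) x = of_real (exp (- (x \<bullet> x) / 2))" for x :: 'a
    by (simp add: gauss_def exp_of_real[symmetric])
  ultimately show ?thesis by (simp add: ift_def)
qed

lemma gauss_scale: "gauss z (c *\<^sub>R \<xi>) = gauss (of_real (c\<^sup>2) * z) \<xi>"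
  by (simp add: gauss_def power2_eq_square mult_ac)

lemma ift_scale:
  fixes y :: "'a::euclidean_space"
  assumes [measurable]: "h \<in> borel_measurable borel" and "c > 0"
  shows "c ^ DIM('a) *\<^sub>R ift (\<lambda>\<xi>. h (c *\<^sub>R \<xi>)) y = ift h (y /\<^sub>R c)"
  unfolding ift_def using assms(2) by (subst (2) integral_lborel_scale[OF _ assms(2)]) (auto simp: mult.assoc[symmetric])

text \<open>Fourier inversion, by testing against the Gaussians \<open>gauss (\<epsilon>\<^sup>2 / 2)\<close> and letting \<open>\<epsilon> \<rightarrow> 0\<close>.\<close>

lemma integral_ift:
  fixes a :: "'a::euclidean_space \<Rightarrow> complex"
  assumes a: "sfun a"
  shows "(LINT y|lborel. ift a y) = of_real (2 * pi) ^ DIM('a) * a 0"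
proof -
  let ?s = "\<lambda>n. inverse (real (Suc n))"
  let ?\<gamma> = "gauss (1/2) :: 'a \<Rightarrow> complex"
  let ?K = "of_real (sqrt (2 * pi)) ^ DIM('a) :: complex"
  have \<gamma>: "sfun ?\<gamma>" by (rule sfun_gauss) simp
  have a_m [measurable]: "a \<in> borel_measurable borel" by (rule sfun_borel_measurable[OF a])
  have \<gamma>_m [measurable]: "?\<gamma> \<in> borel_measurable borel" by (rule sfun_borel_measurable[OF \<gamma>])
  have ift_m [measurable]: "ift a \<in> borel_measurable borel" by (rule borel_measurable_ift[OF a])
  have ift_int: "integrable lborel (ift a)" by (rule integrable_rapid[OF rapid_ift[OF a] ift_m])
  have ift_\<gamma>: "ift ?\<gamma> y = ?K * ?\<gamma> y" for y
    using ift_gauss[of "1/2" y] by (simp add: std_gauss_integral)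
  have \<gamma>_le: "norm (?\<gamma> y) \<le> 1" for y by (simp add: norm_gauss)
  obtain B where B: "\<And>y. norm (a y) \<le> B"
    using rapidE[OF sfun_rapid[OF a], of 0] by auto
  have s0: "?s \<longlonglongrightarrow> 0" by (rule LIMSEQ_inverse_real_of_nat)
  have sy: "(\<lambda>n. ?s n *\<^sub>R y) \<longlonglongrightarrow> 0" for y :: 'a
    using tendsto_scaleR[OF s0 tendsto_const[of y]] by simp
  \<comment> \<open>The multiplication formula and a change of variables move the dilation from the
    Gaussian to \<open>a\<close>. As the scale tends to 0, the left side tends to the integral of
    \<open>ift a\<close> and the right side isolates \<open>a 0\<close>; the Gaussian being its own
    transform up to \<open>?K\<close> leaves the constant \<open>?K\<close> squared.\<close>
  have eq: "(LINT y|lborel. ift a y * ?\<gamma> (?s n *\<^sub>R y)) = ?K * (LINT \<xi>|lborel. a (?s n *\<^sub>R \<xi>) * ?\<gamma> \<xi>)" for n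
  proof -
    let ?c = "?s n"
    have c: "?c > 0" by simp
    have int: "integrable lborel (\<lambda>y. ?\<gamma> (?c *\<^sub>R y))"
      unfolding gauss_scale by (intro sfun_integrable sfun_gauss) (simp del: of_nat_Suc)
    have "(LINT y|lborel. ift a y * ?\<gamma> (?c *\<^sub>R y)) = (LINT \<xi>|lborel. a \<xi> * ift (\<lambda>y. ?\<gamma> (?c *\<^sub>R y)) \<xi>)"
      by (rule ift_multiplication_formula[OF sfun_integrable[OF a] int])
    also have "\<dots> = ?c ^ DIM('a) *\<^sub>R (LINT \<xi>|lborel. a (?c *\<^sub>R \<xi>) * ift (\<lambda>y. ?\<gamma> (?c *\<^sub>R y)) (?c *\<^sub>R \<xi>))"
      by (rule integral_lborel_scale[OF _ c]) (intro borel_measurable_times a_m borel_measurable_ift,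
          unfold gauss_scale, rule sfun_gauss, simp del: of_nat_Suc)
    also have "\<dots> = (LINT \<xi>|lborel. a (?c *\<^sub>R \<xi>) * (?c ^ DIM('a) *\<^sub>R ift (\<lambda>y. ?\<gamma> (?c *\<^sub>R y)) (?c *\<^sub>R \<xi>)))"
      by (subst integral_scaleR_right[symmetric]) (simp del: of_nat_Suc)
    also have "\<dots> = (LINT \<xi>|lborel. ?K * (a (?c *\<^sub>R \<xi>) * ?\<gamma> \<xi>))"
      unfolding ift_scale[OF \<gamma>_m c] using c by (simp add: ift_\<gamma> mult_ac del: of_nat_Suc)
    finally show ?thesis by simp
  qed
  have lim1: "(\<lambda>n. LINT y|lborel. ift a y * ?\<gamma> (?s n *\<^sub>R y)) \<longlonglongrightarrow> (LINT y|lborel. ift a y)"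
  proof (rule integral_dominated_convergence[where w="\<lambda>y. norm (ift a y)"])
    show "integrable lborel (\<lambda>y. norm (ift a y))" using ift_int by simp
    show "AE y in lborel. (\<lambda>n. ift a y * ?\<gamma> (?s n *\<^sub>R y)) \<longlonglongrightarrow> ift a y"
    proof (rule AE_I2)
      fix y
      have "isCont ?\<gamma> 0" using sfun_differentiable[OF \<gamma>] differentiable_imp_continuous_within by blast
      from isCont_tendsto_compose[OF this sy[of y]]
      have "(\<lambda>n. ift a y * ?\<gamma> (?s n *\<^sub>R y)) \<longlonglongrightarrow> ift a y * ?\<gamma> 0" by (rule tendsto_mult_left)
      then show "(\<lambda>n. ift a y * ?\<gamma> (?s n *\<^sub>R y)) \<longlonglongrightarrow> ift a y" by (simp add: gauss_def)
    qed
    show "AE y in lborel. norm (ift a y * ?\<gamma> (?s n *\<^sub>R y)) \<le> norm (ift a y)" for n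
      using \<gamma>_le by (intro AE_I2) (simp add: norm_mult mult_left_le)
  qed measurable
  have lim2: "(\<lambda>n. LINT \<xi>|lborel. a (?s n *\<^sub>R \<xi>) * ?\<gamma> \<xi>) \<longlonglongrightarrow> (LINT \<xi>|lborel. a 0 * ?\<gamma> \<xi>)"
  proof (rule integral_dominated_convergence[where w="\<lambda>\<xi>. B * norm (?\<gamma> \<xi>)"])
    show "integrable lborel (\<lambda>\<xi>. B * norm (?\<gamma> \<xi>))" using sfun_integrable[OF \<gamma>] by simp
    show "AE \<xi> in lborel. (\<lambda>n. a (?s n *\<^sub>R \<xi>) * ?\<gamma> \<xi>) \<longlonglongrightarrow> a 0 * ?\<gamma> \<xi>"
    proof (rule AE_I2)
      fix \<xi>
      have "isCont a 0" using sfun_differentiable[OF a] differentiable_imp_continuous_within by blast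
      from isCont_tendsto_compose[OF this sy[of \<xi>]]
      show "(\<lambda>n. a (?s n *\<^sub>R \<xi>) * ?\<gamma> \<xi>) \<longlonglongrightarrow> a 0 * ?\<gamma> \<xi>" by (rule tendsto_mult_right)
    qed
    show "AE \<xi> in lborel. norm (a (?s n *\<^sub>R \<xi>) * ?\<gamma> \<xi>) \<le> B * norm (?\<gamma> \<xi>)" for n
      using B by (intro AE_I2) (simp add: norm_mult mult_right_mono)
  qed measurable
  have "(LINT \<xi>|lborel. a 0 * ?\<gamma> \<xi>) = a 0 * ?K"
    using std_gauss_integral[where 'a='a] by (simp add: ift_def)
  then have "(LINT y|lborel. ift a y) = ?K * (a 0 * ?K)"
    using LIMSEQ_unique[OF lim1[unfolded eq] tendsto_mult_left[OF lim2]] by simp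
  also have "\<dots> = (of_real (sqrt (2 * pi)) * of_real (sqrt (2 * pi))) ^ DIM('a) * a 0"
    by (simp only: power_mult_distrib mult_ac)
  also have "\<dots> = of_real (2 * pi) ^ DIM('a) * a 0"
    by (simp only: of_real_mult[symmetric]) simp
  finally show ?thesis .
qed

text \<open>Translating \<open>h\<close> moves its value at \<open>\<xi>\<close> to the origin,
  where \<open>integral_ift\<close> applies; the translation becomes a modulation of
  \<open>ift h\<close>, that is, the outer transform.\<close>

lemma fourier_inversion:
  fixes h :: "'a::euclidean_space \<Rightarrow> complex"
  assumes h: "sfun h"
  shows "ift (ift h) (- \<xi>) = of_real (2 * pi) ^ DIM('a) * h \<xi>"
proof -
  have "sfun (\<lambda>\<eta>. h (\<eta> + \<xi>))" using sfun_shift[OF h, of "- \<xi>"] by simp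
  from integral_ift[OF this] show ?thesis
    by (simp add: ift_shift[OF sfun_borel_measurable[OF h]] ift_def[of "ift h"] inner_commute mult.commute)
qed

lemma gauss_integral_real:
  assumes "c > 0"
  shows "ift (gauss (of_real c)) (0 :: 'a::euclidean_space) = of_real (sqrt (pi / c)) ^ DIM('a)"
proof -
  let ?s = "sqrt (2 * c)"
  have s: "?s > 0" "?s\<^sup>2 = 2 * c" using assms by simp_all
  have "gauss (1/2) (?s *\<^sub>R \<xi>) = gauss (of_real c) \<xi>" for \<xi> :: 'a
    unfolding gauss_scale s by simp
  then have "?s ^ DIM('a) *\<^sub>R ift (gauss (of_real c)) (0 :: 'a) = of_real (sqrt (2 * pi)) ^ DIM('a)"
    using ift_scale[OF sfun_borel_measurable[OF sfun_gauss[of "1/2"]] s(1), of "0 :: 'a"]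
    by (simp add: std_gauss_integral)
  moreover have "sqrt (2 * pi) = ?s * sqrt (pi / c)"
    using assms by (simp add: real_sqrt_mult[symmetric])
  ultimately have "of_real (?s ^ DIM('a)) * ift (gauss (of_real c)) (0 :: 'a) = of_real (?s ^ DIM('a)) * of_real (sqrt (pi / c)) ^ DIM('a)"
    by (simp add: scaleR_conv_of_real power_mult_distrib)
  then show ?thesis using s(1) by (subst (asm) mult_cancel_left) auto
qed

text \<open>Plancherel's identity determines the modulus without having to choose a branch of \<open>z powr (-1/2)\<close>.\<close>

lemma norm_gauss_integral:
  assumes "Re z > 0"
  shows "norm (ift (gauss z) (0 :: 'a::euclidean_space)) = sqrt (pi / norm z) ^ DIM('a)"
proof -
  have z: "z \<noteq> 0" "norm z > 0" using assms by auto
  let ?J = "ift (gauss z) :: 'a \<Rightarrow> complex"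
  let ?g = "gauss z :: 'a \<Rightarrow> complex"
  let ?A = "?J 0"
  \<comment> \<open>Twice the real part of 1/(4z), hence the rate of decay of the squared modulus of
    \<open>?J\<close>.\<close>
  define r where "r = Re z / (2 * (norm z)\<^sup>2)"
  have r: "r > 0" using assms z by (simp add: r_def)
  have Re_inv: "Re (1 / (4 * z)) = r / 2"
    using z by (simp add: Re_divide' r_def norm_mult power_mult_distrib)
  have g: "sfun ?g" by (rule sfun_gauss[OF assms])
  have cnjz: "Re (cnj z) > 0" using assms by simp
  have cnj_g: "gauss (cnj z) \<xi> = cnj (?g \<xi>)" for \<xi> :: 'a by (simp add: gauss_def exp_cnj)
  have ift_cnj: "ift (gauss (cnj z)) y = cnj (?J y)" for y :: 'a
  proof -
    have "cnj (?J y) = (LINT \<xi>|lborel. cnj (?g \<xi> * cis (\<xi> \<bullet> y)))"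
      unfolding ift_def by (simp only: Bochner_Integration.integral_cnj)
    also have "\<dots> = ift (gauss (cnj z)) (- y)"
      unfolding ift_def by (intro Bochner_Integration.integral_cong refl) (simp add: cnj_g cis_cnj)
    also have "\<dots> = ift (gauss (cnj z)) y"
      unfolding ift_gauss[OF cnjz, of "- y"] ift_gauss[OF cnjz, of y] by (simp add: gauss_def)
    finally show ?thesis ..
  qed
  have inv: "ift ?J \<xi> = of_real (2 * pi) ^ DIM('a) * ?g \<xi>" for \<xi>
    using fourier_inversion[OF g, of "- \<xi>"] by (simp add: gauss_def)
  \<comment> \<open>Plancherel's identity as a case of the multiplication formula. Both integrands
    reduce to real Gaussians, with rates \<open>r\<close> and \<open>2 * Re z\<close>, whose
    integrals are known.\<close>
  have "(LINT y|lborel. ift (gauss (cnj z)) y * ?J y) = (LINT \<xi>|lborel. gauss (cnj z) \<xi> * ift ?J \<xi>)"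
    by (rule ift_multiplication_formula[OF sfun_integrable[OF sfun_gauss[OF cnjz]]
          integrable_rapid[OF rapid_ift[OF g] borel_measurable_ift[OF g]]])
  moreover have "ift (gauss (cnj z)) y * ?J y = of_real ((norm ?A)\<^sup>2) * gauss (of_real r) y" for y
  proof -
    have "ift (gauss (cnj z)) y * ?J y = of_real ((norm (?J y))\<^sup>2)"
      unfolding ift_cnj by (subst complex_norm_square) (rule mult.commute)
    also have "norm (?J y) = norm ?A * exp (- (r / 2) * (y \<bullet> y))"
      unfolding ift_gauss[OF assms, of y] norm_mult norm_gauss Re_inv ..
    also have "(norm ?A * exp (- (r / 2) * (y \<bullet> y)))\<^sup>2 = (norm ?A)\<^sup>2 * exp (- r * (y \<bullet> y))"
      by (simp add: power_mult_distrib exp_double[symmetric])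
    also have "of_real ((norm ?A)\<^sup>2 * exp (- r * (y \<bullet> y))) = of_real ((norm ?A)\<^sup>2) * gauss (of_real r) y"
      by (simp add: gauss_def exp_of_real[symmetric])
    finally show ?thesis .
  qed
  moreover have "gauss (cnj z) \<xi> * ift ?J \<xi> = of_real (2 * pi) ^ DIM('a) * gauss (of_real (2 * Re z)) \<xi>" for \<xi>
  proof -
    have "gauss (cnj z) \<xi> * ?g \<xi> = gauss (of_real (2 * Re z)) \<xi>"
      unfolding gauss_def exp_add[symmetric] by (rule arg_cong[of _ _ exp]) (simp add: complex_eq_iff)
    then show ?thesis unfolding inv by (simp add: mult.left_commute)
  qed
  ultimately have "of_real ((norm ?A)\<^sup>2) * (LINT y|lborel. gauss (of_real r) (y :: 'a)) =
      of_real (2 * pi) ^ DIM('a) * (LINT \<xi>|lborel. gauss (of_real (2 * Re z)) (\<xi> :: 'a))"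
    by simp
  moreover have K: "(LINT y|lborel. gauss (of_real c) (y :: 'a)) = of_real (sqrt (pi / c) ^ DIM('a))" if "c > 0" for c
    using gauss_integral_real[OF that, where 'a='a] by (simp add: ift_def)
  ultimately have "complex_of_real ((norm ?A)\<^sup>2 * sqrt (pi / r) ^ DIM('a)) =
      complex_of_real ((2 * pi) ^ DIM('a) * sqrt (pi / (2 * Re z)) ^ DIM('a))"
    using K[OF r] K[of "2 * Re z"] assms by (simp only: of_real_mult of_real_power)
  then have A: "(norm ?A)\<^sup>2 * sqrt (pi / r) ^ DIM('a) = (2 * pi * sqrt (pi / (2 * Re z))) ^ DIM('a)"
    unfolding of_real_eq_iff power_mult_distrib .
  have B: "2 * pi * sqrt (pi / (2 * Re z)) = pi / norm z * sqrt (pi / r)"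
  proof (rule power2_eq_imp_eq)
    have pr: "pi / r = 2 * pi * (norm z)\<^sup>2 / Re z" unfolding r_def by simp
    have 1: "(sqrt (pi / r))\<^sup>2 = 2 * pi * (norm z)\<^sup>2 / Re z"
      unfolding pr[symmetric] using r by simp
    have 2: "(sqrt (pi / (2 * Re z)))\<^sup>2 = pi / (2 * Re z)" using assms by simp
    show "(2 * pi * sqrt (pi / (2 * Re z)))\<^sup>2 = (pi / norm z * sqrt (pi / r))\<^sup>2"
      unfolding power_mult_distrib power_divide 1 2 using z(2) assms by (simp add: divide_simps)
  qed (use assms r in auto)
  have "sqrt (pi / r) ^ DIM('a) > 0" using r by simp
  moreover have "(norm ?A)\<^sup>2 * sqrt (pi / r) ^ DIM('a) = (pi / norm z) ^ DIM('a) * sqrt (pi / r) ^ DIM('a)"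
    using A unfolding B power_mult_distrib .
  ultimately have "(norm ?A)\<^sup>2 = (pi / norm z) ^ DIM('a)"
    using r by (subst (asm) mult_cancel_right) auto
  also have "\<dots> = ((sqrt (pi / norm z))\<^sup>2) ^ DIM('a)"
    by simp
  also have "\<dots> = (sqrt (pi / norm z) ^ DIM('a))\<^sup>2"
    by (simp only: power_mult[symmetric] mult.commute)
  finally have "(norm ?A)\<^sup>2 = (sqrt (pi / norm z) ^ DIM('a))\<^sup>2" .
  then show ?thesis by (rule power2_eq_imp_eq) auto
qed

section \<open>Orthogonality of characters on the torus\<close>

lemma integral_lborel_prod:
  fixes f :: "'a::euclidean_space \<Rightarrow> real \<Rightarrow> complex"
  assumes "\<And>b. b \<in> Basis \<Longrightarrow> integrable lborel (f b)"
  shows "integrable lborel (\<lambda>x. \<Prod>b\<in>Basis. f b (x \<bullet> b))"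
    and "(LINT x|lborel. (\<Prod>b\<in>Basis. f b (x \<bullet> b))) = (\<Prod>b\<in>Basis. (LINT t|lborel. f b t))"
proof -
  interpret product_sigma_finite "\<lambda>_ :: 'a. lborel :: real measure" ..
  have m: "f b \<in> borel_measurable borel" if "b \<in> Basis" for b
    using borel_measurable_integrable[OF assms[OF that]] by simp
  have m1 [measurable]: "(\<lambda>x. f b (x \<bullet> b)) \<in> borel_measurable borel" if "b \<in> Basis" for b
    by (rule measurable_compose[OF _ m[OF that]]) simp
  have m2: "(\<lambda>x. \<Prod>b\<in>Basis. f b (x \<bullet> b)) \<in> borel_measurable borel"
    by (rule borel_measurable_prod) (rule m1)
  have m3 [measurable]: "(\<lambda>x :: 'a \<Rightarrow> real. \<Sum>b\<in>Basis. x b *\<^sub>R b) \<in> (\<Pi>\<^sub>M b\<in>Basis. lborel) \<rightarrow>\<^sub>M borel"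
    by measurable
  have eq: "(\<Prod>b\<in>Basis. f b ((\<Sum>c\<in>Basis. x c *\<^sub>R c) \<bullet> b)) = (\<Prod>b\<in>Basis. f b (x b))" for x
    by (intro prod.cong refl) simp
  show "integrable lborel (\<lambda>x. \<Prod>b\<in>Basis. f b (x \<bullet> b))"
    unfolding lborel_eq[where 'a='a] integrable_distr_eq[OF m3 m2] eq
    by (rule product_integrable_prod) (use assms in auto)
  show "(LINT x|lborel. (\<Prod>b\<in>Basis. f b (x \<bullet> b))) = (\<Prod>b\<in>Basis. (LINT t|lborel. f b t))"
    unfolding lborel_eq[where 'a='a] integral_distr[OF m3 m2] eq
    by (rule product_integral_prod) (use assms in auto)
qed

lemma torus_integral_1:
  fixes j :: int
  shows "integrable lborel (\<lambda>t. indicator {0..2 * pi} t *\<^sub>R cis (of_int j * t))"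
    and "(LINT t|lborel. indicator {0..2 * pi} t *\<^sub>R cis (of_int j * t)) = (if j = 0 then of_real (2 * pi) else 0)"
proof -
  show "integrable lborel (\<lambda>t. indicator {0..2 * pi} t *\<^sub>R cis (of_int j * t))"
    by (rule borel_integrable_compact) (auto intro!: continuous_intros)
  show "(LINT t|lborel. indicator {0..2 * pi} t *\<^sub>R cis (of_int j * t)) = (if j = 0 then of_real (2 * pi) else 0)"
  proof (cases "j = 0")
    case False
    let ?F = "\<lambda>t. (- \<i> / of_int j) * cis (of_int j * t)"
    have "(LINT t|lborel. indicator {0..2 * pi} t *\<^sub>R cis (of_int j * t)) = ?F (2 * pi) - ?F 0"
    proof (rule integral_FTC_atLeastAtMost)
      fix t :: real
      have "(?F has_derivative (\<lambda>s. (- \<i> / of_int j) * ((of_int j * s) *\<^sub>R (\<i> * cis (of_int j * t))))) (at t within {0..2 * pi})"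
        by (rule has_derivative_eq_rhs[OF has_derivative_mult_right[OF has_derivative_cis[OF
                has_derivative_mult_right[OF has_derivative_ident]]]]) simp
      then show "(?F has_vector_derivative cis (of_int j * t)) (at t within {0..2 * pi})"
        unfolding has_vector_derivative_def
        by (rule has_derivative_eq_rhs) (use False in \<open>simp add: fun_eq_iff scaleR_conv_of_real complex_eq_iff\<close>)
    qed (auto intro!: continuous_intros)
    moreover have "cis (of_int j * (2 * pi)) = 1"
      using cis_multiple_2pi[of "of_int j"] by (simp add: mult.commute)
    ultimately show ?thesis using False by simp
  qed (simp add: scaleR_conv_of_real measure_def)
qed

lemma cis_sum: "finite A \<Longrightarrow> cis (\<Sum>x\<in>A. f x) = (\<Prod>x\<in>A. cis (f x))"
  by (induction A rule: finite_induct) (auto simp: cis_mult[symmetric])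

abbreviation "torus_cube \<equiv> cbox 0 (\<chi> i. 2 * pi)"

lemma torus_integral:
  fixes k :: "int^'m"
  shows "integrable lborel (\<lambda>x. indicator torus_cube x *\<^sub>R cis (ivec k \<bullet> x))"
    and "(LINT x|lborel. indicator torus_cube x *\<^sub>R cis (ivec k \<bullet> x)) = (if k = 0 then of_real (2 * pi) ^ CARD('m) else 0)"
proof -
  \<comment> \<open>A basis vector \<open>b\<close> does not expose its index; the floor turns the
    real number \<open>ivec k \<bullet> b\<close> back into the integer frequency that
    \<open>torus_integral_1\<close> expects.\<close>
  have eq: "indicator torus_cube x *\<^sub>R cis (ivec k \<bullet> x) =
      (\<Prod>b\<in>Basis. indicator {0..2 * pi} (x \<bullet> b) *\<^sub>R cis (of_int \<lfloor>ivec k \<bullet> b\<rfloor> * (x \<bullet> b)))" for x :: "real^'m"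
  proof -
    have "cis (ivec k \<bullet> x) = (\<Prod>b\<in>Basis. cis (of_int \<lfloor>ivec k \<bullet> b\<rfloor> * (x \<bullet> b)))"
      by (subst euclidean_inner, subst cis_sum) (auto intro!: prod.cong simp: Basis_vec_def inner_axis ivec_def)
    moreover have "(indicator torus_cube x :: real) = (\<Prod>b\<in>Basis. indicator {0..2 * pi} (x \<bullet> b))"
    proof -
      have mem: "x \<in> torus_cube \<longleftrightarrow> (\<forall>b\<in>Basis. x \<bullet> b \<in> {0..2 * pi})"
        by (auto simp: Basis_vec_def inner_axis mem_box)
      show ?thesis
      proof (cases "x \<in> torus_cube")
        case True
        then show ?thesis unfolding mem by (simp add: mem del: atLeastAtMost_iff)
      next
        case False
        then obtain b where "b \<in> Basis" "x \<bullet> b \<notin> {0..2 * pi}" unfolding mem by blast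
        then have "(\<Prod>b\<in>Basis. indicator {0..2 * pi} (x \<bullet> b) :: real) = 0"
          by (intro prod_zero bexI[of _ b]) (simp_all del: atLeastAtMost_iff)
        then show ?thesis using False by simp
      qed
    qed
    ultimately show ?thesis by (simp add: scaleR_conv_of_real prod.distrib)
  qed
  show "integrable lborel (\<lambda>x :: real^'m. indicator torus_cube x *\<^sub>R cis (ivec k \<bullet> x))"
    unfolding eq by (rule integral_lborel_prod(1)) (rule torus_integral_1)
  have "(LINT x|lborel. indicator torus_cube x *\<^sub>R cis (ivec k \<bullet> x)) =
      (\<Prod>b\<in>(Basis :: (real^'m) set). if \<lfloor>ivec k \<bullet> b\<rfloor> = 0 then of_real (2 * pi) else 0)"
    unfolding eq by (subst integral_lborel_prod(2)) (auto simp: torus_integral_1)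
  also have "\<dots> = (if k = 0 then of_real (2 * pi) ^ CARD('m) else 0)"
  proof (cases "k = 0")
    case True
    then show ?thesis by (simp add: ivec_def zero_vec_def[symmetric])
  next
    case False
    then obtain i where i: "k $ i \<noteq> 0" by (auto simp: vec_eq_iff)
    have "(axis i 1 :: real^'m) \<in> Basis" by (simp add: axis_in_Basis_iff)
    moreover have "\<lfloor>ivec k \<bullet> axis i 1\<rfloor> \<noteq> 0" using i by (simp add: inner_axis ivec_def)
    ultimately have "(\<Prod>b\<in>(Basis :: (real^'m) set). if \<lfloor>ivec k \<bullet> b\<rfloor> = 0 then complex_of_real (2 * pi) else 0) = 0"
      by (intro prod_zero bexI[of _ "axis i 1"]) (simp_all only: if_False finite_Basis)
    then show ?thesis using False by simp
  qed
  finally show "(LINT x|lborel. indicator torus_cube x *\<^sub>R cis (ivec k \<bullet> x)) = (if k = 0 then of_real (2 * pi) ^ CARD('m) else 0)" .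
qed

section \<open>Multipliers and Lebesgue norms\<close>

lemma sets_waveguide_domain [simp]:
  "torus_cube \<times> (UNIV :: (real^'n) set) \<in> sets (borel :: ((real^'m) \<times> (real^'n)) measure)"
  by (rule borel_closed, rule closed_Times) auto

text \<open>Orthogonality in \<open>x\<close> selects \<open>j = k\<close>, and Fourier inversion in
  \<open>y\<close> returns \<open>h k\<close>. The factors (2 pi)^m and (2 pi)^n that arise are
  exactly what the normalisation of \<open>fourier\<close> divides out.\<close>

lemma fourier_wave:
  fixes P :: "(int^'m) set" and h :: "int^'m \<Rightarrow> real^'n \<Rightarrow> complex"
  assumes "finite P" "\<And>k. k \<in> P \<Longrightarrow> sfun (h k)"
  shows "fourier (wave P h) k \<xi> = (if k \<in> P then h k \<xi> else 0)"
proof -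
  let ?F = "\<lambda>j x. indicator torus_cube x *\<^sub>R cis (ivec (j - k) \<bullet> x)"
  let ?G = "\<lambda>j y. ift (h j) y * cis (y \<bullet> - \<xi>)"
  have F: "integrable lborel (?F j)" for j by (rule torus_integral(1))
  have G: "integrable lborel (?G j)" if "j \<in> P" for j
    using integrable_rapid[OF rapid_ift[OF assms(2)] borel_measurable_ift[OF assms(2)]] that
    by (intro integrable_ift) blast
  have "(LINT z|waveguide. wave P h z * exp (- \<i> * complex_of_real ((ivec k, \<xi>) \<bullet> z))) =
      (LINT z|lborel. indicator (torus_cube \<times> UNIV) z *\<^sub>R (wave P h z * exp (- \<i> * complex_of_real ((ivec k, \<xi>) \<bullet> z))))"
    unfolding waveguide_def by (rule integral_restrict_space) simp
  also have "\<dots> = (LINT z|lborel. (\<Sum>j\<in>P. ?F j (fst z) * ?G j (snd z)))"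
  proof (intro Bochner_Integration.integral_cong refl)
    fix z :: "(real^'m) \<times> (real^'n)"
    have *: "cis (ivec (j - k) \<bullet> fst z) * cis (snd z \<bullet> - \<xi>) =
       cis (ivec j \<bullet> fst z) * exp (- \<i> * complex_of_real ((ivec k, \<xi>) \<bullet> z))" for j
    proof -
      have "exp (- \<i> * complex_of_real ((ivec k, \<xi>) \<bullet> z)) = cis (- ((ivec k, \<xi>) \<bullet> z))"
        by (simp add: cis_conv_exp)
      moreover have "ivec (j - k) = ivec j - (ivec k :: real^'m)"
        by (simp add: ivec_def vec_eq_iff)
      moreover from this have "ivec (j - k) \<bullet> fst z + snd z \<bullet> - \<xi> = ivec j \<bullet> fst z + - ((ivec k, \<xi>) \<bullet> z)"
        by (simp add: inner_prod_def inner_diff_left inner_commute[of "snd z"])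
      ultimately show ?thesis by (simp only: cis_mult)
    qed
    show "indicator (torus_cube \<times> UNIV) z *\<^sub>R (wave P h z * exp (- \<i> * complex_of_real ((ivec k, \<xi>) \<bullet> z)))
        = (\<Sum>j\<in>P. ?F j (fst z) * ?G j (snd z))"
      unfolding wave_def sum_distrib_right scaleR_sum_right
    proof (intro sum.cong refl)
      fix j
      have "indicator (torus_cube \<times> UNIV) z = (indicator torus_cube (fst z) :: real)"
        by (auto simp: indicator_def mem_Times_iff)
      then show "indicator (torus_cube \<times> UNIV) z *\<^sub>R (cis (ivec j \<bullet> fst z) * ift (h j) (snd z) *
          exp (- \<i> * complex_of_real ((ivec k, \<xi>) \<bullet> z))) = ?F j (fst z) * ?G j (snd z)"
        using *[of j] by (simp add: mult_ac)
    qed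
  qed
  also have "\<dots> = (\<Sum>j\<in>P. (LINT z|lborel. ?F j (fst z) * ?G j (snd z)))"
  proof (rule Bochner_Integration.integral_sum)
    fix j assume "j \<in> P"
    from integrable_pair_mult[OF F G[OF this], of j]
    show "integrable lborel (\<lambda>z. ?F j (fst z) * ?G j (snd z))"
      by (simp add: lborel_prod case_prod_unfold)
  qed
  also have "\<dots> = (\<Sum>j\<in>P. if j = k then of_real (2 * pi) ^ (CARD('m) + CARD('n)) * h k \<xi> else 0)"
  proof (intro sum.cong refl)
    fix j assume j: "j \<in> P"
    have "(LINT z|lborel. ?F j (fst z) * ?G j (snd z)) = (LINT x|lborel. ?F j x) * (LINT y|lborel. ?G j y)"
      by (rule integral_pair_mult[OF F G[OF j]])
    also have "\<dots> = (if j - k = 0 then of_real (2 * pi) ^ CARD('m) else 0) * (of_real (2 * pi) ^ CARD('n) * h j \<xi>)"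
      using fourier_inversion[OF assms(2)[OF j], of \<xi>] torus_integral(2)[of "j - k"]
      by (simp add: ift_def[of "ift (h j)"])
    finally show "(LINT z|lborel. ?F j (fst z) * ?G j (snd z)) =
        (if j = k then of_real (2 * pi) ^ (CARD('m) + CARD('n)) * h k \<xi> else 0)"
      by (simp add: power_add)
  qed
  also have "\<dots> = (if k \<in> P then of_real (2 * pi) ^ (CARD('m) + CARD('n)) * h k \<xi> else 0)"
    using assms(1) by (simp add: sum.delta)
  finally show ?thesis
    unfolding fourier_def by simp
qed

text \<open>The single formula through which the propagator, the Bessel potential and the box
  operators are evaluated.\<close>

lemma multiplier_wave:
  fixes P :: "(int^'m) set" and h :: "int^'m \<Rightarrow> real^'n \<Rightarrow> complex"
  assumes "finite P" "\<And>k. k \<in> P \<Longrightarrow> sfun (h k)"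
  shows "multiplier a (wave P h) z = (\<Sum>k\<in>P. cis (ivec k \<bullet> fst z) * ift (\<lambda>\<xi>. a (ivec k, \<xi>) * h k \<xi>) (snd z))"
proof -
  let ?t = "\<lambda>k. cis (ivec k \<bullet> fst z) * ift (\<lambda>\<xi>. a (ivec k, \<xi>) * h k \<xi>) (snd z)"
  have "multiplier a (wave P h) z = (\<Sum>\<^sub>\<infinity>k. if k \<in> P then ?t k else 0)"
    unfolding multiplier_def
  proof (intro infsum_cong)
    fix k
    have "(LINT \<xi>|lborel. a (ivec k, \<xi>) * h k \<xi> * exp (\<i> * complex_of_real ((ivec k, \<xi>) \<bullet> z))) =
        (LINT \<xi>|lborel. cis (ivec k \<bullet> fst z) * (a (ivec k, \<xi>) * h k \<xi> * cis (\<xi> \<bullet> snd z)))"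
    proof (intro Bochner_Integration.integral_cong refl)
      fix \<xi>
      have "exp (\<i> * complex_of_real ((ivec k, \<xi>) \<bullet> z)) = cis (ivec k \<bullet> fst z) * cis (\<xi> \<bullet> snd z)"
        unfolding cis_conv_exp exp_add[symmetric] by (simp add: inner_prod_def distrib_left)
      then show "a (ivec k, \<xi>) * h k \<xi> * exp (\<i> * complex_of_real ((ivec k, \<xi>) \<bullet> z)) =
          cis (ivec k \<bullet> fst z) * (a (ivec k, \<xi>) * h k \<xi> * cis (\<xi> \<bullet> snd z))"
        by (simp add: mult_ac)
    qed
    also have "\<dots> = ?t k"
      unfolding ift_def by (rule integral_mult_right_zero)
    finally have "(LINT \<xi>|lborel. a (ivec k, \<xi>) * h k \<xi> * exp (\<i> * complex_of_real ((ivec k, \<xi>) \<bullet> z))) = ?t k" .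
    moreover have "fourier (wave P h) k \<xi> = (if k \<in> P then h k \<xi> else 0)" for \<xi>
      by (rule fourier_wave[OF assms(1)]) (rule assms(2))
    ultimately show "(LINT \<xi>|lborel. a (ivec k, \<xi>) * fourier (wave P h) k \<xi> * exp (\<i> * complex_of_real ((ivec k, \<xi>) \<bullet> z))) =
        (if k \<in> P then ?t k else 0)"
      by (cases "k \<in> P") simp_all
  qed
  also have "\<dots> = infsum ?t P"
    by (rule infsum_cong_neutral) auto
  also have "\<dots> = sum ?t P"
    by (rule infsum_finite[OF assms(1)])
  finally show ?thesis .
qed

section \<open>Bounds for Lebesgue norms\<close>

lemma epow_ennreal: "0 \<le> x \<Longrightarrow> epow (ennreal x) a = ennreal (x powr a)"
  by (simp add: epow_def)

lemma epow_mono: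
  assumes "x \<le> y" "0 \<le> a" shows "epow x a \<le> epow y a"
proof (cases "y = \<infinity>")
  case False
  then have "x \<noteq> \<infinity>" using assms(1) by (auto simp: top_unique)
  then show ?thesis using False assms
    by (auto simp: epow_def intro!: ennreal_leI powr_mono2 enn2real_mono simp: less_top)
qed (simp add: epow_def)

text \<open>With 1/\<infinity> = 0 the exponent \<open>enn2real (1 / p)\<close> also covers
  \<open>p = \<infinity>\<close>, so that all norm bounds below have one form for every
  exponent.\<close>

lemma ennreal_ge_1_cases:
  assumes "(1 :: ennreal) \<le> p"
  obtains (infinite) "p = \<infinity>" "enn2real (1 / p) = 0"
    | (finite) r where "p = ennreal r" "1 \<le> r" "enn2real (1 / p) = 1 / r"
proof (cases p rule: ennreal_cases)
  case (real r)
  then have "1 \<le> r" using assms by (metis ennreal_1 ennreal_le_iff)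
  moreover have "1 / p = ennreal (1 / r)"
    using \<open>1 \<le> r\<close> real divide_ennreal[of 1 r] by simp
  ultimately show thesis using finite[of r] real by simp
qed (use infinite in \<open>simp add: infinity_ennreal_def\<close>)

text \<open>Chebyshev's inequality. Monotonicity of the integral and the essential supremum give it
  for an arbitrary \<open>g\<close>, so the measurability of the propagator in space and time never
  has to be discussed.\<close>

lemma eLp_lower_bound:
  assumes p: "1 \<le> p" and E: "E \<in> sets M" "emeasure M E = ennreal v" "0 < v"
    and A: "0 \<le> A" "\<And>z. z \<in> E \<Longrightarrow> ennreal A \<le> g z"
  shows "ennreal (A * v powr enn2real (1 / p)) \<le> eLp p M g"
  using p
proof (cases rule: ennreal_ge_1_cases)
  case infinite
  have "ennreal A \<le> esssup M g"
  proof (rule ccontr)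
    assume "\<not> ennreal A \<le> esssup M g"
    then have less: "esssup M g < ennreal A" by simp
    have "AE z in M. z \<notin> E"
      using esssup_AE[where M=M and f=g] by eventually_elim (use A(2) less in \<open>metis leD order_trans\<close>)
    then have "emeasure M E = 0"
      using emeasure_eq_0_AE[where M=M and P="\<lambda>z. z \<in> E"] sets.sets_into_space[OF E(1)]
      by (simp add: Collect_conj_eq Int_absorb1)
    then show False using E by simp
  qed
  then show ?thesis using infinite E by (simp add: eLp_def)
next
  case (finite r)
  then have r: "enn2real p = r" "p \<noteq> \<infinity>" by simp_all
  have "ennreal (A powr r * v) = (\<integral>\<^sup>+z. ennreal (A powr r) * indicator E z \<partial>M)"
    using E by (simp add: nn_integral_cmult_indicator ennreal_mult)
  also have "\<dots> \<le> (\<integral>\<^sup>+z. epow (g z) r \<partial>M)"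
  proof (rule nn_integral_mono)
    fix z
    have "ennreal (A powr r) \<le> epow (g z) r" if "z \<in> E"
      using epow_mono[OF A(2)[OF that], of r] finite A(1) by (simp add: epow_ennreal)
    then show "ennreal (A powr r) * indicator E z \<le> epow (g z) r"
      by (auto simp: indicator_def)
  qed
  finally have "epow (ennreal (A powr r * v)) (1 / r) \<le> eLp p M g"
    using r finite unfolding eLp_def by (simp add: epow_mono)
  moreover have "(A powr r * v) powr (1 / r) = A * v powr (1 / r)"
    using A E finite by (simp add: powr_mult powr_powr)
  ultimately show ?thesis using finite E by (simp add: epow_ennreal)
qed

text \<open>The normalisation \<open>0 \<le> w \<le> 1\<close> gives w^r \<le> w for r \<ge> 1, so
  that a single bound \<open>V\<close> for the integral of the profile \<open>w\<close> serves every
  exponent.\<close>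

lemma eLp_upper_bound:
  assumes p: "1 \<le> p" and g: "g \<in> borel_measurable M" "\<And>z. z \<in> space M \<Longrightarrow> g z \<le> ennreal (A * w z)"
    and w: "w \<in> borel_measurable M" "\<And>z. 0 \<le> w z" "\<And>z. w z \<le> 1" "(\<integral>\<^sup>+z. ennreal (w z) \<partial>M) \<le> ennreal V"
    and A: "0 \<le> A" "0 < V"
  shows "eLp p M g \<le> ennreal (A * V powr enn2real (1 / p))"
  using p
proof (cases rule: ennreal_ge_1_cases)
  case infinite
  have "esssup M g \<le> ennreal A"
  proof (rule esssup_I[OF g(1)], rule AE_I2)
    fix z assume "z \<in> space M"
    then have "g z \<le> ennreal (A * w z)" by (rule g(2))
    also have "\<dots> \<le> ennreal A" using A w(2,3) by (intro ennreal_leI) (simp add: mult_left_le)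
    finally show "g z \<le> ennreal A" .
  qed
  then show ?thesis using infinite A by (simp add: eLp_def)
next
  case (finite r)
  then have r: "enn2real p = r" "p \<noteq> \<infinity>" by simp_all
  have "(\<integral>\<^sup>+z. epow (g z) r \<partial>M) \<le> (\<integral>\<^sup>+z. ennreal (A powr r) * ennreal (w z) \<partial>M)"
  proof (rule nn_integral_mono)
    fix z assume "z \<in> space M"
    then have "epow (g z) r \<le> epow (ennreal (A * w z)) r"
      using finite by (intro epow_mono g) auto
    also have "\<dots> = ennreal (A powr r * w z powr r)"
      using A w(2)[of z] by (simp add: epow_ennreal powr_mult)
    also have "\<dots> \<le> ennreal (A powr r * w z)"
    proof -
      have "w z powr r \<le> w z powr 1"
        using w(2,3)[of z] finite by (intro powr_mono') auto
      then show ?thesis using w(2)[of z] by (intro ennreal_leI mult_left_mono) auto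
    qed
    finally show "epow (g z) r \<le> ennreal (A powr r) * ennreal (w z)"
      by (simp add: ennreal_mult' w)
  qed
  also have "\<dots> = ennreal (A powr r) * (\<integral>\<^sup>+z. ennreal (w z) \<partial>M)"
    using w(1) by (intro nn_integral_cmult) simp
  also have "\<dots> \<le> ennreal (A powr r) * ennreal V"
    by (intro mult_left_mono w) simp
  finally have "eLp p M g \<le> epow (ennreal (A powr r * V)) (1 / r)"
    using r finite unfolding eLp_def by (simp add: epow_mono ennreal_mult')
  moreover have "(A powr r * V) powr (1 / r) = A * V powr (1 / r)"
    using A finite by (simp add: powr_mult powr_powr)
  ultimately show ?thesis using finite A by (simp add: epow_ennreal)
qed

section \<open>Lower bounds in the absence of cancellation\<close>

lemma cos_ge_1_minus_abs: "1 - \<bar>x\<bar> \<le> cos (x :: real)"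
proof -
  have "cos x = 1 - 2 * (sin (x / 2))\<^sup>2" using cos_double_sin[of "x / 2"] by simp
  moreover have "(sin (x / 2))\<^sup>2 \<le> \<bar>sin (x / 2)\<bar> * 1"
    using mult_left_mono[OF abs_sin_le_one, of "\<bar>sin (x / 2)\<bar>" "x / 2"] by (simp add: power2_eq_square)
  moreover have "\<bar>sin (x / 2)\<bar> \<le> \<bar>x / 2\<bar>" by (rule abs_sin_x_le_abs_x)
  ultimately show ?thesis by simp
qed

text \<open>After rotation by the common phase \<open>\<phi>\<close> the real part is at least the
  integral of \<open>w\<close> times 1 - |deviation|. Only the weighted mean of the deviation has to
  be at most 1/2; this form admits the Gaussian weights of (i), under which the phase is
  unbounded.\<close>

lemma norm_phase_sum_ge:
  fixes w :: "'k \<Rightarrow> 'a \<Rightarrow> real" and \<theta> :: "'k \<Rightarrow> 'a \<Rightarrow> real"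
  assumes w: "\<And>k. k \<in> P \<Longrightarrow> integrable M (w k)" "\<And>k \<xi>. 0 \<le> w k \<xi>"
    and \<theta>: "\<And>k. k \<in> P \<Longrightarrow> \<theta> k \<in> borel_measurable M"
    and int: "\<And>k. k \<in> P \<Longrightarrow> integrable M (\<lambda>\<xi>. w k \<xi> * \<bar>\<theta> k \<xi> - \<phi>\<bar>)"
    and le: "\<And>k. k \<in> P \<Longrightarrow> (LINT \<xi>|M. w k \<xi> * \<bar>\<theta> k \<xi> - \<phi>\<bar>) \<le> (LINT \<xi>|M. w k \<xi>) / 2"
  shows "(\<Sum>k\<in>P. (LINT \<xi>|M. w k \<xi>)) / 2 \<le> norm (\<Sum>k\<in>P. (LINT \<xi>|M. of_real (w k \<xi>) * cis (\<theta> k \<xi>)))"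
proof -
  have one: "(LINT \<xi>|M. w k \<xi>) / 2 \<le> Re (cis (- \<phi>) * (LINT \<xi>|M. of_real (w k \<xi>) * cis (\<theta> k \<xi>)))" if "k \<in> P" for k
  proof -
    have wc: "integrable M (\<lambda>\<xi>. complex_of_real (w k \<xi>) * cis (\<theta> k \<xi> - \<phi>))"
      by (intro integrable_mult_cis integrable_of_real w borel_measurable_diff \<theta> that) simp
    have "cis (- \<phi>) * (LINT \<xi>|M. of_real (w k \<xi>) * cis (\<theta> k \<xi>)) = (LINT \<xi>|M. of_real (w k \<xi>) * cis (\<theta> k \<xi> - \<phi>))"
      unfolding integral_mult_right_zero[symmetric]
      by (intro Bochner_Integration.integral_cong refl) (simp add: mult.left_commute cis_mult)
    then have "Re (cis (- \<phi>) * (LINT \<xi>|M. of_real (w k \<xi>) * cis (\<theta> k \<xi>))) = (LINT \<xi>|M. w k \<xi> * cos (\<theta> k \<xi> - \<phi>))"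
      using integral_Re[OF wc] by simp
    moreover have "(LINT \<xi>|M. w k \<xi> - w k \<xi> * \<bar>\<theta> k \<xi> - \<phi>\<bar>) \<le> (LINT \<xi>|M. w k \<xi> * cos (\<theta> k \<xi> - \<phi>))"
    proof (rule integral_mono)
      show "integrable M (\<lambda>\<xi>. w k \<xi> - w k \<xi> * \<bar>\<theta> k \<xi> - \<phi>\<bar>)"
        using w(1) int that by auto
      show "integrable M (\<lambda>\<xi>. w k \<xi> * cos (\<theta> k \<xi> - \<phi>))"
        using integrable_Re[OF wc] by simp
      show "w k \<xi> - w k \<xi> * \<bar>\<theta> k \<xi> - \<phi>\<bar> \<le> w k \<xi> * cos (\<theta> k \<xi> - \<phi>)" for \<xi>
        using mult_left_mono[OF cos_ge_1_minus_abs[of "\<theta> k \<xi> - \<phi>"] w(2)[of k \<xi>]] by (simp add: right_diff_distrib)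
    qed
    moreover have "(LINT \<xi>|M. w k \<xi> - w k \<xi> * \<bar>\<theta> k \<xi> - \<phi>\<bar>) = (LINT \<xi>|M. w k \<xi>) - (LINT \<xi>|M. w k \<xi> * \<bar>\<theta> k \<xi> - \<phi>\<bar>)"
      using w(1) int that by (intro Bochner_Integration.integral_diff) auto
    ultimately show ?thesis using le[OF that] by linarith
  qed
  have "(\<Sum>k\<in>P. (LINT \<xi>|M. w k \<xi>)) / 2 \<le> (\<Sum>k\<in>P. Re (cis (- \<phi>) * (LINT \<xi>|M. of_real (w k \<xi>) * cis (\<theta> k \<xi>))))"
    unfolding sum_divide_distrib by (intro sum_mono one)
  also have "\<dots> = Re (cis (- \<phi>) * (\<Sum>k\<in>P. (LINT \<xi>|M. of_real (w k \<xi>) * cis (\<theta> k \<xi>))))"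
    by (simp only: sum_distrib_left Re_sum)
  also have "\<dots> \<le> norm (cis (- \<phi>) * (\<Sum>k\<in>P. (LINT \<xi>|M. of_real (w k \<xi>) * cis (\<theta> k \<xi>))))"
    by (rule complex_Re_le_cmod)
  finally show ?thesis by (simp add: norm_mult)
qed

text \<open>A corner and not a symmetric neighbourhood of the origin, because it has to lie in the
  fundamental cube, which begins at 0.\<close>

definition small_box :: "real \<Rightarrow> ((real^'m) \<times> (real^'n)) set" where
  "small_box d = cbox 0 (\<chi> i. d) \<times> cbox 0 (\<chi> j. d)"

lemma emeasure_const_cbox:
  assumes "0 \<le> d" shows "emeasure lborel (cbox 0 (\<chi> i. d) :: (real^'m) set) = ennreal (d ^ CARD('m))"
proof -
  have d: "(\<chi> i. d) \<bullet> b = d" if "b \<in> Basis" for b :: "real^'m"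
    using that by (auto simp: Basis_vec_def inner_axis)
  show ?thesis
    by (subst emeasure_lborel_cbox) (use assms in \<open>auto simp: d prod_constant\<close>)
qed

lemma small_box_measure:
  assumes "0 \<le> d" "d \<le> 2 * pi"
  shows "(small_box d :: ((real^'m) \<times> (real^'n)) set) \<in> sets waveguide"
    and "emeasure waveguide (small_box d :: ((real^'m) \<times> (real^'n)) set) = ennreal (d ^ (CARD('m) + CARD('n)))"
proof -
  let ?E = "small_box d :: ((real^'m) \<times> (real^'n)) set"
  have sub: "?E \<subseteq> torus_cube \<times> UNIV"
    using assms by (auto simp: small_box_def mem_box_cart) (meson order_trans)
  have E: "?E \<in> sets borel"
    unfolding small_box_def by (rule borel_closed, rule closed_Times) auto
  show "?E \<in> sets waveguide"
    unfolding waveguide_def using E sub by (auto simp: sets_restrict_space_iff)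
  have "emeasure waveguide ?E = emeasure lborel ?E"
    unfolding waveguide_def by (rule emeasure_restrict_space) (use sub in auto)
  also have "\<dots> = emeasure (lborel \<Otimes>\<^sub>M lborel) (cbox 0 (\<chi> i. d :: real^'m) \<times> cbox 0 (\<chi> j. d :: real^'n))"
    by (simp add: small_box_def lborel_prod)
  also have "\<dots> = ennreal (d ^ CARD('m)) * ennreal (d ^ CARD('n))"
    by (subst lborel.emeasure_pair_measure_Times) (simp_all add: emeasure_const_cbox[OF assms(1)])
  finally show "emeasure waveguide ?E = ennreal (d ^ (CARD('m) + CARD('n)))"
    using assms by (simp add: power_add ennreal_mult)
qed

lemma unit_time_interval:
  assumes "0 \<le> t0" "0 \<le> s" "t0 + s \<le> 1"
  shows "{t0..t0 + s} \<in> sets unit_time" and "emeasure unit_time {t0..t0 + s} = ennreal s"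
proof -
  show "{t0..t0 + s} \<in> sets unit_time"
    unfolding unit_time_def using assms by (auto simp: sets_restrict_space_iff)
  show "emeasure unit_time {t0..t0 + s} = ennreal s"
    unfolding unit_time_def using assms by (subst emeasure_restrict_space) auto
qed

lemma sigma_finite_unit_time: "sigma_finite_measure unit_time"
proof -
  have "emeasure unit_time (space unit_time) = 1"
    unfolding unit_time_def by (simp add: space_restrict_space emeasure_restrict_space)
  then have "finite_measure unit_time" by (intro finite_measureI) simp
  then show ?thesis by (rule finite_measure.sigma_finite_measure)
qed

lemma mixed_norm_lower_bound:
  fixes F :: "(real^'m) \<times> (real^'n) \<Rightarrow> real \<Rightarrow> complex"
  assumes "1 \<le> q" "1 \<le> r" and d: "0 < d" "d \<le> 2 * pi" and t: "0 \<le> t0" "0 < s" "t0 + s \<le> 1"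
    and A: "0 \<le> A" "\<And>z t. z \<in> small_box d \<Longrightarrow> t \<in> {t0..t0 + s} \<Longrightarrow> A \<le> norm (F z t)"
  shows "ennreal (A * s powr enn2real (1 / r) * (d ^ (CARD('m) + CARD('n))) powr enn2real (1 / q)) \<le> mixed_norm q r F"
  unfolding mixed_norm_def
proof (rule eLp_lower_bound[OF assms(1) small_box_measure])
  fix z :: "(real^'m) \<times> (real^'n)" assume "z \<in> small_box d"
  then show "ennreal (A * s powr enn2real (1 / r)) \<le> Lp_norm r unit_time (F z)"
    unfolding Lp_norm_def using t
    by (intro eLp_lower_bound[OF assms(2) unit_time_interval] A ennreal_leI) auto
qed (use d A in auto)

lemma Lp_norm_lower_bound:
  fixes F :: "(real^'m) \<times> (real^'n) \<Rightarrow> real \<Rightarrow> complex"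
  assumes "1 \<le> p" and d: "0 < d" "d \<le> 2 * pi" and t: "0 < s" "s \<le> 1"
    and A: "0 \<le> A" "\<And>z t. z \<in> small_box d \<Longrightarrow> t \<in> {0..s} \<Longrightarrow> A \<le> norm (F z t)"
  shows "ennreal (A * (d ^ (CARD('m) + CARD('n)) * s) powr enn2real (1 / p))
    \<le> Lp_norm p (waveguide \<Otimes>\<^sub>M unit_time) (\<lambda>(z, t). F z t)"
  unfolding Lp_norm_def
proof (rule eLp_lower_bound[OF assms(1)])
  interpret sigma_finite_measure unit_time by (rule sigma_finite_unit_time)
  let ?E = "small_box d :: ((real^'m) \<times> (real^'n)) set"
  have E: "?E \<in> sets waveguide" "{0..s} \<in> sets unit_time"
    using small_box_measure(1)[of d] unit_time_interval(1)[of 0 s] d t by auto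
  show "?E \<times> {0..s} \<in> sets (waveguide \<Otimes>\<^sub>M unit_time)" using E by (rule pair_measureI)
  show "emeasure (waveguide \<Otimes>\<^sub>M unit_time) (?E \<times> {0..s}) = ennreal (d ^ (CARD('m) + CARD('n)) * s)"
    using emeasure_pair_measure_Times[OF E] unit_time_interval(2)[of 0 s] d t small_box_measure(2)[of d, where 'm='m and 'n='n]
    by (simp add: ennreal_mult)
  show "ennreal A \<le> ennreal (norm (case zt of (z, t) \<Rightarrow> F z t))" if "zt \<in> ?E \<times> {0..s}" for zt
    using that A(2) by (auto intro: ennreal_leI)
qed (use d t A in auto)

lemma nn_integral_waveguide_snd:
  fixes w :: "real^'n \<Rightarrow> real"
  assumes "w \<in> borel_measurable borel"
  shows "(\<integral>\<^sup>+z. ennreal (w (snd z)) \<partial>(waveguide :: ((real^'m) \<times> (real^'n)) measure))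
    = ennreal ((2 * pi) ^ CARD('m)) * (\<integral>\<^sup>+y. ennreal (w y) \<partial>lborel)"
proof -
  note [measurable] = assms
  let ?c = "torus_cube :: (real^'m) set"
  have "(\<integral>\<^sup>+z. ennreal (w (snd z)) \<partial>(waveguide :: ((real^'m) \<times> (real^'n)) measure))
      = (\<integral>\<^sup>+z. ennreal (w (snd z)) * indicator (?c \<times> UNIV) z \<partial>lborel)"
    unfolding waveguide_def by (rule nn_integral_restrict_space) simp
  also have "\<dots> = (\<integral>\<^sup>+z. indicator ?c (fst z) * ennreal (w (snd z)) \<partial>(lborel \<Otimes>\<^sub>M lborel))"
    unfolding lborel_prod by (intro nn_integral_cong) (auto simp: indicator_def mem_Times_iff)
  also have "\<dots> = (\<integral>\<^sup>+x. \<integral>\<^sup>+y. indicator ?c x * ennreal (w y) \<partial>lborel \<partial>lborel)"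
    by (subst lborel.nn_integral_fst[symmetric]) simp_all
  also have "\<dots> = (\<integral>\<^sup>+x. indicator ?c x * (\<integral>\<^sup>+y. ennreal (w y) \<partial>lborel) \<partial>lborel)"
    by (intro nn_integral_cong nn_integral_cmult) simp
  also have "\<dots> = ennreal ((2 * pi) ^ CARD('m)) * (\<integral>\<^sup>+y. ennreal (w y) \<partial>lborel)"
    by (subst nn_integral_multc) (simp_all add: emeasure_const_cbox)
  finally show ?thesis .
qed

lemma powr_exponent_le:
  fixes g :: "nat \<Rightarrow> real"
  assumes "filterlim g at_top sequentially" "\<And>n. g n > 0" "c > 0"
    and "\<And>n. c * g n powr a \<le> C * g n powr b"
  shows "a \<le> b"
proof (rule ccontr)
  assume "\<not> a \<le> b"
  then have "filterlim (\<lambda>n. g n powr (a - b)) at_top sequentially"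
    by (intro filterlim_compose[OF real_powr_at_top assms(1)]) simp
  then have "eventually (\<lambda>n. g n powr (a - b) > C / c) sequentially"
    by (simp add: filterlim_at_top_dense)
  then obtain n where n: "g n powr (a - b) > C / c" by (auto simp: eventually_sequentially)
  have "c * (g n powr (a - b) * g n powr b) \<le> C * g n powr b"
    using assms(4)[of n] by (simp add: powr_add[symmetric])
  then have "c * g n powr (a - b) \<le> C"
    using assms(2)[of n] by simp
  then show False using n assms(3) by (simp add: field_simps)
qed

lemma enn2real_divide_ge_1:
  assumes "(1 :: ennreal) \<le> p" shows "enn2real (2 / p) = 2 * enn2real (1 / p)"
  using assms
proof (cases rule: ennreal_ge_1_cases)
  case (finite r)
  have "2 / p = ennreal (2 / r)" using finite divide_ennreal[of 2 r] by simp
  then show ?thesis using finite by simp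
qed (simp add: infinity_ennreal_def)

section \<open>Modulation spaces\<close>

lemma borel_measurable_waveguideI:
  "f \<in> borel_measurable borel \<Longrightarrow> f \<in> borel_measurable waveguide"
  unfolding waveguide_def by (intro measurable_restrict_space1) simp

lemma Lp_norm_decay_bound:
  fixes F :: "(real^'m) \<times> (real^'n) \<Rightarrow> complex"
  assumes p: "1 \<le> p" and F: "F \<in> borel_measurable borel" "\<And>z. norm (F z) \<le> A * w (snd z)"
    and w: "w \<in> borel_measurable borel" "\<And>y. 0 \<le> w y" "\<And>y. w y \<le> 1" "integrable lborel w" "(LINT y|lborel. w y) \<le> V"
    and A: "0 \<le> A" "0 < V"
  shows "Lp_norm p waveguide F \<le> ennreal (A * ((2 * pi) ^ CARD('m) * V) powr enn2real (1 / p))"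
  unfolding Lp_norm_def
proof (rule eLp_upper_bound[OF p, where w="\<lambda>z. w (snd z)"])
  show "(\<lambda>z. ennreal (norm (F z))) \<in> borel_measurable waveguide"
    by (rule borel_measurable_waveguideI) (use F(1) in measurable)
  show "(\<lambda>z. w (snd z)) \<in> borel_measurable waveguide"
    by (intro borel_measurable_waveguideI measurable_compose[OF borel_measurable_continuous_onI w(1)] continuous_intros)
  have "(\<integral>\<^sup>+y. ennreal (w y) \<partial>lborel) \<le> ennreal V"
    using w by (subst nn_integral_eq_integral) (auto intro: ennreal_leI)
  then show "(\<integral>\<^sup>+z. ennreal (w (snd z)) \<partial>(waveguide :: ((real^'m) \<times> (real^'n)) measure)) \<le> ennreal ((2 * pi) ^ CARD('m) * V)"
    unfolding nn_integral_waveguide_snd[OF w(1)] using A by (simp add: ennreal_mult' mult_left_mono)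
qed (use F w A in \<open>auto intro: ennreal_leI\<close>)

lemma norm_le_const_vec:
  fixes x :: "real^'n" and c :: real
  assumes "\<And>i. \<bar>x $ i\<bar> \<le> c"
  shows "norm x \<le> CARD('n) * c"
proof -
  have "norm x \<le> (\<Sum>i\<in>UNIV. \<bar>x $ i\<bar>)" by (rule norm_le_l1_cart)
  also have "\<dots> \<le> (\<Sum>i\<in>(UNIV :: 'n set). c)" by (intro sum_mono assms)
  finally show ?thesis by simp
qed

lemma abs_inner_le_const_vec:
  fixes x y :: "real^'n" and a b :: real
  assumes "\<And>i. \<bar>x $ i\<bar> \<le> a" "\<And>i. \<bar>y $ i\<bar> \<le> b"
  shows "\<bar>x \<bullet> y\<bar> \<le> CARD('n) * (a * b)"
proof -
  have "\<bar>x \<bullet> y\<bar> \<le> (\<Sum>i\<in>UNIV. \<bar>x $ i * y $ i\<bar>)"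
    unfolding inner_vec_def by (rule order_trans[OF sum_abs]) simp
  also have "\<dots> \<le> (\<Sum>i\<in>(UNIV :: 'n set). a * b)"
    unfolding abs_mult by (intro sum_mono mult_mono assms order_trans[OF abs_ge_zero assms(1)]) auto
  finally show ?thesis by simp
qed

section \<open>The partition of unity and the test data of (ii)\<close>

locale partition =
  fixes \<sigma> :: "(real^'m) \<times> (real^'n) \<Rightarrow> real"
  assumes unit_cube_partition: "unit_cube_partition \<sigma>"
begin

lemmas unit_cube_partition_unfolded = unit_cube_partition[unfolded unit_cube_partition_def]

lemma smooth_sigma: "smooth \<sigma>"
  by (rule conjunct1[OF unit_cube_partition_unfolded])

lemma sigma_nonneg: "0 \<le> \<sigma> z"
  by (rule conjunct1[OF conjunct2[OF unit_cube_partition_unfolded], THEN spec])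

lemma sigma_closure: "closure {\<zeta>. \<sigma> \<zeta> \<noteq> 0} \<subseteq>
    {(k, \<xi>). (\<forall>i. -3/4 \<le> k $ i \<and> k $ i < 3/4) \<and> (\<forall>j. -3/4 \<le> \<xi> $ j \<and> \<xi> $ j < 3/4)}"
  by (rule conjunct1[OF conjunct2[OF conjunct2[OF unit_cube_partition_unfolded]]])

lemma sigma_has_sum: "((\<lambda>K. \<sigma> (z - lattice_pt K)) has_sum 1) UNIV"
  by (rule conjunct2[OF conjunct2[OF conjunct2[OF unit_cube_partition_unfolded]], THEN spec])

lemma sigma_support:
  assumes "\<sigma> z \<noteq> 0" shows "\<bar>fst z $ i\<bar> \<le> 3/4" "\<bar>snd z $ j\<bar> \<le> 3/4"
proof -
  have "z \<in> closure {\<zeta>. \<sigma> \<zeta> \<noteq> 0}" 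
    by (rule subsetD[OF closure_subset]) (simp add: assms)
  from subsetD[OF sigma_closure this]
  have "\<forall>i. -3/4 \<le> fst z $ i \<and> fst z $ i < 3/4" "\<forall>j. -3/4 \<le> snd z $ j \<and> snd z $ j < 3/4"
    by (simp_all add: case_prod_unfold)
  from this(1)[rule_format, of i] this(2)[rule_format, of j]
  show "\<bar>fst z $ i\<bar> \<le> 3/4" "\<bar>snd z $ j\<bar> \<le> 3/4" by (auto simp: abs_le_iff)
qed

text \<open>Since 3/4 < 1, all other translates vanish at this lattice point, so one term carries
  the whole sum 1. This is how the nontriviality of \<open>psi\<close> is known.\<close>

lemma sigma_0: "\<sigma> 0 = 1"
proof -
  have zero: "\<sigma> (0 - lattice_pt K) = 0" if "K \<noteq> 0" for K :: "(int^'m) \<times> (int^'n)"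
  proof (rule ccontr)
    assume *: "\<sigma> (0 - lattice_pt K) \<noteq> 0"
    have "fst K $ i = 0" for i
    proof -
      have "\<bar>real_of_int (fst K $ i)\<bar> \<le> 3/4"
        using sigma_support(1)[OF *, of i] by (simp add: lattice_pt_def ivec_def)
      then show ?thesis by linarith
    qed
    moreover have "snd K $ j = 0" for j
    proof -
      have "\<bar>real_of_int (snd K $ j)\<bar> \<le> 3/4"
        using sigma_support(2)[OF *, of j] by (simp add: lattice_pt_def ivec_def)
      then show ?thesis by linarith
    qed
    ultimately show False using that by (simp add: prod_eq_iff vec_eq_iff)
  qed
  let ?O = "{0 :: (int^'m) \<times> (int^'n)}"
  have "((\<lambda>K. \<sigma> (0 - lattice_pt K)) has_sum 1) ?O"
  proof (rule has_sum_cong_neutral[THEN iffD1])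
    show "((\<lambda>K. \<sigma> (0 - lattice_pt K)) has_sum 1) UNIV" by (rule sigma_has_sum)
  qed (use zero in auto)
  from has_sum_unique[OF this has_sum_finite]
  have "1 = \<sigma> (0 - lattice_pt (0 :: (int^'m) \<times> (int^'n)))" by simp
  moreover have "lattice_pt (0 :: (int^'m) \<times> (int^'n)) = 0"
    by (simp add: lattice_pt_def ivec_def zero_vec_def zero_prod_def)
  ultimately show ?thesis by simp
qed

text \<open>The slice over torus frequency 0. Torus frequencies are integers and the support has
  radius 3/4 < 1, so the box operator at \<open>K\<close> acts on the frequency \<open>fst K\<close>
  alone, by a translate of this slice.\<close>

definition psi :: "real^'n \<Rightarrow> real" where
  "psi \<xi> = \<sigma> (0, \<xi>)"

abbreviation psic :: "real^'n \<Rightarrow> complex" where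
  "psic \<xi> \<equiv> complex_of_real (psi \<xi>)"

lemma sfun_psi: "sfun psic"
  unfolding psi_def
proof (rule sfun_section[OF smooth_sigma])
  fix z :: "(real^'m) \<times> (real^'n)" assume z: "norm z > real CARD('m) + real CARD('n)"
  show "\<sigma> z = 0"
  proof (rule ccontr)
    assume nz: "\<sigma> z \<noteq> 0"
    have "norm (fst z) \<le> CARD('m) * (3/4)" "norm (snd z) \<le> CARD('n) * (3/4)"
      by (rule norm_le_const_vec[OF sigma_support(1)[OF nz]], rule norm_le_const_vec[OF sigma_support(2)[OF nz]])
    moreover have "norm z \<le> norm (fst z) + norm (snd z)" using norm_Pair_le[of "fst z" "snd z"] by simp
    moreover have "CARD('m) * (3/4 :: real) \<le> CARD('m)" "CARD('n) * (3/4 :: real) \<le> CARD('n)" by simp_all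
    ultimately show False using z by linarith
  qed
qed

lemma psi_nonneg: "0 \<le> psi \<xi>" by (simp add: psi_def sigma_nonneg)

lemma psi_support: "psi \<xi> \<noteq> 0 \<Longrightarrow> \<bar>\<xi> $ j\<bar> \<le> 3/4"
  unfolding psi_def using sigma_support(2)[of "(0, \<xi>)"] by simp

lemma integrable_psi: "integrable lborel psi"
  using integrable_Re[OF sfun_integrable[OF sfun_psi]] by simp

definition psi_mass :: real where "psi_mass = (LINT \<xi>|lborel. psi \<xi>)"

text \<open>A vanishing integral of the nonnegative \<open>psi\<close> would make its transform
  vanish identically, and then \<open>integral_ift\<close> would force \<open>psi\<close> to be 0 at
  the origin, where it is 1.\<close>

lemma psi_mass_pos: "psi_mass > 0"
proof (rule ccontr)
  assume "\<not> psi_mass > 0"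
  moreover have "psi_mass \<ge> 0" unfolding psi_mass_def by (simp add: psi_nonneg)
  ultimately have "psi_mass = 0" by linarith
  then have "(LINT \<xi>|lborel. norm (psic \<xi>)) = 0"
    by (simp add: psi_mass_def psi_nonneg)
  then have "ift psic y = 0" for y using norm_ift_le[of psic y] by simp
  then have "of_real (2 * pi) ^ DIM(real^'n) * psic 0 = 0"
    using integral_ift[OF sfun_psi] by simp
  then show False using sigma_0 by (simp add: psi_def zero_prod_def)
qed

definition rho :: "(int^'n) set \<Rightarrow> real^'n \<Rightarrow> real" where
  "rho L \<xi> = (\<Sum>l\<in>L. psi (\<xi> - ivec l))"

lemma sfun_rho: "sfun (\<lambda>\<xi>. complex_of_real (rho L \<xi>))"
  unfolding rho_def of_real_sum by (rule sfun_sum) (rule sfun_shift[OF sfun_psi])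

lemma integrable_rho: "integrable lborel (rho L)"
  using integrable_Re[OF sfun_integrable[OF sfun_rho]] by simp

lemma rho_nonneg: "0 \<le> rho L \<xi>" unfolding rho_def by (intro sum_nonneg psi_nonneg)

lemma integral_rho: "(LINT \<xi>|lborel. rho L \<xi>) = card L * psi_mass"
proof -
  have psi_m: "psi \<in> borel_measurable borel" 
    by (rule borel_measurable_integrable[OF integrable_psi, unfolded measurable_lborel2])
  have shift: "integrable lborel (\<lambda>\<xi>. psi (\<xi> - ivec l))" for l :: "int^'n"
    using integrable_Re[OF sfun_integrable[OF sfun_shift[OF sfun_psi, of "ivec l"]]] by simp
  have "(LINT \<xi>|lborel. rho L \<xi>) = (\<Sum>l\<in>L. (LINT \<xi>|lborel. psi (\<xi> - ivec l)))"
    unfolding rho_def by (rule Bochner_Integration.integral_sum) (rule shift)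
  also have "\<dots> = (\<Sum>l\<in>L. psi_mass)"
  proof (intro sum.cong refl)
    fix l :: "int^'n"
    show "(LINT \<xi>|lborel. psi (\<xi> - ivec l)) = psi_mass"
      using integral_lborel_shift[OF psi_m, of "- ivec l"] by (simp add: psi_mass_def)
  qed
  finally show ?thesis by simp
qed

text \<open>Here the frequency support is bounded, so a pointwise bound on the phase suffices. The
  common phase \<open>\<phi>\<close> is free in order that the large phase of one remote torus
  frequency can be factored out.\<close>

lemma propagator_wave_lower_bound:
  assumes "finite P" and c: "\<And>k \<xi>. k \<in> P \<Longrightarrow> rho L \<xi> \<noteq> 0 \<Longrightarrow>
      \<bar>ivec k \<bullet> x + \<xi> \<bullet> y - t * ((norm (ivec k :: real^'m))\<^sup>2 + (norm \<xi>)\<^sup>2) - \<phi>\<bar> \<le> 1/2"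
  shows "card P * (card L * psi_mass) / 2 \<le> norm (propagator t (wave P (\<lambda>k \<xi>. of_real (rho L \<xi>))) (x, y))"
proof -
  let ?\<theta> = "\<lambda>k \<xi>. ivec k \<bullet> x + \<xi> \<bullet> y - t * ((norm (ivec k :: real^'m))\<^sup>2 + (norm \<xi>)\<^sup>2)"
  have "propagator t (wave P (\<lambda>k \<xi>. of_real (rho L \<xi>))) (x, y) =
      (\<Sum>k\<in>P. cis (ivec k \<bullet> x) * ift (\<lambda>\<xi>. exp (- \<i> * complex_of_real (t * (norm (ivec k :: real^'m, \<xi>))\<^sup>2)) * of_real (rho L \<xi>)) y)"
    unfolding propagator_def by (subst multiplier_wave[OF assms(1) sfun_rho]) simp
  also have "\<dots> = (\<Sum>k\<in>P. (LINT \<xi>|lborel. of_real (rho L \<xi>) * cis (?\<theta> k \<xi>)))"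
    unfolding ift_def integral_mult_right_zero[symmetric]
  proof (intro sum.cong refl Bochner_Integration.integral_cong)
    fix k and \<xi> :: "real^'n"
    have "exp (- \<i> * complex_of_real (t * (norm (ivec k :: real^'m, \<xi>))\<^sup>2)) = cis (- (t * ((norm (ivec k :: real^'m))\<^sup>2 + (norm \<xi>)\<^sup>2)))"
      by (simp add: cis_conv_exp norm_Pair)
    then show "cis (ivec k \<bullet> x) * (exp (- \<i> * complex_of_real (t * (norm (ivec k :: real^'m, \<xi>))\<^sup>2)) * of_real (rho L \<xi>) * cis (\<xi> \<bullet> y))
        = of_real (rho L \<xi>) * cis (?\<theta> k \<xi>)"
      by (simp add: mult.left_commute cis_mult mult.commute[of _ "complex_of_real (rho L \<xi>)"] algebra_simps)
  qed
  finally have eq: "propagator t (wave P (\<lambda>k \<xi>. of_real (rho L \<xi>))) (x, y) = (\<Sum>k\<in>P. (LINT \<xi>|lborel. of_real (rho L \<xi>) * cis (?\<theta> k \<xi>)))" .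
  have le: "rho L \<xi> * \<bar>?\<theta> k \<xi> - \<phi>\<bar> \<le> rho L \<xi> * (1/2)" if "k \<in> P" for k \<xi>
    using c[OF that, of \<xi>] rho_nonneg[of L \<xi>] by (cases "rho L \<xi> = 0") (auto intro!: mult_left_mono)
  have \<theta>: "?\<theta> k \<in> borel_measurable borel" for k
    by (intro borel_measurable_continuous_onI continuous_intros)
  have int: "integrable lborel (\<lambda>\<xi>. rho L \<xi> * \<bar>?\<theta> k \<xi> - \<phi>\<bar>)" if "k \<in> P" for k
  proof (rule Bochner_Integration.integrable_bound)
    show "integrable lborel (\<lambda>\<xi>. rho L \<xi> * (1/2))" using integrable_rho by simp
    show "(\<lambda>\<xi>. rho L \<xi> * \<bar>?\<theta> k \<xi> - \<phi>\<bar>) \<in> borel_measurable lborel"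
      using \<theta>[of k] borel_measurable_integrable[OF integrable_rho] by measurable
    show "AE \<xi> in lborel. norm (rho L \<xi> * \<bar>?\<theta> k \<xi> - \<phi>\<bar>) \<le> norm (rho L \<xi> * (1/2))"
      using le[OF that] rho_nonneg by (intro AE_I2) (simp add: abs_mult)
  qed
  have "(\<Sum>k\<in>P. (LINT \<xi>|lborel. rho L \<xi>)) / 2 \<le> norm (\<Sum>k\<in>P. (LINT \<xi>|lborel. of_real (rho L \<xi>) * cis (?\<theta> k \<xi>)))"
  proof (rule norm_phase_sum_ge[where w="\<lambda>_. rho L" and \<phi>=\<phi>])
    fix k assume k: "k \<in> P"
    have "(LINT \<xi>|lborel. rho L \<xi> * \<bar>?\<theta> k \<xi> - \<phi>\<bar>) \<le> (LINT \<xi>|lborel. rho L \<xi> * (1/2))"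
      by (rule integral_mono[OF int[OF k] _ le[OF k]]) (use integrable_rho in simp)
    then show "(LINT \<xi>|lborel. rho L \<xi> * \<bar>?\<theta> k \<xi> - \<phi>\<bar>) \<le> (LINT \<xi>|lborel. rho L \<xi>) / 2" by simp
    show "?\<theta> k \<in> borel_measurable lborel"
      unfolding measurable_lborel2 by (rule \<theta>)
    show "integrable lborel (\<lambda>\<xi>. rho L \<xi> * \<bar>?\<theta> k \<xi> - \<phi>\<bar>)" by (rule int[OF k])
    show "integrable lborel (rho L)" by (rule integrable_rho)
  next
    show "0 \<le> rho L \<xi>" for \<xi> by (rule rho_nonneg)
  qed
  then show ?thesis unfolding eq integral_rho by simp
qed

section \<open>Overlapping frequency boxes\<close>

definition neighbours :: "(int^'n) set" where
  "neighbours = {d. \<forall>j. d $ j \<in> {-1, 0, 1}}"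

lemma finite_neighbours: "finite neighbours"
proof -
  have "neighbours \<subseteq> vec_lambda ` (UNIV \<rightarrow>\<^sub>E {-1, 0, 1})"
    unfolding neighbours_def by (auto intro!: image_eqI[of _ _ "vec_nth _"])
  then show ?thesis by (rule finite_subset) (intro finite_imageI finite_PiE, auto)
qed

lemma neighbours_0: "0 \<in> neighbours"
  by (simp add: neighbours_def)

text \<open>Two bumps of radius 3/4 meet only if their centres are at most 3/2 < 2 apart in each
  coordinate; for integer centres that means at most 1.\<close>

lemma psi_mult_shift_zero:
  assumes "l - l' \<notin> neighbours" shows "psi (\<xi> - ivec l') * psi (\<xi> - ivec l) = 0"
proof (rule ccontr)
  assume "psi (\<xi> - ivec l') * psi (\<xi> - ivec l) \<noteq> 0"
  then have ne: "psi (\<xi> - ivec l') \<noteq> 0" "psi (\<xi> - ivec l) \<noteq> 0" by auto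
  have "(l - l') $ j \<in> {-1, 0, 1}" for j
  proof -
    have "\<bar>\<xi> $ j - of_int (l' $ j)\<bar> \<le> 3/4" "\<bar>\<xi> $ j - of_int (l $ j)\<bar> \<le> 3/4"
      using psi_support[OF ne(1), of j] psi_support[OF ne(2), of j] by (simp_all add: ivec_def)
    then have "\<bar>l $ j - l' $ j\<bar> < 2" by linarith
    then have "l $ j - l' $ j = -1 \<or> l $ j - l' $ j = 0 \<or> l $ j - l' $ j = 1" by arith
    then show ?thesis by simp
  qed
  then show False using assms by (simp add: neighbours_def)
qed

end

context partition begin

text \<open>Contains every centre whose bump can meet the support of \<open>rho L\<close>; its size
  exceeds that of \<open>L\<close> at most by the fixed factor
  \<open>card neighbours\<close>.\<close>

definition hood :: "(int^'n) set \<Rightarrow> (int^'n) set" where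
  "hood L = (\<lambda>(l, d). l - d) ` (L \<times> neighbours)"

lemma hoodI: "l \<in> L \<Longrightarrow> l - l' \<in> neighbours \<Longrightarrow> l' \<in> hood L"
  unfolding hood_def by (rule image_eqI[of _ _ "(l, l - l')"]) auto

lemma finite_hood: "finite L \<Longrightarrow> finite (hood L)"
  unfolding hood_def using finite_neighbours by simp

lemma card_hood: "finite L \<Longrightarrow> card (hood L) \<le> card L * card neighbours"
  unfolding hood_def using card_image_le[of "L \<times> neighbours"] finite_neighbours by (simp add: card_cartesian_product)

lemma hood_nonempty: "l \<in> L \<Longrightarrow> l \<in> hood L"
  by (rule hoodI[of l]) (simp_all add: neighbours_0)

abbreviation rho_wave :: "(int^'m) set \<Rightarrow> (int^'n) set \<Rightarrow> (real^'m) \<times> (real^'n) \<Rightarrow> complex" where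
  "rho_wave P L \<equiv> wave P (\<lambda>k \<xi>. complex_of_real (rho L \<xi>))"

lemma sfun_psi_rho: "sfun (\<lambda>\<xi>. complex_of_real (psi (\<xi> - ivec l) * rho L \<xi>))"
  unfolding of_real_mult by (rule sfun_mult[OF sfun_shift[OF sfun_psi] sfun_rho])

lemma box_op_rho_wave:
  assumes "finite P"
  shows "box_op \<sigma> K (rho_wave P L) z = (if fst K \<in> P then
    cis (ivec (fst K) \<bullet> fst z) * ift (\<lambda>\<xi>. complex_of_real (psi (\<xi> - ivec (snd K)) * rho L \<xi>)) (snd z) else 0)"
proof -
  let ?t = "\<lambda>k. cis (ivec k \<bullet> fst z) * ift (\<lambda>\<xi>. of_real (\<sigma> ((ivec k, \<xi>) - lattice_pt K)) * complex_of_real (rho L \<xi>)) (snd z)"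
  have "\<sigma> ((ivec k, \<xi>) - lattice_pt K) = 0" if ne: "k \<noteq> fst K" for k \<xi>
  proof (rule ccontr)
    assume nz: "\<sigma> ((ivec k, \<xi>) - lattice_pt K) \<noteq> 0"
    obtain i where i: "k $ i \<noteq> fst K $ i" using ne by (auto simp: vec_eq_iff)
    have "\<bar>real_of_int (k $ i) - real_of_int (fst K $ i)\<bar> \<le> 3/4"
      using sigma_support(1)[OF nz, of i] by (simp add: lattice_pt_def ivec_def)
    then show False using i by linarith
  qed
  then have zero: "?t k = 0" if "k \<noteq> fst K" for k using that by (simp add: ift_def)
  have "box_op \<sigma> K (rho_wave P L) z = (\<Sum>k\<in>P. ?t k)"
    unfolding box_op_def by (rule multiplier_wave[OF assms sfun_rho])
  also have "\<dots> = (\<Sum>k\<in>P. if k = fst K then ?t (fst K) else 0)"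
    using zero by (intro sum.cong refl) (simp del: of_real_mult)
  also have "\<dots> = (if fst K \<in> P then ?t (fst K) else 0)"
    by (rule sum.delta'[OF assms, of "fst K" "\<lambda>_. ?t (fst K)", unfolded eq_commute[of "fst K"]])
  finally show ?thesis
    by (simp add: lattice_pt_def psi_def)
qed

text \<open>A translation in frequency does not affect the modulus of the transform, so a product of
  two bumps matters only through the difference of the centres, and only differences in
  \<open>neighbours\<close> occur. Hence this one function majorises all pieces, whatever the sets
  \<open>P\<close> and \<open>L\<close> are.\<close>

definition Omega :: "real^'n \<Rightarrow> real" where
  "Omega y = (\<Sum>d\<in>neighbours. norm (ift (\<lambda>\<eta>. psic \<eta> * psic (\<eta> - ivec d)) y))"

lemma Omega_decay: "\<exists>B>0. \<forall>y. Omega y \<le> B * (1 / (1 + norm y) ^ (2 * DIM(real^'n)))"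
proof -
  let ?M = "2 * DIM(real^'n)"
  have "\<exists>B. \<forall>y. (1 + norm y) ^ ?M * norm (ift (\<lambda>\<eta>. psic \<eta> * psic (\<eta> - ivec d)) y) \<le> B" for d :: "int^'n"
    using rapid_ift[OF sfun_mult[OF sfun_psi sfun_shift[OF sfun_psi, of "ivec d"]]] unfolding rapid_def by (rule spec)
  then obtain B where B: "\<And>d y. (1 + norm y) ^ ?M * norm (ift (\<lambda>\<eta>. psic \<eta> * psic (\<eta> - ivec d)) y) \<le> B (d :: int^'n)"
    by metis
  have "Omega y \<le> max 1 (sum B neighbours) * (1 / (1 + norm y) ^ ?M)" for y
  proof -
    have pos: "(1 + norm y) ^ ?M > 0" by (simp add: add_pos_nonneg)
    have "(1 + norm y) ^ ?M * Omega y \<le> sum B neighbours"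
      unfolding Omega_def sum_distrib_left by (intro sum_mono B)
    then have "(1 + norm y) ^ ?M * Omega y \<le> max 1 (sum B neighbours)" by simp
    then show ?thesis using pos by (simp add: pos_le_divide_eq mult.commute)
  qed
  then show ?thesis by (intro exI[of _ "max 1 (sum B neighbours)"]) auto
qed

lemma norm_ift_psi_rho_le:
  assumes "finite L"
  shows "norm (ift (\<lambda>\<xi>. complex_of_real (psi (\<xi> - ivec l') * rho L \<xi>)) y) \<le> (if l' \<in> hood L then Omega y else 0)"
proof -
  let ?g = "\<lambda>d \<eta>. psic \<eta> * psic (\<eta> - ivec d)"
  let ?L = "{l \<in> L. l - l' \<in> neighbours}"
  have g: "sfun (?g d)" for d :: "int^'n" by (rule sfun_mult[OF sfun_psi sfun_shift[OF sfun_psi]])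
  have iv: "ivec (l - l') = ivec l - ivec l'" for l :: "int^'n" by (simp add: ivec_def vec_eq_iff)
  have "complex_of_real (psi (\<xi> - ivec l') * rho L \<xi>) = (\<Sum>l\<in>?L. ?g (l - l') (\<xi> - ivec l'))" for \<xi>
  proof -
    have "psi (\<xi> - ivec l') * rho L \<xi> = (\<Sum>l\<in>L. psi (\<xi> - ivec l') * psi (\<xi> - ivec l))"
      by (simp add: rho_def sum_distrib_left)
    also have "\<dots> = (\<Sum>l\<in>?L. psi (\<xi> - ivec l') * psi (\<xi> - ivec l))"
      using psi_mult_shift_zero by (intro sum.mono_neutral_right assms) auto
    finally show ?thesis by (simp add: iv)
  qed
  then have "ift (\<lambda>\<xi>. complex_of_real (psi (\<xi> - ivec l') * rho L \<xi>)) y = ift (\<lambda>\<xi>. \<Sum>l\<in>?L. ?g (l - l') (\<xi> - ivec l')) y"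
    by simp
  also have "\<dots> = (\<Sum>l\<in>?L. ift (\<lambda>\<xi>. ?g (l - l') (\<xi> - ivec l')) y)"
    by (rule ift_sum) (rule sfun_integrable[OF sfun_shift[OF g]])
  also have "\<dots> = (\<Sum>l\<in>?L. cis (ivec l' \<bullet> y) * ift (?g (l - l')) y)"
    using ift_shift[OF sfun_borel_measurable[OF g], where a="- ivec l'" and y=y] by simp
  also have "norm \<dots> \<le> (\<Sum>l\<in>?L. norm (ift (?g (l - l')) y))"
    by (rule order_trans[OF norm_sum]) (simp add: norm_mult)
  also have "\<dots> = (\<Sum>d\<in>(\<lambda>l. l - l') ` ?L. norm (ift (?g d) y))"
    by (subst sum.reindex) (auto simp: inj_on_def)
  also have "\<dots> \<le> (if l' \<in> hood L then Omega y else 0)"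
  proof (cases "l' \<in> hood L")
    case True
    have "(\<Sum>d\<in>(\<lambda>l. l - l') ` ?L. norm (ift (?g d) y)) \<le> Omega y"
      unfolding Omega_def by (rule sum_mono2[OF finite_neighbours]) auto
    then show ?thesis using True by simp
  next
    case False
    then have "?L = {}" using hoodI by blast
    then show ?thesis using False by (simp del: Collect_empty_eq)
  qed
  finally show ?thesis .
qed

text \<open>The order of the quantifiers is what counts: \<open>A\<close> comes from
  \<open>Omega\<close> and is the same for all frequency sets and all boxes.\<close>

lemma Lp_norm_box_op_le:
  assumes p: "1 \<le> p"
  shows "\<exists>A>0. \<forall>P L K. finite P \<longrightarrow> finite L \<longrightarrow>
    Lp_norm p waveguide (box_op \<sigma> K (rho_wave P L)) \<le> ennreal (A * indicator (P \<times> hood L) K)"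
proof -
  let ?w = "\<lambda>y :: real^'n. 1 / (1 + norm y) ^ (2 * DIM(real^'n))"
  obtain B where B: "B > 0" "\<And>y. Omega y \<le> B * ?w y" using Omega_decay by blast
  have w1: "?w y \<le> 1" for y :: "real^'n"
  proof -
    have "1 \<le> (1 + norm y) ^ (2 * DIM(real^'n))" by (rule one_le_power) simp
    then show ?thesis unfolding divide_le_eq_1 by linarith
  qed
  have wm: "?w \<in> borel_measurable borel" by measurable
  define V where "V = 1 + (LINT y|lborel. ?w y)"
  have V: "V > 0" "(LINT y|lborel. ?w y) \<le> V"
    unfolding V_def by (simp_all add: add_pos_nonneg)
  let ?A = "B * ((2 * pi) ^ CARD('m) * V) powr enn2real (1 / p)"
  have "Lp_norm p waveguide (box_op \<sigma> K (rho_wave P L)) \<le> ennreal (?A * indicator (P \<times> hood L) K)"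
    if P: "finite P" and L: "finite L" for P L K
  proof -
    let ?F = "box_op \<sigma> K (rho_wave P L)"
    let ?c = "indicator (P \<times> hood L) K :: real"
    have meas: "?F \<in> borel_measurable borel"
    proof -
      have "(\<lambda>z :: (real^'m) \<times> (real^'n). cis (ivec (fst K) \<bullet> fst z) *
          ift (\<lambda>\<xi>. complex_of_real (psi (\<xi> - ivec (snd K)) * rho L \<xi>)) (snd z)) \<in> borel_measurable borel"
        by (intro borel_measurable_continuous_onI continuous_intros
            continuous_on_compose2[OF continuous_on_ift[OF sfun_psi_rho, of UNIV]]) auto
      then show ?thesis
        by (cases "fst K \<in> P") (simp_all add: box_op_rho_wave[OF P] fun_eq_iff[symmetric] cong: measurable_cong)
    qed
    have "norm (?F z) \<le> (B * ?c) * ?w (snd z)" for z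
    proof (cases "fst K \<in> P")
      case True
      then have "norm (?F z) \<le> (if snd K \<in> hood L then Omega (snd z) else 0)"
        using norm_ift_psi_rho_le[OF L, of "snd K" "snd z"] by (simp add: box_op_rho_wave[OF P] norm_mult)
      then show ?thesis using B(2)[of "snd z"] True by (auto simp: indicator_def mem_Times_iff split: if_splits)
    next
      case False
      then show ?thesis by (simp add: box_op_rho_wave[OF P] indicator_def mem_Times_iff)
    qed
    from Lp_norm_decay_bound[OF p meas this wm _ w1 integrable_polynomial_decay V(2) _ V(1)]
    have "Lp_norm p waveguide ?F \<le> ennreal (B * ?c * ((2 * pi) ^ CARD('m) * V) powr enn2real (1 / p))"
      using B(1) by (simp add: indicator_def)
    then show ?thesis by (simp add: mult_ac)
  qed
  moreover have "?A > 0" using B V by simp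
  ultimately show ?thesis by blast
qed

lemma modulation_norm_rho_wave_le:
  assumes p: "1 \<le> p" and q: "1 \<le> q"
  shows "\<exists>A>0. \<forall>P L W. finite P \<longrightarrow> finite L \<longrightarrow> P \<noteq> {} \<longrightarrow> L \<noteq> {} \<longrightarrow>
    (\<forall>K\<in>P \<times> hood L. sqrt (1 + (norm (lattice_pt K))\<^sup>2) powr \<alpha> \<le> W) \<longrightarrow>
    modulation_norm \<sigma> \<alpha> p q (rho_wave P L) \<le> ennreal (A * W * (card P * card L) powr enn2real (1 / q))"
proof -
  obtain A where A: "A > 0" and box: "\<And>P L K. finite P \<Longrightarrow> finite L \<Longrightarrow>
    Lp_norm p waveguide (box_op \<sigma> K (rho_wave P L)) \<le> ennreal (A * indicator (P \<times> hood L) K)"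
    using Lp_norm_box_op_le[OF p] by blast
  let ?D = "real (card (neighbours :: (int^'n) set))"
  have D: "?D > 0" using finite_neighbours neighbours_0 by (auto simp: card_gt_0_iff)
  have "modulation_norm \<sigma> \<alpha> p q (rho_wave P L) \<le> ennreal ((A * ?D powr enn2real (1 / q)) * W * (card P * card L) powr enn2real (1 / q))"
    if P: "finite P" "P \<noteq> {}" and L: "finite L" "L \<noteq> {}"
      and W: "\<forall>K\<in>P \<times> hood L. sqrt (1 + (norm (lattice_pt K))\<^sup>2) powr \<alpha> \<le> W" for P L W
  proof -
    let ?S = "P \<times> hood L" and ?V = "real (card P) * real (card L) * ?D"
    obtain k l where kl: "k \<in> P" "l \<in> L" using P L by blast
    have "(k, l) \<in> ?S" using kl hood_nonempty by simp
    then have W0: "W \<ge> 0" using W by (meson order_trans powr_ge_zero)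
    have "modulation_norm \<sigma> \<alpha> p q (rho_wave P L) \<le> ennreal ((W * A) * ?V powr enn2real (1 / q))"
      unfolding modulation_norm_def
    proof (rule eLp_upper_bound[OF q, where w="indicator ?S"])
      fix K :: "(int^'m) \<times> (int^'n)"
      let ?x = "sqrt (1 + (norm (lattice_pt K :: (real^'m) \<times> (real^'n)))\<^sup>2) powr \<alpha>"
      have "ennreal ?x * Lp_norm p waveguide (box_op \<sigma> K (rho_wave P L)) \<le> ennreal ?x * ennreal (A * indicator ?S K)"
        by (intro mult_left_mono box P L) simp
      also have "\<dots> = ennreal (?x * (A * indicator ?S K))"
        using A by (subst ennreal_mult) auto
      also have "\<dots> \<le> ennreal (W * A * indicator ?S K)"
        using W A by (intro ennreal_leI) (auto simp: indicator_def)
      finally show "ennreal ?x * Lp_norm p waveguide (box_op \<sigma> K (rho_wave P L)) \<le> ennreal (W * A * indicator ?S K)" .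
    next
      have fin: "finite ?S" using P L finite_hood by simp
      have "(\<integral>\<^sup>+K. ennreal (indicator ?S K) \<partial>count_space UNIV) = ennreal (card ?S)"
        using fin by (simp add: ennreal_indicator emeasure_count_space_finite ennreal_of_nat_eq_real_of_nat)
      also have "\<dots> \<le> ennreal ?V"
        using card_hood[OF L(1)] by (intro ennreal_leI)
          (simp add: card_cartesian_product mult.assoc mult_left_mono of_nat_mult[symmetric] del: of_nat_mult)
      finally show "(\<integral>\<^sup>+K. ennreal (indicator ?S K) \<partial>count_space UNIV) \<le> ennreal ?V" .
      show "?V > 0" using P L D by (simp add: card_gt_0_iff)
    qed (use A W0 in \<open>auto simp: indicator_def\<close>)
    also have "?V powr enn2real (1 / q) = (card P * card L) powr enn2real (1 / q) * ?D powr enn2real (1 / q)"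
      by (simp add: powr_mult)
    finally show ?thesis by (simp add: mult_ac)
  qed
  moreover have "A * ?D powr enn2real (1 / q) > 0" using A D by simp
  ultimately show ?thesis by blast
qed

end

lemma finite_card_int_box:
  assumes "finite B"
  shows "finite {k :: int^'n. \<forall>i. k $ i \<in> B}" and "card {k :: int^'n. \<forall>i. k $ i \<in> B} = card B ^ CARD('n)"
proof -
  let ?S = "{k :: int^'n. \<forall>i. k $ i \<in> B}" and ?T = "PiE (UNIV :: 'n set) (\<lambda>_. B)"
  have bij: "bij_betw vec_nth ?S ?T"
    by (rule bij_betw_byWitness[where f'=vec_lambda]) (auto simp: PiE_def extensional_def)
  have "finite ?T" using assms by (intro finite_PiE) auto
  then show "finite ?S" using bij_betw_finite[OF bij] by simp
  show "card ?S = card B ^ CARD('n)"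
    using bij_betw_same_card[OF bij] by (simp add: card_PiE)
qed

text \<open>\<open>ennreal C\<close> is 0 for negative \<open>C\<close>, hence the truncation when
  the estimate is read as an inequality between reals.\<close>

lemma ennreal_le_mult_maxD:
  assumes "ennreal a \<le> ennreal C * M" "M \<le> ennreal b" "0 \<le> b"
  shows "a \<le> max C 0 * b"
proof -
  have "ennreal C = ennreal (max C 0)" by (simp add: ennreal_neg max_def)
  then have "ennreal a \<le> ennreal (max C 0) * ennreal b"
    using assms(1,2) by (metis mult_left_mono order_trans zero_le)
  also have "\<dots> = ennreal (max C 0 * b)" using assms(3) by (simp add: ennreal_mult)
  finally show ?thesis using assms(3) by (subst (asm) ennreal_le_iff) auto
qed

lemma norm_le_lattice_pt: "norm (ivec (fst K)) \<le> norm (lattice_pt K)"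
  unfolding lattice_pt_def by (simp add: norm_Pair)

lemma abs_le_small_box:
  assumes "(x, y) \<in> small_box d" shows "\<bar>x $ i\<bar> \<le> d" "\<bar>y $ j\<bar> \<le> d"
proof -
  have "0 \<le> x $ i \<and> x $ i \<le> d" "0 \<le> y $ j \<and> y $ j \<le> d"
    using assms by (simp_all add: small_box_def mem_box_cart)
  then show "\<bar>x $ i\<bar> \<le> d" "\<bar>y $ j\<bar> \<le> d" by simp_all
qed

lemma ivec_nth [simp]: "ivec k $ i = real_of_int (k $ i)"
  by (simp add: ivec_def)

lemma filterlim_real_Suc: "filterlim (\<lambda>n. real (Suc n)) at_top sequentially"
  using filterlim_compose[OF filterlim_real_sequentially filterlim_Suc] .

section \<open>The two conditions on the modulation exponent\<close>

context partition begin

definition modulation_estimate :: "ennreal \<Rightarrow> ennreal \<Rightarrow> real \<Rightarrow> real \<Rightarrow> bool" where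
  "modulation_estimate p q \<alpha> C \<longleftrightarrow> (\<forall>f :: (real^'m) \<times> (real^'n) \<Rightarrow> complex. schwartz f \<longrightarrow>
    Lp_norm p (waveguide \<Otimes>\<^sub>M unit_time) (\<lambda>(z, t). propagator t f z) \<le> ennreal C * modulation_norm \<sigma> \<alpha> p q f)"

lemma modulation_estimate_rho_wave:
  assumes "modulation_estimate p q \<alpha> C"
  shows "Lp_norm p (waveguide \<Otimes>\<^sub>M unit_time) (\<lambda>(z, t). propagator t (rho_wave P L) z)
    \<le> ennreal C * modulation_norm \<sigma> \<alpha> p q (rho_wave P L)"
  using assms unfolding modulation_estimate_def by (elim allE impE) (rule wave_schwartz[OF sfun_rho])

text \<open>Tested on a single frequency moving to infinity along the torus, where the modulus of the
  solution does not change.\<close>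

lemma modulation_exponent_nonneg:
  assumes p: "1 \<le> p" and q: "1 \<le> q" and est: "modulation_estimate p q \<alpha> C"
  shows "0 \<le> \<alpha>"
proof (rule ccontr)
  \<comment> \<open>The contradiction hypothesis does real work: for negative
    \<open>\<alpha>\<close> the lower bound for |K| becomes an upper bound for the weight.\<close>
  assume neg: "\<not> 0 \<le> \<alpha>"
  let ?n = "real CARD('n)"
  \<comment> \<open>Both parts of the phase, \<open>\<xi> \<bullet> y\<close> and t |\<xi>|^2, are
    at most \<delta> n^2; together they reach the admissible 1/2.\<close>
  define \<delta> where "\<delta> = 1 / (4 * ?n\<^sup>2)"
  have n1: "?n \<ge> 1" by (simp add: Suc_leI)
  have n2: "?n \<le> ?n\<^sup>2" "1 \<le> ?n\<^sup>2"
    by (rule self_le_power[OF n1], simp) (rule one_le_power[OF n1])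
  have \<delta>: "\<delta> > 0" "\<delta> \<le> 1" "2 * \<delta> * ?n\<^sup>2 = 1/2"
  proof -
    have "1 \<le> 4 * ?n\<^sup>2" using n2(2) by linarith
    then show "\<delta> \<le> 1" unfolding \<delta>_def divide_le_eq_1 by linarith
  qed (simp_all add: \<delta>_def)
  define c where "c = psi_mass / 2 * (\<delta> ^ (CARD('m) + CARD('n)) * \<delta>) powr enn2real (1 / p)"
  have c: "c > 0" using psi_mass_pos \<delta> by (simp add: c_def)
  obtain A where A: "A > 0" and mod: "\<And>P L W. finite P \<Longrightarrow> finite L \<Longrightarrow> P \<noteq> {} \<Longrightarrow> L \<noteq> {} \<Longrightarrow>
      (\<forall>K\<in>P \<times> hood L. sqrt (1 + (norm (lattice_pt K))\<^sup>2) powr \<alpha> \<le> W) \<Longrightarrow>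
      modulation_norm \<sigma> \<alpha> p q (rho_wave P L) \<le> ennreal (A * W * (card P * card L) powr enn2real (1 / q))"
    using modulation_norm_rho_wave_le[OF p q, of \<alpha>] by blast
  \<comment> \<open>The exponent 0 records that the lower bound for the solution does not depend on
    the frequency, while the norm of the data carries the power \<open>\<alpha>\<close>.\<close>
  have main: "c * real (Suc N) powr 0 \<le> (max C 0 * A) * real (Suc N) powr \<alpha>" for N
  proof -
    define k :: "int^'m" where "k = (\<chi> i. int (Suc N))"
    let ?P = "{k}" and ?L = "{0 :: int^'n}"
    have "ennreal c \<le> Lp_norm p (waveguide \<Otimes>\<^sub>M unit_time) (\<lambda>(z, t). propagator t (rho_wave ?P ?L) z)"
      unfolding c_def
    proof (rule Lp_norm_lower_bound[OF p])
      fix z :: "(real^'m) \<times> (real^'n)" and t :: real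
      assume z: "z \<in> small_box \<delta>" and t: "t \<in> {0..\<delta>}"
      obtain x y where xy: "z = (x, y)" by (cases z)
      have "card ?P * (card ?L * psi_mass) / 2 \<le> norm (propagator t (rho_wave ?P ?L) (x, y))"
      \<comment> \<open>The phase of the single torus frequency grows with \<open>N\<close> but is
        common to all \<open>\<xi>\<close>, so it serves as the reference phase.\<close>
      proof (rule propagator_wave_lower_bound[where \<phi>="ivec k \<bullet> x - t * (norm (ivec k :: real^'m))\<^sup>2"])
        fix k' \<xi> assume k': "k' \<in> ?P" and "rho ?L \<xi> \<noteq> 0"
        then have "psi \<xi> \<noteq> 0" by (simp add: rho_def ivec_def zero_vec_def[symmetric])
        then have \<xi>: "\<bar>\<xi> $ j\<bar> \<le> 1" for j using psi_support[of \<xi> j] by linarith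
        have "\<bar>\<xi> \<bullet> y\<bar> \<le> ?n * (1 * \<delta>)"
          by (rule abs_inner_le_const_vec[OF \<xi>]) (use abs_le_small_box(2)[OF z[unfolded xy]] in simp)
        also have "\<dots> \<le> \<delta> * ?n\<^sup>2" using n2 \<delta> by (simp add: mult_left_mono)
        finally have 1: "\<bar>\<xi> \<bullet> y\<bar> \<le> \<delta> * ?n\<^sup>2" .
        have "norm \<xi> \<le> ?n * 1" by (rule norm_le_const_vec[OF \<xi>])
        then have "t * (norm \<xi>)\<^sup>2 \<le> \<delta> * ?n\<^sup>2" using t by (intro mult_mono power_mono) auto
        moreover have "0 \<le> t * (norm \<xi>)\<^sup>2" using t by simp
        moreover have "ivec k' \<bullet> x + \<xi> \<bullet> y - t * ((norm (ivec k' :: real^'m))\<^sup>2 + (norm \<xi>)\<^sup>2)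
            - (ivec k \<bullet> x - t * (norm (ivec k :: real^'m))\<^sup>2) = \<xi> \<bullet> y - t * (norm \<xi>)\<^sup>2"
          using k' by (simp add: algebra_simps)
        ultimately show "\<bar>ivec k' \<bullet> x + \<xi> \<bullet> y - t * ((norm (ivec k' :: real^'m))\<^sup>2 + (norm \<xi>)\<^sup>2)
            - (ivec k \<bullet> x - t * (norm (ivec k :: real^'m))\<^sup>2)\<bar> \<le> 1/2"
          using 1 \<delta>(3) by linarith
      qed simp
      then show "psi_mass / 2 \<le> norm (propagator t (rho_wave ?P ?L) z)" by (simp add: xy)
    qed (use \<delta> psi_mass_pos pi_gt3 in auto)
    also have "\<dots> \<le> ennreal C * modulation_norm \<sigma> \<alpha> p q (rho_wave ?P ?L)"
      by (rule modulation_estimate_rho_wave[OF est])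
    finally have "ennreal c \<le> ennreal C * modulation_norm \<sigma> \<alpha> p q (rho_wave ?P ?L)" .
    moreover have "modulation_norm \<sigma> \<alpha> p q (rho_wave ?P ?L) \<le> ennreal (A * real (Suc N) powr \<alpha> * (card ?P * card ?L) powr enn2real (1 / q))"
    proof (rule mod)
      show "\<forall>K\<in>?P \<times> hood ?L. sqrt (1 + (norm (lattice_pt K))\<^sup>2) powr \<alpha> \<le> real (Suc N) powr \<alpha>"
      proof
        fix K assume "K \<in> ?P \<times> hood ?L"
        then have K: "fst K = k" by auto
        have "real (Suc N) \<le> norm (ivec k :: real^'m)"
          using component_le_norm_cart[of "ivec k :: real^'m" undefined] by (simp add: k_def)
        also have "\<dots> \<le> norm (lattice_pt K)" using norm_le_lattice_pt[of K] K by simp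
        also have "\<dots> \<le> sqrt (1 + (norm (lattice_pt K))\<^sup>2)" by (rule real_le_rsqrt) simp
        finally show "sqrt (1 + (norm (lattice_pt K))\<^sup>2) powr \<alpha> \<le> real (Suc N) powr \<alpha>"
          using neg by (intro powr_mono2') auto
      qed
    qed auto
    ultimately have "c \<le> max C 0 * (A * real (Suc N) powr \<alpha> * (card ?P * card ?L) powr enn2real (1 / q))"
      by (rule ennreal_le_mult_maxD) (use A in simp)
    then show ?thesis by (simp add: mult.assoc)
  qed
  have "0 \<le> \<alpha>"
    by (rule powr_exponent_le[OF filterlim_real_Suc _ c main]) simp
  then show False using neg by simp
qed

lemma modulation_exponent_ge:
  assumes p: "1 \<le> p" and q: "1 \<le> q" and est: "modulation_estimate p q \<alpha> C"
  shows "\<alpha> \<ge> real (CARD('m) + CARD('n)) * (1 - enn2real (1 / p) - enn2real (1 / q)) - 2 * enn2real (1 / p)"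
proof -
  have \<alpha>: "\<alpha> \<ge> 0" by (rule modulation_exponent_nonneg[OF assms])
  let ?m = "real CARD('m)" and ?n = "real CARD('n)" and ?M = "CARD('m) + CARD('n)"
  let ?a = "enn2real (1 / p)" and ?b = "enn2real (1 / q)"
  have m1: "?m \<ge> 1" and n1: "?n \<ge> 1" by (simp_all add: Suc_leI)
  \<comment> \<open>The four terms bound, in units of \<open>\<delta>\<close>, the phases
    \<open>k \<bullet> x\<close>, \<open>\<xi> \<bullet> y\<close>, t |k|^2 and t |\<xi>|^2 on the
    rescaled box and time interval; the choice of \<open>\<delta>\<close> makes their sum
    1/2.\<close>
  define S where "S = ?m + ?n + ?m\<^sup>2 + ?n\<^sup>2"
  have S: "S \<ge> 1" 
    unfolding S_def using m1 n1 zero_le_power2[of ?m] zero_le_power2[of ?n] by linarith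
  define \<delta> where "\<delta> = 1 / (2 * S)"
  have \<delta>: "\<delta> > 0" "\<delta> \<le> 1" "\<delta> * S = 1/2" using S by (simp_all add: \<delta>_def)
  define c where "c = psi_mass / 2 * (\<delta> ^ (?M + 1)) powr ?a"
  have c: "c > 0" using psi_mass_pos \<delta> by (simp add: c_def)
  obtain A where A: "A > 0" and mod: "\<And>P L W. finite P \<Longrightarrow> finite L \<Longrightarrow> P \<noteq> {} \<Longrightarrow> L \<noteq> {} \<Longrightarrow>
      (\<forall>K\<in>P \<times> hood L. sqrt (1 + (norm (lattice_pt K))\<^sup>2) powr \<alpha> \<le> W) \<Longrightarrow>
      modulation_norm \<sigma> \<alpha> p q (rho_wave P L) \<le> ennreal (A * W * (card P * card L) powr ?b)"
    using modulation_norm_rho_wave_le[OF p q, of \<alpha>] by blast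
  have main: "c * real (Suc N) powr (?M - (?M + 2) * ?a)
      \<le> (max C 0 * A * (1 + ?m + ?n) powr \<alpha>) * real (Suc N) powr (\<alpha> + ?M * ?b)" for N
  proof -
    define X where "X = real (Suc N)"
    have X: "X \<ge> 1" by (simp add: X_def)
    let ?B = "{0..<int (Suc N)}"
    let ?P = "{k :: int^'m. \<forall>i. k $ i \<in> ?B}" and ?L = "{l :: int^'n. \<forall>i. l $ i \<in> ?B}"
    have fin: "finite ?P" "finite ?L" by (rule finite_card_int_box(1), simp)+
    have cardPL: "real (card ?P) = X ^ CARD('m)" "real (card ?L) = X ^ CARD('n)"
      using finite_card_int_box(2)[of ?B, where 'n='m] finite_card_int_box(2)[of ?B, where 'n='n] by (simp_all add: X_def)
    have "0 \<in> ?P" "0 \<in> ?L" by simp_all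
    then have ne: "?P \<noteq> {}" "?L \<noteq> {}" by blast+
    have kP: "\<bar>ivec k $ i\<bar> \<le> X" if "k \<in> ?P" for k i
    proof -
      have "0 \<le> k $ i" "k $ i < int (Suc N)" using that by auto
      then show ?thesis by (simp add: X_def)
    qed
    have low: "ennreal ((X ^ CARD('m) * (X ^ CARD('n) * psi_mass) / 2) * ((\<delta> / X) ^ ?M * (\<delta> / X\<^sup>2)) powr ?a)
        \<le> Lp_norm p (waveguide \<Otimes>\<^sub>M unit_time) (\<lambda>(z, t). propagator t (rho_wave ?P ?L) z)"
    proof (rule Lp_norm_lower_bound[OF p])
      fix z :: "(real^'m) \<times> (real^'n)" and t :: real
      assume z: "z \<in> small_box (\<delta> / X)" and t: "t \<in> {0..\<delta> / X\<^sup>2}"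
      obtain x y where xy: "z = (x, y)" by (cases z)
      have "card ?P * (card ?L * psi_mass) / 2 \<le> norm (propagator t (rho_wave ?P ?L) (x, y))"
      proof (rule propagator_wave_lower_bound[where \<phi>=0, OF fin(1)])
        fix k \<xi> assume k: "k \<in> ?P" and "rho ?L \<xi> \<noteq> 0"
        then obtain l where l: "l \<in> ?L" "psi (\<xi> - ivec l) \<noteq> 0"
          unfolding rho_def by (meson sum.neutral)
        \<comment> \<open>The centres end at \<open>N\<close> while \<open>X\<close> is
          \<open>N + 1\<close>; the difference absorbs the radius 3/4 of a bump.\<close>
        have \<xi>: "\<bar>\<xi> $ j\<bar> \<le> X" for j
        proof -
          have "l $ j \<in> ?B" using l(1) by blast
          then have "0 \<le> l $ j" "l $ j \<le> int N" by auto
          then have "0 \<le> real_of_int (l $ j)" "real_of_int (l $ j) \<le> real N" by linarith+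
          moreover have "\<bar>\<xi> $ j - real_of_int (l $ j)\<bar> \<le> 3/4" using psi_support[OF l(2), of j] by simp
          ultimately show ?thesis unfolding X_def of_nat_Suc by linarith
        qed
        have "\<bar>ivec k \<bullet> x\<bar> \<le> ?m * (X * (\<delta> / X))"
          by (rule abs_inner_le_const_vec[OF kP[OF k]]) (use abs_le_small_box(1)[OF z[unfolded xy]] in simp)
        moreover have "\<bar>\<xi> \<bullet> y\<bar> \<le> ?n * (X * (\<delta> / X))"
          by (rule abs_inner_le_const_vec[OF \<xi>]) (use abs_le_small_box(2)[OF z[unfolded xy]] in simp)
        moreover have "t * ((norm (ivec k :: real^'m))\<^sup>2 + (norm \<xi>)\<^sup>2) \<le> (\<delta> / X\<^sup>2) * ((?m * X)\<^sup>2 + (?n * X)\<^sup>2)"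
          using t by (intro mult_mono add_mono power_mono norm_le_const_vec kP k \<xi>) auto
        moreover have "0 \<le> t * ((norm (ivec k :: real^'m))\<^sup>2 + (norm \<xi>)\<^sup>2)" using t by simp
        moreover have "X * (\<delta> / X) = \<delta>" "(\<delta> / X\<^sup>2) * ((?m * X)\<^sup>2 + (?n * X)\<^sup>2) = \<delta> * (?m\<^sup>2 + ?n\<^sup>2)"
          using X by (simp_all add: power_mult_distrib distrib_left)
        moreover have "?m * \<delta> + ?n * \<delta> + \<delta> * (?m\<^sup>2 + ?n\<^sup>2) = 1/2"
          using \<delta>(3) by (simp add: S_def algebra_simps)
        ultimately show "\<bar>ivec k \<bullet> x + \<xi> \<bullet> y - t * ((norm (ivec k :: real^'m))\<^sup>2 + (norm \<xi>)\<^sup>2) - 0\<bar> \<le> 1/2"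
          by (simp only:)
      qed
      then show "X ^ CARD('m) * (X ^ CARD('n) * psi_mass) / 2 \<le> norm (propagator t (rho_wave ?P ?L) z)"
        unfolding xy cardPL .
    next
      have "\<delta> / Y \<le> \<delta>" if "1 \<le> Y" for Y
        using that \<delta>(1) by (simp add: divide_le_eq)
      from this[OF X] this[OF one_le_power[OF X, of 2]]
      have "\<delta> / X \<le> \<delta>" "\<delta> / X\<^sup>2 \<le> \<delta>" .
      then show "\<delta> / X \<le> 2 * pi" "\<delta> / X\<^sup>2 \<le> 1" using \<delta> pi_gt3 by linarith+
    qed (use \<delta> X psi_mass_pos in auto)
    note le = order_trans[OF low modulation_estimate_rho_wave[OF est]]
    have up: "modulation_norm \<sigma> \<alpha> p q (rho_wave ?P ?L) \<le> ennreal (A * (((1 + ?m + ?n) * X) powr \<alpha>) * (card ?P * card ?L) powr ?b)"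
    proof (rule mod[OF fin ne], rule ballI)
      fix K assume K: "K \<in> ?P \<times> hood ?L"
      \<comment> \<open>The same unit of room absorbs the shift by a neighbour.\<close>
      have "\<bar>(ivec (snd K) :: real^'n) $ j\<bar> \<le> X" for j
      proof -
        obtain l d where ld: "l \<in> ?L" "d \<in> neighbours" "snd K = l - d" using K by (auto simp: hood_def)
        have "l $ j \<in> ?B" using ld(1) by blast
        then have "0 \<le> l $ j" "l $ j \<le> int N" by auto
        moreover have "-1 \<le> d $ j" "d $ j \<le> 1" using ld(2) by (auto simp: neighbours_def dest!: spec[of _ j])
        ultimately have "\<bar>snd K $ j\<bar> \<le> int (Suc N)" unfolding ld(3) by simp
        then show ?thesis unfolding X_def ivec_nth by linarith
      qed
      then have "norm (ivec (snd K) :: real^'n) \<le> ?n * X" by (rule norm_le_const_vec)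
      moreover have "norm (ivec (fst K) :: real^'m) \<le> ?m * X"
        by (rule norm_le_const_vec[OF kP]) (use K in auto)
      moreover have "norm (lattice_pt K) \<le> norm (ivec (fst K) :: real^'m) + norm (ivec (snd K) :: real^'n)"
        unfolding lattice_pt_def by (rule norm_Pair_le)
      moreover have "sqrt (1 + (norm (lattice_pt K))\<^sup>2) \<le> 1 + norm (lattice_pt K)"
        by (rule real_le_lsqrt) (simp_all add: power2_sum)
      ultimately have "sqrt (1 + (norm (lattice_pt K))\<^sup>2) \<le> (1 + ?m + ?n) * X"
        using X by (simp add: distrib_right)
      then show "sqrt (1 + (norm (lattice_pt K))\<^sup>2) powr \<alpha> \<le> ((1 + ?m + ?n) * X) powr \<alpha>"
        using \<alpha> by (intro powr_mono2) auto
    qed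
    have Xm: "X ^ k = X powr real k" for k using X by (simp add: powr_realpow)
    have "(X ^ CARD('m) * (X ^ CARD('n) * psi_mass) / 2) * ((\<delta> / X) ^ ?M * (\<delta> / X\<^sup>2)) powr ?a
        \<le> max C 0 * (A * (((1 + ?m + ?n) * X) powr \<alpha>) * (card ?P * card ?L) powr ?b)"
      by (rule ennreal_le_mult_maxD[OF le up]) (use A in simp)
    moreover have "(X ^ CARD('m) * (X ^ CARD('n) * psi_mass) / 2) * ((\<delta> / X) ^ ?M * (\<delta> / X\<^sup>2)) powr ?a
        = c * X powr (?M - (?M + 2) * ?a)"
    proof -
      have "(\<delta> / X) ^ ?M * (\<delta> / X\<^sup>2) = \<delta> ^ (?M + 1) * X powr (- (real ?M + 2))"
      proof -
        have "X powr (real ?M + 2) = X ^ ?M * X\<^sup>2"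
          using X by (simp only: powr_add) (simp add: powr_realpow[of X ?M, simplified] powr_numeral power_add powr_realpow powr_add)
        then show ?thesis by (simp only: powr_minus) (simp add: power_mult_distrib power_inverse divide_inverse mult_ac)
      qed
      then have e1: "((\<delta> / X) ^ ?M * (\<delta> / X\<^sup>2)) powr ?a = (\<delta> ^ (?M + 1)) powr ?a * X powr (- (real ?M + 2) * ?a)"
        using \<delta> X by (simp only: powr_mult powr_powr)
      have e2: "X ^ CARD('m) * (X ^ CARD('n) * psi_mass) / 2 = psi_mass / 2 * X powr ?M"
        unfolding Xm by (simp add: powr_add)
      have e3: "X powr ?M * X powr (- (real ?M + 2) * ?a) = X powr (?M - (?M + 2) * ?a)"
        unfolding powr_add[symmetric] by (rule arg_cong[of _ _ "\<lambda>u. X powr u"]) (simp add: algebra_simps)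
      show ?thesis
        unfolding e1 e2 c_def e3[symmetric] by (simp only: mult_ac)
    qed
    moreover have "max C 0 * (A * (((1 + ?m + ?n) * X) powr \<alpha>) * (card ?P * card ?L) powr ?b)
        = (max C 0 * A * (1 + ?m + ?n) powr \<alpha>) * X powr (\<alpha> + ?M * ?b)"
    proof -
      have "(real (card ?P * card ?L)) powr ?b = X powr (?M * ?b)"
        unfolding of_nat_mult cardPL Xm by (simp add: powr_add[symmetric] powr_powr)
      then show ?thesis using X by (simp add: powr_mult powr_add mult_ac)
    qed
    ultimately show ?thesis by (simp only: X_def[symmetric])
  qed
  have "?M - (?M + 2) * ?a \<le> \<alpha> + ?M * ?b"
    by (rule powr_exponent_le[OF filterlim_real_Suc _ c main]) simp
  then show ?thesis by (simp add: algebra_simps)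
qed

end

section \<open>Weyl sums\<close>

lemma prod_sum_vec:
  fixes f :: "'n::finite \<Rightarrow> 'b \<Rightarrow> 'c::comm_semiring_1"
  assumes "finite B"
  shows "(\<Prod>i\<in>UNIV. \<Sum>b\<in>B. f i b) = (\<Sum>k\<in>{k :: 'b^'n. \<forall>i. k $ i \<in> B}. \<Prod>i\<in>UNIV. f i (k $ i))"
proof -
  have bij: "bij_betw vec_nth {k :: 'b^'n. \<forall>i. k $ i \<in> B} (PiE UNIV (\<lambda>_. B))"
    by (rule bij_betw_byWitness[where f'=vec_lambda]) (auto simp: PiE_def extensional_def)
  have "(\<Prod>i\<in>UNIV. \<Sum>b\<in>B. f i b) = (\<Sum>g\<in>PiE UNIV (\<lambda>_. B). \<Prod>i\<in>UNIV. f i (g i))"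
    by (rule prod_sum_PiE) (use assms in auto)
  also have "\<dots> = (\<Sum>k\<in>{k :: 'b^'n. \<forall>i. k $ i \<in> B}. \<Prod>i\<in>UNIV. f i (k $ i))"
    by (rule sum.reindex_bij_betw[OF bij, symmetric])
  finally show ?thesis .
qed

lemma cis_eq_1_imp: "cis x = 1 \<Longrightarrow> \<exists>n :: int. x = 2 * pi * of_int n"
  using exp_eq_1[of "\<i> * of_real x"] by (auto simp: cis_conv_exp)

lemma dft_orthogonality:
  fixes c :: int
  assumes N: "N > 0"
  shows "(\<Sum>i<N. cis (2 * pi * real_of_int c * real i / real N)) = (if int N dvd c then of_nat N else 0)"
proof -
  let ?w = "cis (2 * pi * real_of_int c / real N)"
  have pw: "cis (2 * pi * real_of_int c * real i / real N) = ?w ^ i" for i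
    by (simp add: Complex.DeMoivre mult_ac)
  have wN: "?w ^ N = 1"
    using N cis_multiple_2pi[of "of_int c"] by (simp add: Complex.DeMoivre)
  show ?thesis
  proof (cases "int N dvd c")
    case True
    then obtain e where "c = int N * e" by (rule dvdE)
    then have "?w = 1" using N cis_multiple_2pi[of "of_int e"] by (simp add: mult_ac)
    then show ?thesis unfolding pw using True by simp
  next
    case False
    have "?w \<noteq> 1"
    proof
      assume "?w = 1"
      then obtain n :: int where "2 * pi * real_of_int c / real N = 2 * pi * of_int n"
        using cis_eq_1_imp by blast
      then have "real_of_int c = real_of_int (int N * n)" using N by (simp add: field_simps)
      then have "c = int N * n" by (simp only: of_int_eq_iff)
      then show False using False by simp
    qed
    then show ?thesis
      unfolding pw using False wN by (simp add: sum_gp_strict)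
  qed
qed

text \<open>The Fejer weights \<open>N - \<bar>k\<bar>\<close> turn the quadratic exponential sum into a bilinear form whose
  matrix is, up to unimodular factors, that of the discrete Fourier transform.\<close>

lemma weyl_sum_bound:
  fixes t u :: real
  assumes t: "t = pi * real b / real N" and N: "N = 8 * b + 1"
  shows "norm (\<Sum>i<N. \<Sum>j<N. cis (t * (real i - real j)\<^sup>2 + (real i - real j) * u)) \<le> sqrt (real N ^ 3)"
proof -
  have N0: "N > 0" using N by simp
  define v where "v j = cis (t * (real j)\<^sup>2 - real j * u)" for j
  define F where "F i = (\<Sum>j<N. v j * cis (- (2 * t * real i * real j)))" for i
  \<comment> \<open>Expanding the square splits off unimodular factors in \<open>i\<close> and in
    \<open>j\<close>. As t = pi b/N, the cross term 2 t i j equals 2 pi b i j/N, a character modulo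
    \<open>N\<close>.\<close>
  have "(\<Sum>j<N. cis (t * (real i - real j)\<^sup>2 + (real i - real j) * u)) = cis (t * (real i)\<^sup>2 + real i * u) * F i" for i
    unfolding F_def v_def sum_distrib_left cis_mult
    by (intro sum.cong refl arg_cong[of _ _ cis]) (simp add: power2_eq_square algebra_simps)
  then have "norm (\<Sum>i<N. \<Sum>j<N. cis (t * (real i - real j)\<^sup>2 + (real i - real j) * u)) \<le> (\<Sum>i<N. norm (F i))"
    by (simp only:) (rule order_trans[OF norm_sum], simp add: norm_mult)
  then have 1: "(norm (\<Sum>i<N. \<Sum>j<N. cis (t * (real i - real j)\<^sup>2 + (real i - real j) * u)))\<^sup>2 \<le> (\<Sum>i<N. norm (F i))\<^sup>2"
    by (rule power_mono) simp
  \<comment> \<open>Cauchy-Schwarz in \<open>i\<close>. Parseval for the discrete transform then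
    evaluates the sum of squares as N times the sum of |v j|^2 = 1, that is N^2, so the total is
    N^3.\<close>
  also have "\<dots> \<le> (\<Sum>i<N. (norm (F i))\<^sup>2) * real N"
    using sum_squared_le_sum_of_squares[of "\<lambda>i. norm (F i)" "{..<N}"] by simp
  also have "(\<Sum>i<N. (norm (F i))\<^sup>2) = (real N)\<^sup>2"
  proof -
    have orth: "(\<Sum>i<N. cis (- (2 * t * real i * real j)) * cis (2 * t * real i * real j')) = (if j = j' then of_nat N else 0)"
      if "j < N" "j' < N" for j j'
    proof -
      let ?c = "int b * (int j' - int j)"
      have "(\<Sum>i<N. cis (- (2 * t * real i * real j)) * cis (2 * t * real i * real j')) =
          (\<Sum>i<N. cis (2 * pi * real_of_int ?c * real i / real N))"
        unfolding cis_mult t by (intro sum.cong refl arg_cong[of _ _ cis]) (simp add: algebra_simps diff_divide_distrib)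
      also have "\<dots> = (if int N dvd ?c then of_nat N else 0)" by (rule dft_orthogonality[OF N0])
      also have "int N dvd ?c \<longleftrightarrow> j = j'"
      proof
        assume "int N dvd ?c"
        \<comment> \<open>As 8 b = N - 1 is congruent to -1 modulo \<open>N\<close>, multiplication
          by 8 removes \<open>b\<close>.\<close>
        then have "int N dvd 8 * ?c" by simp
        also have "8 * ?c = int N * (int j' - int j) - (int j' - int j)" by (simp add: N algebra_simps)
        finally have "int N dvd int j' - int j" by (simp add: dvd_diff_right_iff)
        then have "int j' - int j = 0"
          using that zdvd_imp_le[of "int N" "\<bar>int j' - int j\<bar>"] by (cases "int j' - int j = 0") auto
        then show "j = j'" by simp
      qed simp
      finally show ?thesis .
    qed
    have "complex_of_real (\<Sum>i<N. (norm (F i))\<^sup>2) = (\<Sum>i<N. F i * cnj (F i))"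
      by (simp only: of_real_sum complex_norm_square)
    also have "\<dots> = (\<Sum>i<N. \<Sum>j<N. \<Sum>j'<N. (v j * cnj (v j')) * (cis (- (2 * t * real i * real j)) * cis (2 * t * real i * real j')))"
      unfolding F_def cnj_sum sum_product by (simp add: cis_cnj mult_ac)
    also have "\<dots> = (\<Sum>j<N. \<Sum>j'<N. (v j * cnj (v j')) * (\<Sum>i<N. cis (- (2 * t * real i * real j)) * cis (2 * t * real i * real j')))"
      unfolding sum_distrib_left by (rule trans[OF sum.swap], rule sum.cong[OF refl], rule sum.swap)
    also have "\<dots> = (\<Sum>j<N. \<Sum>j'<N. if j = j' then (v j * cnj (v j')) * of_nat N else 0)"
      by (intro sum.cong refl) (simp add: orth)
    also have "\<dots> = (\<Sum>j<N. of_nat N)"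
      by (intro sum.cong refl) (simp add: sum.delta v_def cis_cnj cis_mult)
    finally have "complex_of_real (\<Sum>i<N. (norm (F i))\<^sup>2) = complex_of_real ((real N)\<^sup>2)"
      by (simp add: power2_eq_square)
    then show ?thesis by (simp only: of_real_eq_iff)
  qed
  finally have "(norm (\<Sum>i<N. \<Sum>j<N. cis (t * (real i - real j)\<^sup>2 + (real i - real j) * u)))\<^sup>2 \<le> real N ^ 3"
    by (simp add: power3_eq_cube power2_eq_square)
  then show ?thesis by (rule real_le_rsqrt)
qed

text \<open>Equal to N - |k| for |k| < N. The counting form makes the passage between the double sum
  over \<open>i\<close>, \<open>j\<close> and the sum over \<open>k = i - j\<close> a mere
  regrouping, without evaluating the weight.\<close>

definition fejer :: "nat \<Rightarrow> int \<Rightarrow> nat" where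
  "fejer N k = card {ij \<in> {..<N} \<times> {..<N}. int (fst ij) - int (snd ij) = k}"

abbreviation fejer_range :: "nat \<Rightarrow> int set" where
  "fejer_range N \<equiv> {- int N<..<int N}"

lemma sum_fejer:
  fixes g :: "int \<Rightarrow> 'a::comm_semiring_1"
  shows "(\<Sum>k\<in>fejer_range N. of_nat (fejer N k) * g k) = (\<Sum>i<N. \<Sum>j<N. g (int i - int j))"
proof -
  have "(\<Sum>i<N. \<Sum>j<N. g (int i - int j)) = (\<Sum>ij\<in>{..<N} \<times> {..<N}. g (int (fst ij) - int (snd ij)))"
    by (simp add: sum.cartesian_product case_prod_unfold)
  also have "\<dots> = (\<Sum>k\<in>fejer_range N. of_nat (fejer N k) * g k)"
    unfolding fejer_def by (rule sum_fun_comp) auto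
  finally show ?thesis ..
qed

definition fejer_box :: "nat \<Rightarrow> (int^'m) set" where
  "fejer_box N = {k. \<forall>i. k $ i \<in> fejer_range N}"

definition fejer_weight :: "nat \<Rightarrow> int^'m \<Rightarrow> real" where
  "fejer_weight N k = (\<Prod>i\<in>UNIV. real (fejer N (k $ i)))"

lemma fejer_weight_nonneg: "0 \<le> fejer_weight N k"
  by (simp add: fejer_weight_def prod_nonneg)

lemma sum_fejer_weight: "(\<Sum>k\<in>(fejer_box N :: (int^'m) set). fejer_weight N k) = (real N)\<^sup>2 ^ CARD('m)"
proof -
  have "(\<Sum>k\<in>(fejer_box N :: (int^'m) set). fejer_weight N k) = (\<Prod>i\<in>(UNIV :: 'm set). \<Sum>k\<in>fejer_range N. real (fejer N k))"
    unfolding fejer_box_def fejer_weight_def by (rule prod_sum_vec[symmetric]) simp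
  also have "(\<Sum>k\<in>fejer_range N. real (fejer N k)) = (real N)\<^sup>2"
    using sum_fejer[of N "\<lambda>_. 1 :: real"] by (simp add: power2_eq_square)
  finally show ?thesis by simp
qed

lemma ivec_inner: "ivec k \<bullet> x = (\<Sum>i\<in>UNIV. real_of_int (k $ i) * x $ i)"
  by (simp add: inner_vec_def ivec_def)

lemma norm_ivec_square: "(norm (ivec k))\<^sup>2 = (\<Sum>i\<in>UNIV. (real_of_int (k $ i))\<^sup>2)"
  unfolding power2_norm_eq_inner ivec_inner by (simp add: ivec_def power2_eq_square)

lemma weyl_sum_vec_bound:
  fixes x :: "real^'m"
  assumes "t = pi * real b / real N" "N = 8 * b + 1"
  shows "norm (\<Sum>k\<in>fejer_box N. of_real (fejer_weight N k) * cis (t * (norm (ivec k :: real^'m))\<^sup>2 + ivec k \<bullet> x))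
    \<le> sqrt (real N ^ 3) ^ CARD('m)"
proof -
  let ?g = "\<lambda>i k. of_nat (fejer N k) * cis (t * (real_of_int k)\<^sup>2 + real_of_int k * x $ i)"
  have "(\<Sum>k\<in>fejer_box N. of_real (fejer_weight N k) * cis (t * (norm (ivec k :: real^'m))\<^sup>2 + ivec k \<bullet> x)) =
      (\<Sum>k\<in>fejer_box N. \<Prod>i\<in>UNIV. ?g i (k $ i))"
    by (intro sum.cong refl)
      (simp add: prod.distrib fejer_weight_def cis_sum[symmetric] norm_ivec_square ivec_inner sum_distrib_left sum.distrib[symmetric])
  also have "\<dots> = (\<Prod>i\<in>UNIV. \<Sum>k\<in>fejer_range N. ?g i k)"
    unfolding fejer_box_def by (rule prod_sum_vec[symmetric]) simp
  also have "norm \<dots> = (\<Prod>i\<in>UNIV. norm (\<Sum>k\<in>fejer_range N. ?g i k))"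
    by (rule prod_norm[symmetric])
  also have "\<dots> \<le> (\<Prod>i\<in>(UNIV :: 'm set). sqrt (real N ^ 3))"
  proof (rule prod_mono)
    fix i
    have "(\<Sum>k\<in>fejer_range N. ?g i k) = (\<Sum>i'<N. \<Sum>j<N. cis (t * (real i' - real j)\<^sup>2 + (real i' - real j) * x $ i))"
      by (subst sum_fejer) simp
    then show "0 \<le> norm (\<Sum>k\<in>fejer_range N. ?g i k) \<and> norm (\<Sum>k\<in>fejer_range N. ?g i k) \<le> sqrt (real N ^ 3)"
      using weyl_sum_bound[OF assms, of "x $ i"] by simp
  qed
  finally show ?thesis by simp
qed

section \<open>Sobolev spaces\<close>

lemma bessel_gauss_sfun:
  assumes "B \<ge> 1" "Re z > 0" "0 \<le> \<alpha>"
  shows "sfun (\<lambda>\<xi>. of_real ((B + \<xi> \<bullet> \<xi>) powr (- \<alpha> / 2)) * exp (- z * of_real (\<xi> \<bullet> \<xi>)))"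
  by (rule gauss_space_sfun[OF assms(1,2) gauss_space.base]) (use assms(3) in simp)

lemma bessel_gauss_integrable:
  assumes "B \<ge> 1" "c > 0" "0 \<le> \<alpha>"
  shows "integrable lborel (\<lambda>\<xi> :: 'a::euclidean_space. (B + \<xi> \<bullet> \<xi>) powr (- \<alpha> / 2) * exp (- c * (\<xi> \<bullet> \<xi>)))"
    and "integrable lborel (\<lambda>\<xi> :: 'a. (B + \<xi> \<bullet> \<xi>) powr (- \<alpha> / 2) * exp (- c * (\<xi> \<bullet> \<xi>)) * (\<xi> \<bullet> \<xi>))"
proof -
  let ?h = "\<lambda>\<xi> :: 'a. of_real ((B + \<xi> \<bullet> \<xi>) powr (- \<alpha> / 2)) * exp (- complex_of_real c * of_real (\<xi> \<bullet> \<xi>))"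
  have h: "sfun ?h" using assms by (intro bessel_gauss_sfun) auto
  have n: "norm (?h \<xi>) = (B + \<xi> \<bullet> \<xi>) powr (- \<alpha> / 2) * exp (- c * (\<xi> \<bullet> \<xi>))" for \<xi>
    by (simp add: norm_mult)
  show "integrable lborel (\<lambda>\<xi> :: 'a. (B + \<xi> \<bullet> \<xi>) powr (- \<alpha> / 2) * exp (- c * (\<xi> \<bullet> \<xi>)))"
    using sfun_integrable_norm_power[OF h, of 0] unfolding n by simp
  show "integrable lborel (\<lambda>\<xi> :: 'a. (B + \<xi> \<bullet> \<xi>) powr (- \<alpha> / 2) * exp (- c * (\<xi> \<bullet> \<xi>)) * (\<xi> \<bullet> \<xi>))"
    using sfun_integrable_norm_power[OF h, of 2] unfolding n by (simp add: power2_norm_eq_inner mult_ac)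
qed

text \<open>Rescaling \<open>\<xi>\<close> by \<open>\<surd>2\<close> absorbs the second moment, because the Bessel weight is radially
  decreasing; low frequencies therefore need no separate treatment.\<close>

lemma bessel_gauss_moment:
  assumes B: "B \<ge> 1" and c: "c > 0" and \<alpha>: "0 \<le> \<alpha>"
  defines "w \<equiv> \<lambda>\<xi> :: 'a::euclidean_space. (B + \<xi> \<bullet> \<xi>) powr (- \<alpha> / 2) * exp (- c * (\<xi> \<bullet> \<xi>))"
  shows "(LINT \<xi>|lborel. w \<xi> * (1 + c * (\<xi> \<bullet> \<xi>))) \<le> 2 * sqrt 2 ^ DIM('a) * (LINT \<xi>|lborel. w \<xi>)"
proof -
  let ?D = "\<lambda>\<xi> :: 'a. (B + \<xi> \<bullet> \<xi>) powr (- \<alpha> / 2)"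
  let ?v = "\<lambda>\<xi> :: 'a. ?D \<xi> * exp (- (c / 2) * (\<xi> \<bullet> \<xi>))"
  have w_int: "integrable lborel w" unfolding w_def by (rule bessel_gauss_integrable(1)[OF B c \<alpha>])
  have v_int: "integrable lborel ?v" using c by (intro bessel_gauss_integrable(1)[OF B _ \<alpha>]) simp
  have m_int: "integrable lborel (\<lambda>\<xi>. w \<xi> * (1 + c * (\<xi> \<bullet> \<xi>)))"
  proof -
    have "integrable lborel (\<lambda>\<xi>. w \<xi> + c * (w \<xi> * (\<xi> \<bullet> \<xi>)))"
      using bessel_gauss_integrable(2)[OF B c \<alpha>, where 'a='a] w_int
      by (intro Bochner_Integration.integrable_add integrable_mult_right) (simp_all add: w_def)
    then show ?thesis by (simp add: algebra_simps)
  qed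
  have "(LINT \<xi>|lborel. w \<xi> * (1 + c * (\<xi> \<bullet> \<xi>))) \<le> (LINT \<xi>|lborel. 2 * ?v \<xi>)"
  proof (rule integral_mono[OF m_int])
    show "integrable lborel (\<lambda>\<xi>. 2 * ?v \<xi>)" using v_int by (rule integrable_mult_right)
    fix \<xi> :: 'a
    \<comment> \<open>Half of the Gaussian decay pays for the moment; the dilation restores the full
      rate afterwards.\<close>
    have "1 + c * (\<xi> \<bullet> \<xi>) \<le> 2 * exp (c / 2 * (\<xi> \<bullet> \<xi>))"
      using exp_ge_add_one_self[of "c / 2 * (\<xi> \<bullet> \<xi>)"] by linarith
    then have "exp (- c * (\<xi> \<bullet> \<xi>)) * (1 + c * (\<xi> \<bullet> \<xi>)) \<le> exp (- c * (\<xi> \<bullet> \<xi>)) * (2 * exp (c / 2 * (\<xi> \<bullet> \<xi>)))"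
      by (intro mult_left_mono) auto
    also have "\<dots> = 2 * exp (- (c / 2) * (\<xi> \<bullet> \<xi>))" by (simp add: exp_add[symmetric])
    finally have "?D \<xi> * (exp (- c * (\<xi> \<bullet> \<xi>)) * (1 + c * (\<xi> \<bullet> \<xi>))) \<le> ?D \<xi> * (2 * exp (- (c / 2) * (\<xi> \<bullet> \<xi>)))"
      by (rule mult_left_mono) simp
    then show "w \<xi> * (1 + c * (\<xi> \<bullet> \<xi>)) \<le> 2 * ?v \<xi>" by (simp add: w_def mult_ac)
  qed
  also have "\<dots> = 2 * (sqrt 2 ^ DIM('a) * (LINT \<xi>|lborel. ?v (sqrt 2 *\<^sub>R \<xi>)))"
    using integral_lborel_scale[of ?v "sqrt 2"] borel_measurable_integrable[OF v_int] by simp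
  also have "\<dots> \<le> 2 * (sqrt 2 ^ DIM('a) * (LINT \<xi>|lborel. w \<xi>))"
  proof (intro mult_left_mono integral_mono')
    fix \<xi> :: 'a
    have e: "(sqrt 2 *\<^sub>R \<xi>) \<bullet> (sqrt 2 *\<^sub>R \<xi>) = 2 * (\<xi> \<bullet> \<xi>)" by simp
    have "(B + 2 * (\<xi> \<bullet> \<xi>)) powr (- \<alpha> / 2) \<le> ?D \<xi>"
      using B \<alpha> by (intro powr_mono2') (auto simp: add_pos_nonneg)
    then show "?v (sqrt 2 *\<^sub>R \<xi>) \<le> w \<xi>"
      unfolding e w_def by (simp add: mult_right_mono)
    show "0 \<le> w \<xi>" by (simp add: w_def)
  qed (use w_int in auto)
  finally show ?thesis by simp
qed

section \<open>The focusing data\<close>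

lemma exp_Complex_of_real: "exp (- Complex e (- t) * of_real s) = of_real (exp (- e * s)) * cis (t * s)"
  by (subst exp_eq_polar) simp

text \<open>The parameter \<open>dims\<close> only fixes the two dimension types, which no other
  parameter mentions.\<close>

locale focusing =
  fixes b N :: nat and t0 \<alpha> :: real and dims :: "((real^'m) \<times> (real^'n)) itself"
  assumes N: "N = 8 * b + 1" and b: "b \<ge> 1" and t0: "t0 = pi * real b / real N" and \<alpha>: "0 \<le> \<alpha>"
begin

definition X :: real where "X = real N"
definition \<epsilon> :: real where "\<epsilon> = 1 / X\<^sup>2"
text \<open>Chosen so that \<open>gauss z\<close> is the cutoff at frequency \<open>X\<close> times
  the chirp that the flow undoes at time \<open>t0\<close>.\<close>

definition z :: complex where "z = Complex \<epsilon> (- t0)"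

lemma X: "X \<ge> 1"
proof -
  have "1 \<le> real N" using N by simp
  then show ?thesis unfolding X_def .
qed

lemma \<epsilon>: "0 < \<epsilon>" "\<epsilon> \<le> 1" using X by (simp_all add: \<epsilon>_def)

text \<open>\<open>t0\<close> lies between pi/9 and pi/8. The lower bound keeps \<open>z\<close>
  away from 0, so that the data are dispersed; the upper one leaves room in the unit interval for
  the short time after focusing.\<close>

lemma t0_bounds: "1/3 \<le> t0" "t0 \<le> 1/2"
proof -
  have "real N \<le> 9 * real b" "8 * real b \<le> real N" using N b by simp_all
  moreover have "3 * real b \<le> pi * real b" "pi * real b \<le> 4 * real b"
    using pi_gt3 pi_less_4 by (intro mult_right_mono; simp)+
  ultimately have le: "1/3 * real N \<le> pi * real b" "pi * real b \<le> 1/2 * real N" by linarith+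
  have "real N > 0" using N by simp
  then show "1/3 \<le> t0" "t0 \<le> 1/2"
    unfolding t0 by (rule pos_le_divide_eq[THEN iffD2, OF _ le(1)], rule pos_divide_le_eq[THEN iffD2, OF _ le(2)])
qed

lemma z: "Re z > 0" "Re z = \<epsilon>" "1/3 \<le> norm z" "(norm z)\<^sup>2 \<le> 2"
proof -
  show "Re z > 0" "Re z = \<epsilon>" using \<epsilon> by (simp_all add: z_def)
  have "t0 \<le> norm z" using abs_Im_le_cmod[of z] by (simp add: z_def)
  then show "1/3 \<le> norm z" using t0_bounds by linarith
  have "\<epsilon>\<^sup>2 \<le> 1" "t0\<^sup>2 \<le> 1" using \<epsilon> t0_bounds by (auto intro!: power_le_one)
  then show "(norm z)\<^sup>2 \<le> 2" by (simp add: cmod_power2 z_def)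
qed

text \<open>The transform has height (pi/|z|)^(n/2), bounded because |z| \<ge> 1/3, and decay rate
  \<epsilon>/(4|z|^2), at least \<epsilon>/8 because |z|^2 \<le> 2. This is the dispersion in the
  Euclidean variables.\<close>

lemma norm_ift_gauss_z:
  fixes y :: "real^'n"
  shows "norm (ift (gauss z) y) \<le> sqrt 12 ^ CARD('n) * exp (- (\<epsilon> / 8) * (y \<bullet> y))"
proof -
  have "Re (1 / (4 * z)) = \<epsilon> / (4 * (norm z)\<^sup>2)"
    using z by (simp add: Re_divide' norm_mult power_mult_distrib)
  moreover have "\<epsilon> / 8 \<le> \<epsilon> / (4 * (norm z)\<^sup>2)"
    using z \<epsilon> by (intro divide_left_mono) auto
  ultimately have "\<epsilon> / 8 * (y \<bullet> y) \<le> Re (1 / (4 * z)) * (y \<bullet> y)"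
    by (intro mult_right_mono) auto
  then have 1: "norm (gauss (1 / (4 * z)) y) \<le> exp (- (\<epsilon> / 8) * (y \<bullet> y))"
    unfolding norm_gauss by simp
  have "pi / norm z \<le> 12"
    using z(3) pi_less_4 by (simp add: divide_le_eq)
  then have "sqrt (pi / norm z) ^ CARD('n) \<le> sqrt 12 ^ CARD('n)"
    by (intro power_mono real_sqrt_le_mono) auto
  then show ?thesis
    unfolding ift_gauss[OF z(1), of y] norm_mult norm_gauss_integral[OF z(1)]
    using 1 by (intro mult_mono) auto
qed

definition weight :: "int^'m \<Rightarrow> real^'n \<Rightarrow> real" where
  "weight k \<xi> = fejer_weight N k *
    (((1 + (norm (ivec k :: real^'m))\<^sup>2) + \<xi> \<bullet> \<xi>) powr (- \<alpha> / 2) * exp (- \<epsilon> * (\<xi> \<bullet> \<xi>)))"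

definition fhat :: "int^'m \<Rightarrow> real^'n \<Rightarrow> complex" where
  "fhat k \<xi> = of_real (weight k \<xi>) * cis (t0 * ((norm (ivec k :: real^'m))\<^sup>2 + \<xi> \<bullet> \<xi>))"

abbreviation box :: "(int^'m) set" where "box \<equiv> fejer_box N"

lemma finite_box: "finite box"
  unfolding fejer_box_def by (rule finite_card_int_box(1)) simp

lemma fhat_eq: "fhat k \<xi> = (of_real (fejer_weight N k) * cis (t0 * (norm (ivec k :: real^'m))\<^sup>2)) *
    (of_real (((1 + (norm (ivec k :: real^'m))\<^sup>2) + \<xi> \<bullet> \<xi>) powr (- \<alpha> / 2)) * gauss z \<xi>)"
  unfolding gauss_def z_def exp_Complex_of_real fhat_def weight_def distrib_left cis_mult[symmetric] by simp

lemma sfun_fhat: "sfun (fhat k)"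
  unfolding fhat_eq[abs_def] gauss_def by (intro sfun_cmult bessel_gauss_sfun z \<alpha>) simp

lemma weight_nonneg: "0 \<le> weight k \<xi>"
  by (simp add: weight_def fejer_weight_nonneg)

lemma integrable_weight: "integrable lborel (weight k)"
  unfolding weight_def by (intro integrable_mult_right bessel_gauss_integrable \<epsilon> \<alpha>) simp

definition u0 :: "(real^'m) \<times> (real^'n) \<Rightarrow> complex" where "u0 = wave box fhat"

lemma schwartz_u0: "schwartz u0"
  unfolding u0_def by (rule wave_schwartz[OF sfun_fhat])

text \<open>Once the symbol has cancelled the Bessel weight, nothing couples \<open>k\<close> and
  \<open>\<xi>\<close> any more, and the transform of the chirped Gaussian factors out.\<close>

lemma bessel_potential_u0:
  "bessel_potential \<alpha> u0 (x, y) = (\<Sum>k\<in>box. of_real (fejer_weight N k) *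
    cis (t0 * (norm (ivec k :: real^'m))\<^sup>2 + ivec k \<bullet> x)) * ift (gauss z) y"
proof -
  have "bessel_potential \<alpha> u0 (x, y) = (\<Sum>k\<in>box. cis (ivec k \<bullet> x) *
      ift (\<lambda>\<xi>. of_real ((1 + (norm (ivec k :: real^'m, \<xi>))\<^sup>2) powr (\<alpha> / 2)) * fhat k \<xi>) y)"
    unfolding bessel_potential_def u0_def by (subst multiplier_wave[OF finite_box sfun_fhat]) simp
  also have "\<dots> = (\<Sum>k\<in>box. (of_real (fejer_weight N k) *
    cis (t0 * (norm (ivec k :: real^'m))\<^sup>2 + ivec k \<bullet> x)) * ift (gauss z) y)"
  proof (intro sum.cong refl)
    fix k :: "int^'m"
    have "of_real ((1 + (norm (ivec k :: real^'m, \<xi>))\<^sup>2) powr (\<alpha> / 2)) * fhat k \<xi> =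
        (of_real (fejer_weight N k) * cis (t0 * (norm (ivec k :: real^'m))\<^sup>2)) * gauss z \<xi>" for \<xi> :: "real^'n"
    proof -
      let ?B = "(1 + (norm (ivec k :: real^'m))\<^sup>2) + \<xi> \<bullet> \<xi>"
      have "?B > 0" by (simp add: add_pos_nonneg)
      then have one: "complex_of_real (?B powr (\<alpha> / 2)) * of_real (?B powr (- \<alpha> / 2)) = 1"
        unfolding of_real_mult[symmetric] powr_add[symmetric] by simp
      have B: "1 + (norm (ivec k :: real^'m, \<xi>))\<^sup>2 = ?B" by (simp add: norm_Pair power2_norm_eq_inner)
      have rearrange: "u * (v * (w * g)) = (u * w) * (v * g)" for u v w g :: complex by (simp only: mult_ac)
      show ?thesis unfolding fhat_eq B rearrange[of _ "of_real (fejer_weight N k) * _"] one by simp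
    qed
    then show "cis (ivec k \<bullet> x) * ift (\<lambda>\<xi>. of_real ((1 + (norm (ivec k :: real^'m, \<xi>))\<^sup>2) powr (\<alpha> / 2)) * fhat k \<xi>) y =
        (of_real (fejer_weight N k) * cis (t0 * (norm (ivec k :: real^'m))\<^sup>2 + ivec k \<bullet> x)) * ift (gauss z) y"
      by (simp only: ift_cmult) (simp add: cis_mult[symmetric] mult_ac)
  qed
  finally show ?thesis by (simp only: sum_distrib_right)
qed

lemma sobolev_norm_u0_le:
  assumes p: "1 \<le> p"
  shows "sobolev_norm \<alpha> p u0 \<le> ennreal (sqrt (X ^ 3) ^ CARD('m) * sqrt 12 ^ CARD('n) *
    ((2 * pi) ^ CARD('m) * (sqrt (8 * pi) * X) ^ CARD('n)) powr enn2real (1 / p))"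
  unfolding sobolev_norm_def
proof (rule Lp_norm_decay_bound[OF p, where w="\<lambda>y. exp (- (\<epsilon> / 8) * (y \<bullet> y))"])
  let ?S = "\<lambda>x :: real^'m. \<Sum>k\<in>box. of_real (fejer_weight N k) * cis (t0 * (norm (ivec k :: real^'m))\<^sup>2 + ivec k \<bullet> x)"
  have eq: "bessel_potential \<alpha> u0 = (\<lambda>p. ?S (fst p) * ift (gauss z) (snd p))"
    using bessel_potential_u0 by (auto simp: fun_eq_iff)
  have "continuous_on UNIV (\<lambda>p :: (real^'m) \<times> (real^'n). ?S (fst p) * ift (gauss z) (snd p))"
    by (intro continuous_intros continuous_on_compose2[OF continuous_on_ift[OF sfun_gauss[OF z(1)], of UNIV]]) auto
  then show "bessel_potential \<alpha> u0 \<in> borel_measurable borel"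
    unfolding eq by (rule borel_measurable_continuous_onI)
  show "norm (bessel_potential \<alpha> u0 p) \<le> sqrt (X ^ 3) ^ CARD('m) * sqrt 12 ^ CARD('n) * exp (- (\<epsilon> / 8) * (snd p \<bullet> snd p))" for p
    unfolding eq norm_mult mult.assoc
    using weyl_sum_vec_bound[OF t0 N, of "fst p"] norm_ift_gauss_z[of "snd p"] by (intro mult_mono) (auto simp: X_def)
  have c: "\<epsilon> / 8 > 0" using \<epsilon> by simp
  have g: "gauss (of_real (\<epsilon> / 8)) y = complex_of_real (exp (- (\<epsilon> / 8) * (y \<bullet> y)))" for y :: "real^'n"
    by (simp add: gauss_def exp_of_real[symmetric])
  have int: "integrable lborel (\<lambda>y :: real^'n. exp (- (\<epsilon> / 8) * (y \<bullet> y)))"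
    by (rule integrable_rapid[OF rapid_gaussian[OF c]])
      (intro borel_measurable_continuous_onI continuous_intros)
  then show "integrable lborel (\<lambda>y :: real^'n. exp (- (\<epsilon> / 8) * (y \<bullet> y)))" .
  have "complex_of_real (LINT y|lborel. exp (- (\<epsilon> / 8) * ((y :: real^'n) \<bullet> y))) = of_real (sqrt (pi / (\<epsilon> / 8)) ^ CARD('n))"
    using gauss_integral_real[OF c, where 'a="real^'n"] unfolding ift_def g by simp
  then have "(LINT y|lborel. exp (- (\<epsilon> / 8) * ((y :: real^'n) \<bullet> y))) = sqrt (pi / (\<epsilon> / 8)) ^ CARD('n)"
    by (simp only: of_real_eq_iff)
  also have "sqrt (pi / (\<epsilon> / 8)) = sqrt (8 * pi) * X"
    using X by (simp add: \<epsilon>_def real_sqrt_mult)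
  finally show "(LINT y|lborel. exp (- (\<epsilon> / 8) * ((y :: real^'n) \<bullet> y))) \<le> (sqrt (8 * pi) * X) ^ CARD('n)" by simp
  show "(\<lambda>y :: real^'n. exp (- (\<epsilon> / 8) * (y \<bullet> y))) \<in> borel_measurable borel"
    by (intro borel_measurable_continuous_onI continuous_intros)
qed (use X \<epsilon> in auto)

text \<open>The summands account for \<open>k \<bullet> x\<close>, \<open>\<xi> \<bullet> y\<close>,
  s |k|^2 and s |\<xi>|^2 in \<open>phase_bound\<close>, in this order.\<close>

definition Q :: real where
  "Q = real CARD('m) + real CARD('n) + (real CARD('m))\<^sup>2 + 1"

text \<open>Solves \<delta> Q M = 1/2, where M is the moment constant of
  \<open>bessel_gauss_moment\<close>: the mean phase then just meets the hypothesis of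
  \<open>norm_phase_sum_ge\<close>.\<close>

definition \<delta> :: real where
  "\<delta> = 1 / (2 * Q * (2 * sqrt 2 ^ CARD('n)))"

lemma Q: "Q \<ge> 3"
proof -
  have "real CARD('m) \<ge> 1" "real CARD('n) \<ge> 1" by (simp_all add: Suc_leI)
  then show ?thesis unfolding Q_def using zero_le_power2[of "real CARD('m)"] by linarith
qed

lemma \<delta>: "0 < \<delta>" "\<delta> \<le> 1/4" "\<delta> * Q * (2 * sqrt 2 ^ CARD('n)) = 1/2"
proof -
  have s: "1 \<le> sqrt 2 ^ CARD('n)" by (rule one_le_power) simp
  then have "3 * 1 \<le> Q * sqrt 2 ^ CARD('n)" using Q by (intro mult_mono) auto
  then show "\<delta> \<le> 1/4" "0 < \<delta>" by (simp_all add: \<delta>_def field_simps)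
  show "\<delta> * Q * (2 * sqrt 2 ^ CARD('n)) = 1/2" using Q by (simp add: \<delta>_def)
qed

lemma fejer_box_le: "k \<in> box \<Longrightarrow> \<bar>(ivec k :: real^'m) $ i\<bar> \<le> X"
proof -
  assume "k \<in> box"
  then have "k $ i \<in> fejer_range N" unfolding fejer_box_def by blast
  then have "\<bar>k $ i\<bar> \<le> int N" by auto
  then show ?thesis unfolding X_def ivec_nth by linarith
qed

lemma norm_ivec_box: "k \<in> box \<Longrightarrow> (norm (ivec k :: real^'m))\<^sup>2 \<le> (real CARD('m))\<^sup>2 * X\<^sup>2"
  unfolding power_mult_distrib[symmetric] by (intro power_mono norm_le_const_vec fejer_box_le) auto

text \<open>Frequencies up to order \<open>X\<close> contribute O(\<delta>); beyond that the growth
  is at most quadratic in |\<xi>|/X, the linear term being absorbed by 2a \<le> 1 + a^2. This is the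
  moment that \<open>bessel_gauss_moment\<close> controls.\<close>

lemma phase_bound:
  fixes \<xi> :: "real^'n"
  assumes k: "k \<in> box" and xy: "(x, y) \<in> (small_box (\<delta> / X) :: ((real^'m) \<times> (real^'n)) set)" and s: "0 \<le> s" "s \<le> \<delta> / X\<^sup>2"
  shows "\<bar>ivec k \<bullet> x + \<xi> \<bullet> y - s * ((norm (ivec k :: real^'m))\<^sup>2 + \<xi> \<bullet> \<xi>)\<bar> \<le> \<delta> * Q * (1 + \<epsilon> * (\<xi> \<bullet> \<xi>))"
proof -
  let ?m = "real CARD('m)" and ?n = "real CARD('n)" and ?a = "\<epsilon> * (\<xi> \<bullet> \<xi>)"
  have a: "0 \<le> ?a" using \<epsilon> by simp
  have "\<bar>ivec k \<bullet> x\<bar> \<le> ?m * (X * (\<delta> / X))"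
    by (rule abs_inner_le_const_vec[OF fejer_box_le[OF k] abs_le_small_box(1)[OF xy]])
  then have 1: "\<bar>ivec k \<bullet> x\<bar> \<le> ?m * \<delta>" using X by simp
  have "norm y \<le> ?n * (\<delta> / X)" by (rule norm_le_const_vec[OF abs_le_small_box(2)[OF xy]])
  then have "\<bar>\<xi> \<bullet> y\<bar> \<le> norm \<xi> * (?n * (\<delta> / X))"
    by (intro order_trans[OF Cauchy_Schwarz_ineq2] mult_left_mono) auto
  also have "\<dots> = ?n * \<delta> * (norm \<xi> / X)" by simp
  also have "\<dots> \<le> ?n * \<delta> * (1 + ?a)"
  proof (rule mult_left_mono)
    have "0 \<le> (norm \<xi> / X - 1)\<^sup>2" by simp
    then have "2 * (norm \<xi> / X) \<le> 1 + (norm \<xi> / X)\<^sup>2" by (simp add: power2_diff)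
    also have "(norm \<xi> / X)\<^sup>2 = ?a" by (simp add: \<epsilon>_def power_divide power2_norm_eq_inner)
    finally have "2 * (norm \<xi> / X) \<le> 1 + ?a" .
    moreover have "0 \<le> norm \<xi> / X" using X by simp
    ultimately show "norm \<xi> / X \<le> 1 + ?a" by linarith
  qed (use \<delta> in simp)
  finally have 2: "\<bar>\<xi> \<bullet> y\<bar> \<le> ?n * \<delta> * (1 + ?a)" .
  have "s * (norm (ivec k :: real^'m))\<^sup>2 \<le> (\<delta> / X\<^sup>2) * (?m\<^sup>2 * X\<^sup>2)"
    using s norm_ivec_box[OF k] by (intro mult_mono) auto
  then have 3: "s * (norm (ivec k :: real^'m))\<^sup>2 \<le> \<delta> * ?m\<^sup>2" using X by simp
  have "s * (\<xi> \<bullet> \<xi>) \<le> (\<delta> / X\<^sup>2) * (\<xi> \<bullet> \<xi>)" using s by (intro mult_right_mono) auto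
  then have 4: "s * (\<xi> \<bullet> \<xi>) \<le> \<delta> * ?a" by (simp add: \<epsilon>_def)
  have 5: "0 \<le> s * (norm (ivec k :: real^'m))\<^sup>2" "0 \<le> s * (\<xi> \<bullet> \<xi>)" using s by auto
  have "\<bar>ivec k \<bullet> x + \<xi> \<bullet> y - s * ((norm (ivec k :: real^'m))\<^sup>2 + \<xi> \<bullet> \<xi>)\<bar>
      \<le> ?m * \<delta> + ?n * \<delta> * (1 + ?a) + \<delta> * ?m\<^sup>2 + \<delta> * ?a"
    using 1 2 3 4 5 by (simp only: distrib_left[of s])
  also have "\<dots> \<le> ?m * \<delta> * (1 + ?a) + ?n * \<delta> * (1 + ?a) + \<delta> * ?m\<^sup>2 * (1 + ?a) + \<delta> * (1 + ?a)"
  proof -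
    have "0 \<le> ?m * \<delta> * ?a" "0 \<le> \<delta> * ?m\<^sup>2 * ?a" using \<delta> a by simp_all
    then show ?thesis using \<delta>(1) by (simp only: distrib_left mult_1_right)
  qed
  also have "\<dots> = \<delta> * Q * (1 + ?a)" by (simp add: Q_def algebra_simps)
  finally show ?thesis .
qed

text \<open>On the cube of side \<open>X\<close> the Gaussian is bounded below and, as \<alpha>
  \<ge> 0, the Bessel weight is at least a constant times X^(-\<alpha>), uniformly for
  \<open>k\<close> in the box; the cube has volume X^n.\<close>

lemma integral_weight_ge:
  assumes k: "k \<in> box"
  shows "fejer_weight N k * (((1 + (real CARD('m))\<^sup>2 + (real CARD('n))\<^sup>2) powr (- \<alpha> / 2) * exp (- (real CARD('n))\<^sup>2))
    * X powr (real CARD('n) - \<alpha>)) \<le> (LINT \<xi>|lborel. weight k \<xi>)"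
proof -
  let ?m = "real CARD('m)" and ?n = "real CARD('n)"
  let ?R = "1 + ?m\<^sup>2 + ?n\<^sup>2" and ?C = "cbox 0 (\<chi> j. X) :: (real^'n) set"
  let ?c = "(?R * X\<^sup>2) powr (- \<alpha> / 2) * exp (- ?n\<^sup>2)"
  let ?w = "\<lambda>\<xi> :: real^'n. ((1 + (norm (ivec k :: real^'m))\<^sup>2) + \<xi> \<bullet> \<xi>) powr (- \<alpha> / 2) * exp (- \<epsilon> * (\<xi> \<bullet> \<xi>))"
  have X0: "X > 0" using X by simp
  have mC: "measure lborel ?C = X ^ CARD('n)"
    using emeasure_const_cbox[of X, where 'm='n] X by (simp add: measure_def)
  have "?c * X ^ CARD('n) = (LINT \<xi>|lborel. ?c * indicator ?C \<xi>)"
    using mC by simp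
  also have "\<dots> \<le> (LINT \<xi>|lborel. ?w \<xi>)"
  proof (rule integral_mono')
    show "integrable lborel ?w" by (intro bessel_gauss_integrable \<epsilon> \<alpha>) simp
    fix \<xi> :: "real^'n"
    show "?c * indicator ?C \<xi> \<le> ?w \<xi>"
    proof (cases "\<xi> \<in> ?C")
      case True
      then have "\<bar>\<xi> $ j\<bar> \<le> X" for j by (simp add: mem_box_cart)
      then have "norm \<xi> \<le> ?n * X" by (rule norm_le_const_vec)
      then have \<xi>: "\<xi> \<bullet> \<xi> \<le> ?n\<^sup>2 * X\<^sup>2"
        unfolding power2_norm_eq_inner[symmetric] power_mult_distrib[symmetric] by (rule power_mono) simp
      have "(1 + (norm (ivec k :: real^'m))\<^sup>2) + \<xi> \<bullet> \<xi> \<le> X\<^sup>2 + ?m\<^sup>2 * X\<^sup>2 + ?n\<^sup>2 * X\<^sup>2"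
        using one_le_power[OF X, of 2] norm_ivec_box[OF k] \<xi> by linarith
      also have "\<dots> = ?R * X\<^sup>2" by (simp only: distrib_right mult_1)
      finally have "(?R * X\<^sup>2) powr (- \<alpha> / 2) \<le> ((1 + (norm (ivec k :: real^'m))\<^sup>2) + \<xi> \<bullet> \<xi>) powr (- \<alpha> / 2)"
        using \<alpha> by (intro powr_mono2') (auto simp: add_pos_nonneg)
      moreover have "\<epsilon> * (\<xi> \<bullet> \<xi>) \<le> ?n\<^sup>2"
        using \<xi> X0 by (simp add: \<epsilon>_def divide_le_eq)
      then have "exp (- ?n\<^sup>2) \<le> exp (- \<epsilon> * (\<xi> \<bullet> \<xi>))" by simp
      ultimately have "?c \<le> ?w \<xi>" by (intro mult_mono) auto
      then show ?thesis using True by simp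
    qed simp
  qed simp
  finally have le: "?c * X ^ CARD('n) \<le> (LINT \<xi>|lborel. ?w \<xi>)" .
  have "(X\<^sup>2) powr (- \<alpha> / 2) * X ^ CARD('n) = X powr (?n - \<alpha>)"
  proof -
    have "(X\<^sup>2) powr (- \<alpha> / 2) = X powr (- \<alpha>)"
      using X0 by (simp add: powr_powr flip: powr_numeral)
    moreover have "X ^ CARD('n) = X powr ?n" using X0 by (simp add: powr_realpow)
    ultimately show ?thesis by (simp add: powr_add[symmetric])
  qed
  then have c: "?c * X ^ CARD('n) = (?R powr (- \<alpha> / 2) * exp (- ?n\<^sup>2)) * X powr (?n - \<alpha>)"
    using X0 by (simp add: powr_mult mult_ac)
  have "(?R powr (- \<alpha> / 2) * exp (- ?n\<^sup>2)) * X powr (?n - \<alpha>) \<le> (LINT \<xi>|lborel. ?w \<xi>)"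
    using le unfolding c .
  then have "fejer_weight N k * ((?R powr (- \<alpha> / 2) * exp (- ?n\<^sup>2)) * X powr (?n - \<alpha>)) \<le> fejer_weight N k * (LINT \<xi>|lborel. ?w \<xi>)"
    by (rule mult_left_mono) (rule fejer_weight_nonneg)
  then show ?thesis by (simp add: weight_def)
qed

lemma propagator_u0_ge:
  assumes xy: "(x, y) \<in> (small_box (\<delta> / X) :: ((real^'m) \<times> (real^'n)) set)" and t: "t0 \<le> t" "t \<le> t0 + \<delta> / X\<^sup>2"
  shows "((1 + (real CARD('m))\<^sup>2 + (real CARD('n))\<^sup>2) powr (- \<alpha> / 2) * exp (- (real CARD('n))\<^sup>2)) / 2
    * X powr (2 * real CARD('m) + real CARD('n) - \<alpha>) \<le> norm (propagator t u0 (x, y))"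
proof -
  let ?c = "(1 + (real CARD('m))\<^sup>2 + (real CARD('n))\<^sup>2) powr (- \<alpha> / 2) * exp (- (real CARD('n))\<^sup>2)"
  \<comment> \<open>The chirp of the data cancels the propagator up to time \<open>t0\<close>; only
    the remaining time \<open>s\<close> enters the phase.\<close>
  define s where "s = t - t0"
  have s: "0 \<le> s" "s \<le> \<delta> / X\<^sup>2" using t by (simp_all add: s_def)
  let ?\<theta> = "\<lambda>k \<xi>. ivec k \<bullet> x + \<xi> \<bullet> y - s * ((norm (ivec k :: real^'m))\<^sup>2 + \<xi> \<bullet> \<xi>)"
  have "propagator t u0 (x, y) = (\<Sum>k\<in>box. cis (ivec k \<bullet> x) *
      ift (\<lambda>\<xi>. exp (- \<i> * complex_of_real (t * (norm (ivec k :: real^'m, \<xi>))\<^sup>2)) * fhat k \<xi>) y)"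
    unfolding propagator_def u0_def by (subst multiplier_wave[OF finite_box sfun_fhat]) simp
  also have "\<dots> = (\<Sum>k\<in>box. (LINT \<xi>|lborel. of_real (weight k \<xi>) * cis (?\<theta> k \<xi>)))"
    unfolding ift_def integral_mult_right_zero[symmetric]
  proof (intro sum.cong refl Bochner_Integration.integral_cong)
    fix k :: "int^'m" and \<xi> :: "real^'n"
    let ?q = "(norm (ivec k :: real^'m))\<^sup>2 + \<xi> \<bullet> \<xi>"
    have 1: "exp (- \<i> * complex_of_real (t * (norm (ivec k :: real^'m, \<xi>))\<^sup>2)) = cis (- (t * ?q))"
      by (simp add: cis_conv_exp norm_Pair power2_norm_eq_inner)
    have 2: "ivec k \<bullet> x + (- (t * ?q) + (t0 * ?q + \<xi> \<bullet> y)) = ?\<theta> k \<xi>"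
      by (simp add: s_def algebra_simps)
    have rearrange: "u * (v * (w * g) * h) = w * (u * (v * (g * h)))" for u v w g h :: complex
      by (simp only: mult_ac)
    show "cis (ivec k \<bullet> x) * (exp (- \<i> * complex_of_real (t * (norm (ivec k :: real^'m, \<xi>))\<^sup>2)) * fhat k \<xi> * cis (\<xi> \<bullet> y))
        = of_real (weight k \<xi>) * cis (?\<theta> k \<xi>)"
      unfolding fhat_def 1 rearrange cis_mult 2 ..
  qed
  finally have eq: "propagator t u0 (x, y) = (\<Sum>k\<in>box. (LINT \<xi>|lborel. of_real (weight k \<xi>) * cis (?\<theta> k \<xi>)))" .
  have \<theta>: "?\<theta> k \<in> borel_measurable borel" for k
    by (intro borel_measurable_continuous_onI continuous_intros)
  let ?W = "\<lambda>k \<xi>. \<delta> * Q * (weight k \<xi> * (1 + \<epsilon> * (\<xi> \<bullet> \<xi>)))"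
  have le: "weight k \<xi> * \<bar>?\<theta> k \<xi> - 0\<bar> \<le> ?W k \<xi>" if "k \<in> box" for k \<xi>
    using mult_left_mono[OF phase_bound[OF that xy s, of \<xi>] weight_nonneg[of k \<xi>]] by (simp add: mult_ac)
  have W_int: "integrable lborel (?W k)" for k
  proof -
    have "integrable lborel (\<lambda>\<xi>. weight k \<xi> + \<epsilon> * (weight k \<xi> * (\<xi> \<bullet> \<xi>)))"
      unfolding weight_def mult.assoc[of "fejer_weight N k"]
      by (intro Bochner_Integration.integrable_add integrable_mult_right bessel_gauss_integrable \<epsilon> \<alpha>) simp_all
    then have "integrable lborel (\<lambda>\<xi>. weight k \<xi> * (1 + \<epsilon> * (\<xi> \<bullet> \<xi>)))" by (simp add: algebra_simps)
    then show ?thesis by (rule integrable_mult_right)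
  qed
  have int: "integrable lborel (\<lambda>\<xi>. weight k \<xi> * \<bar>?\<theta> k \<xi> - 0\<bar>)" if "k \<in> box" for k
  proof (rule Bochner_Integration.integrable_bound[OF W_int])
    show "(\<lambda>\<xi>. weight k \<xi> * \<bar>?\<theta> k \<xi> - 0\<bar>) \<in> borel_measurable lborel"
      using \<theta>[of k] borel_measurable_integrable[OF integrable_weight[of k]] by measurable
    show "AE \<xi> in lborel. norm (weight k \<xi> * \<bar>?\<theta> k \<xi> - 0\<bar>) \<le> norm (?W k \<xi>)"
    proof (rule AE_I2)
      fix \<xi>
      have "norm (weight k \<xi> * \<bar>?\<theta> k \<xi> - 0\<bar>) = weight k \<xi> * \<bar>?\<theta> k \<xi> - 0\<bar>"
        using weight_nonneg[of k \<xi>] by (simp add: abs_mult)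
      also have "\<dots> \<le> ?W k \<xi>" by (rule le[OF that])
      also have "\<dots> \<le> norm (?W k \<xi>)" unfolding real_norm_def by (rule abs_ge_self)
      finally show "norm (weight k \<xi> * \<bar>?\<theta> k \<xi> - 0\<bar>) \<le> norm (?W k \<xi>)" .
    qed
  qed
  have "(\<Sum>k\<in>box. (LINT \<xi>|lborel. weight k \<xi>)) / 2 \<le> norm (\<Sum>k\<in>box. (LINT \<xi>|lborel. of_real (weight k \<xi>) * cis (?\<theta> k \<xi>)))"
  proof (rule norm_phase_sum_ge[where w=weight and \<phi>=0])
    fix k assume k: "k \<in> box"
    show "integrable lborel (weight k)" by (rule integrable_weight)
    show "?\<theta> k \<in> borel_measurable lborel" unfolding measurable_lborel2 by (rule \<theta>)
    show "integrable lborel (\<lambda>\<xi>. weight k \<xi> * \<bar>?\<theta> k \<xi> - 0\<bar>)" by (rule int[OF k])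
    let ?w = "\<lambda>\<xi> :: real^'n. ((1 + (norm (ivec k :: real^'m))\<^sup>2) + \<xi> \<bullet> \<xi>) powr (- \<alpha> / 2) * exp (- \<epsilon> * (\<xi> \<bullet> \<xi>))"
    have "(LINT \<xi>|lborel. weight k \<xi> * \<bar>?\<theta> k \<xi> - 0\<bar>) \<le> (LINT \<xi>|lborel. ?W k \<xi>)"
      by (rule integral_mono[OF int[OF k] W_int le[OF k]])
    also have "\<dots> = \<delta> * Q * (fejer_weight N k * (LINT \<xi>|lborel. ?w \<xi> * (1 + \<epsilon> * (\<xi> \<bullet> \<xi>))))"
      by (simp add: weight_def mult.assoc)
    \<comment> \<open>The moment constant does not depend on \<open>B\<close>, here 1 + |k|^2, so
      one \<open>\<delta>\<close> serves every torus frequency.\<close>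
    also have "\<dots> \<le> \<delta> * Q * (fejer_weight N k * (2 * sqrt 2 ^ CARD('n) * (LINT \<xi>|lborel. ?w \<xi>)))"
      using bessel_gauss_moment[OF _ \<epsilon>(1) \<alpha>, of "1 + (norm (ivec k :: real^'m))\<^sup>2", where 'a="real^'n"] \<delta> Q
      by (intro mult_left_mono) (simp_all add: fejer_weight_nonneg)
    also have "\<dots> = (\<delta> * Q * (2 * sqrt 2 ^ CARD('n))) * (fejer_weight N k * (LINT \<xi>|lborel. ?w \<xi>))"
      by (simp only: mult_ac)
    also have "\<dots> = (LINT \<xi>|lborel. weight k \<xi>) / 2" unfolding \<delta>(3) by (simp add: weight_def)
    finally show "(LINT \<xi>|lborel. weight k \<xi> * \<bar>?\<theta> k \<xi> - 0\<bar>) \<le> (LINT \<xi>|lborel. weight k \<xi>) / 2" .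
  next
    show "0 \<le> weight k \<xi>" for k \<xi> by (rule weight_nonneg)
  qed
  moreover have "?c * X powr (2 * real CARD('m) + real CARD('n) - \<alpha>) \<le> (\<Sum>k\<in>box. (LINT \<xi>|lborel. weight k \<xi>))"
  proof -
    have "X powr real (2 * CARD('m)) = X ^ (2 * CARD('m))"
      using X by (intro powr_realpow) simp
    then have "(X\<^sup>2) ^ CARD('m) = X powr (2 * real CARD('m))"
      by (simp add: power_mult)
    then have "?c * X powr (2 * real CARD('m) + real CARD('n) - \<alpha>) = (X\<^sup>2) ^ CARD('m) * (?c * X powr (real CARD('n) - \<alpha>))"
      by (simp add: powr_add[symmetric] mult.left_commute add_diff_eq)
    also have "\<dots> = (\<Sum>k\<in>box. fejer_weight N k * (?c * X powr (real CARD('n) - \<alpha>)))"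
      unfolding sum_distrib_right[symmetric] sum_fejer_weight X_def ..
    also have "\<dots> \<le> (\<Sum>k\<in>box. (LINT \<xi>|lborel. weight k \<xi>))"
      by (rule sum_mono) (rule integral_weight_ge)
    finally show ?thesis .
  qed
  ultimately show ?thesis unfolding eq times_divide_eq_left by linarith
qed

end

section \<open>Comparison of exponents for Sobolev data\<close>

lemma filterlim_affine_Suc: "filterlim (\<lambda>i. real (8 * Suc i + 1)) at_top sequentially"
proof (rule filterlim_at_top_mono[OF filterlim_real_Suc])
  show "\<forall>\<^sub>F i in sequentially. real (Suc i) \<le> real (8 * Suc i + 1)" by (intro always_eventually) simp
qed

lemma sobolev_exponent_ge:
  assumes p: "1 \<le> p" and q: "1 \<le> q" and r: "1 \<le> r" and \<alpha>: "0 \<le> \<alpha>"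
    and est: "\<forall>f :: (real^'m) \<times> (real^'n) \<Rightarrow> complex. schwartz f \<longrightarrow>
      mixed_norm q r (\<lambda>z t. propagator t f z) \<le> ennreal C * sobolev_norm \<alpha> p f"
  shows "\<alpha> \<ge> real (CARD('m) + CARD('n)) * (1/2 - enn2real (1/q)) + real CARD('n) * (1/2 - enn2real (1/p)) - 2 * enn2real (1/r)"
proof -
  let ?m = "real CARD('m)" and ?n = "real CARD('n)" and ?M = "CARD('m) + CARD('n)"
  let ?p = "enn2real (1/p)" and ?q = "enn2real (1/q)" and ?r = "enn2real (1/r)"
  define g where "g i = real (8 * Suc i + 1)" for i
  \<comment> \<open>The value of \<open>\<delta>\<close> in \<open>focusing\<close>, repeated here
    because the constants have to be fixed before \<open>N\<close> is. It depends on the dimensions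
    only, so \<open>c1\<close> and \<open>c2\<close> are uniform in \<open>i\<close>.\<close>
  define d where "d = 1 / (2 * (?m + ?n + ?m\<^sup>2 + 1) * (2 * sqrt 2 ^ CARD('n)))"
  define k where "k = ((1 + ?m\<^sup>2 + ?n\<^sup>2) powr (- \<alpha> / 2) * exp (- ?n\<^sup>2)) / 2"
  define c1 where "c1 = k * d powr ?r * (d ^ ?M) powr ?q"
  define c2 where "c2 = sqrt 12 ^ CARD('n) * ((2 * pi) ^ CARD('m) * sqrt (8 * pi) ^ CARD('n)) powr ?p"
  have k: "k > 0"
  proof -
    have "1 + ?m\<^sup>2 + ?n\<^sup>2 > 0" by (simp add: add_pos_nonneg)
    then show ?thesis by (simp add: k_def)
  qed
  have d: "d > 0" unfolding d_def by (simp add: add_pos_nonneg)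
  have c1: "c1 > 0" using k d by (simp add: c1_def)
  have main: "c1 * g i powr (2 * ?m + ?n - \<alpha> - 2 * ?r - ?M * ?q) \<le> (max C 0 * c2) * g i powr (3/2 * ?m + ?n * ?p)" for i
  proof -
    define N where "N = 8 * Suc i + 1"
    define t0 where "t0 = pi * real (Suc i) / real N"
    interpret F: focusing "Suc i" N t0 \<alpha> "TYPE((real^'m) \<times> (real^'n))"
      by unfold_locales (simp_all add: N_def t0_def \<alpha>)
    define X where "X = real N"
    have FX: "F.X = X" by (simp add: F.X_def X_def)
    have F\<delta>: "F.\<delta> = d" by (simp add: F.\<delta>_def F.Q_def d_def)
    note X = F.X[unfolded FX] and dd = F.\<delta>[unfolded F\<delta>]
    have X0: "X > 0" using X by simp
    have ratio: "d / Y \<le> d" if "1 \<le> Y" for Y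
      using that d by (simp add: divide_le_eq)
    let ?A = "k * X powr (2 * ?m + ?n - \<alpha>)"
    have "ennreal (?A * (d / X\<^sup>2) powr ?r * ((d / X) ^ ?M) powr ?q) \<le> mixed_norm q r (\<lambda>z t. propagator t F.u0 z)"
    proof (rule mixed_norm_lower_bound[OF q r, where ?t0.0=t0])
      fix z :: "(real^'m) \<times> (real^'n)" and t :: real
      assume z: "z \<in> small_box (d / X)" and t: "t \<in> {t0..t0 + d / X\<^sup>2}"
      obtain x y where xy: "z = (x, y)" by (cases z)
      show "?A \<le> norm (propagator t F.u0 z)"
        using F.propagator_u0_ge[of x y t] z t unfolding xy FX F\<delta> k_def by simp
    next
      show "d / X \<le> 2 * pi" using ratio[OF X] dd(2) pi_gt3 by linarith
      show "t0 + d / X\<^sup>2 \<le> 1" using ratio[OF one_le_power[OF X, of 2]] dd(2) F.t0_bounds by linarith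
      show "0 \<le> t0" using F.t0_bounds by linarith
    qed (use d X0 k in simp_all)
    also have "\<dots> \<le> ennreal C * sobolev_norm \<alpha> p F.u0"
      using est F.schwartz_u0 by blast
    finally have "?A * (d / X\<^sup>2) powr ?r * ((d / X) ^ ?M) powr ?q \<le> max C 0 *
        (sqrt (X ^ 3) ^ CARD('m) * sqrt 12 ^ CARD('n) * ((2 * pi) ^ CARD('m) * (sqrt (8 * pi) * X) ^ CARD('n)) powr ?p)"
      using F.sobolev_norm_u0_le[OF p, unfolded FX] by (rule ennreal_le_mult_maxD) (use X0 in simp)
    moreover have "?A * (d / X\<^sup>2) powr ?r * ((d / X) ^ ?M) powr ?q = c1 * X powr (2 * ?m + ?n - \<alpha> - 2 * ?r - ?M * ?q)"
    proof -
      have X2: "X\<^sup>2 = X powr 2" using X0 by simp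
      have e1: "(d / X\<^sup>2) powr ?r = d powr ?r * X powr (- (2 * ?r))"
      proof -
        have "(d / X\<^sup>2) powr ?r = d powr ?r / X\<^sup>2 powr ?r"
          using d X0 by (simp add: powr_divide)
        then show ?thesis unfolding X2 powr_powr powr_minus_divide by simp
      qed
      have XM: "X ^ ?M = X powr real ?M" using X0 by (simp only: powr_realpow)
      have e2: "((d / X) ^ ?M) powr ?q = (d ^ ?M) powr ?q * X powr (- (real ?M * ?q))"
      proof -
        have "((d / X) ^ ?M) powr ?q = (d ^ ?M) powr ?q / (X ^ ?M) powr ?q"
          unfolding power_divide by (rule powr_divide)
        then show ?thesis unfolding XM powr_powr powr_minus_divide by simp
      qed
      have e3: "X powr (2 * ?m + ?n - \<alpha>) * (X powr (- (2 * ?r)) * X powr (- (real ?M * ?q))) = X powr (2 * ?m + ?n - \<alpha> - 2 * ?r - ?M * ?q)"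
        unfolding powr_add[symmetric] by (rule arg_cong[of _ _ "\<lambda>u. X powr u"]) simp
      show ?thesis unfolding e1 e2 c1_def e3[symmetric] by (simp only: mult_ac)
    qed
    moreover have "max C 0 * (sqrt (X ^ 3) ^ CARD('m) * sqrt 12 ^ CARD('n) * ((2 * pi) ^ CARD('m) * (sqrt (8 * pi) * X) ^ CARD('n)) powr ?p)
        = (max C 0 * c2) * X powr (3/2 * ?m + ?n * ?p)"
    proof -
      have root: "sqrt (X ^ 3) = X powr (3/2)"
      proof -
        have "X ^ 3 = X powr 3" using X0 by simp
        then show ?thesis using X0 by (simp only: powr_half_sqrt[symmetric] powr_powr powr_ge_zero) simp
      qed
      have "(X powr (3/2)) powr ?m = (X powr (3/2)) ^ CARD('m)"
        using X0 by (intro powr_realpow) simp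
      then have e1: "sqrt (X ^ 3) ^ CARD('m) = X powr (3/2 * ?m)"
        unfolding root powr_powr ..
      have Xn: "X ^ CARD('n) = X powr ?n" using X0 by (simp only: powr_realpow)
      have e2: "((2 * pi) ^ CARD('m) * (sqrt (8 * pi) * X) ^ CARD('n)) powr ?p
          = ((2 * pi) ^ CARD('m) * sqrt (8 * pi) ^ CARD('n)) powr ?p * X powr (?n * ?p)"
        unfolding power_mult_distrib[of "sqrt (8 * pi)"] Xn mult.assoc[symmetric]
        using X0 by (simp only: powr_powr[symmetric], subst powr_mult) simp_all
      show ?thesis unfolding e1 e2 c2_def powr_add by (simp only: mult_ac)
    qed
    ultimately show ?thesis by (simp only: g_def N_def[symmetric] X_def[symmetric])
  qed
  have "2 * ?m + ?n - \<alpha> - 2 * ?r - ?M * ?q \<le> 3/2 * ?m + ?n * ?p"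
    by (rule powr_exponent_le[OF filterlim_affine_Suc[folded g_def] _ c1 main]) (simp add: g_def)
  then show ?thesis by (simp add: algebra_simps)
qed

theorem proposition1p3:
  shows
   "(\<forall>p q r :: ennreal. \<forall>\<alpha>::real. 1 \<le> p \<longrightarrow> 1 \<le> q \<longrightarrow> 1 \<le> r \<longrightarrow> 0 \<le> \<alpha> \<longrightarrow>
       (\<exists>C::real. \<forall>f :: (real^'m::finite) \<times> (real^'n::finite) \<Rightarrow> complex. schwartz f \<longrightarrow>
          mixed_norm q r (\<lambda>z t. propagator t f z) \<le> ennreal C * sobolev_norm \<alpha> p f) \<longrightarrow>
       \<alpha> \<ge> real (CARD('m) + CARD('n)) * (1/2 - enn2real (1/q))
            + real CARD('n) * (1/2 - enn2real (1/p)) - enn2real (2/r) \<and>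
       (p = q \<and> q = r \<longrightarrow>
          \<alpha> \<ge> real (CARD('m) + 2 * CARD('n)) * (1/2 - enn2real (1/p)) - enn2real (2/p)) \<and>
       (p = 2 \<and> q = r \<longrightarrow>
          \<alpha> \<ge> real (CARD('m) + CARD('n)) * (1/2 - enn2real (1/q)) - enn2real (2/q)))
    \<and>
    (\<forall>\<sigma> :: (real^'m::finite) \<times> (real^'n::finite) \<Rightarrow> real. unit_cube_partition \<sigma> \<longrightarrow>
      (\<forall>p q :: ennreal. \<forall>\<alpha>::real. 1 \<le> p \<longrightarrow> 1 \<le> q \<longrightarrow>
       (\<exists>C::real. \<forall>f :: (real^'m::finite) \<times> (real^'n::finite) \<Rightarrow> complex. schwartz f \<longrightarrow>
          Lp_norm p (waveguide \<Otimes>\<^sub>M unit_time) (\<lambda>(z, t). propagator t f z)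
            \<le> ennreal C * modulation_norm \<sigma> \<alpha> p q f) \<longrightarrow>
       \<alpha> \<ge> max 0 (real (CARD('m) + CARD('n)) * (1 - enn2real (1/p) - enn2real (1/q))
                    - enn2real (2/p))))"
proof (intro conjI allI impI)
  fix p q r :: ennreal and \<alpha> :: real
  assume pqr: "1 \<le> p" "1 \<le> q" "1 \<le> r" and \<alpha>: "0 \<le> \<alpha>"
    and "\<exists>C::real. \<forall>f :: (real^'m) \<times> (real^'n) \<Rightarrow> complex. schwartz f \<longrightarrow>
      mixed_norm q r (\<lambda>z t. propagator t f z) \<le> ennreal C * sobolev_norm \<alpha> p f"
  then obtain C where C: "\<forall>f :: (real^'m) \<times> (real^'n) \<Rightarrow> complex. schwartz f \<longrightarrow>
      mixed_norm q r (\<lambda>z t. propagator t f z) \<le> ennreal C * sobolev_norm \<alpha> p f" by (elim exE)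
  show *: "\<alpha> \<ge> real (CARD('m) + CARD('n)) * (1/2 - enn2real (1/q))
      + real CARD('n) * (1/2 - enn2real (1/p)) - enn2real (2/r)"
    using sobolev_exponent_ge[OF pqr \<alpha> C] by (simp only: enn2real_divide_ge_1[OF pqr(3)])
  show "\<alpha> \<ge> real (CARD('m) + 2 * CARD('n)) * (1/2 - enn2real (1/p)) - enn2real (2/p)" if "p = q \<and> q = r"
    using * that by (simp add: algebra_simps)
  show "\<alpha> \<ge> real (CARD('m) + CARD('n)) * (1/2 - enn2real (1/q)) - enn2real (2/q)" if "p = 2 \<and> q = r"
  proof -
    have "(1 :: ennreal) / 2 = ennreal (1 / 2)" using divide_ennreal[of 1 2] by simp
    then have "enn2real (1 / 2) = enn2real (ennreal (1 / 2))" by (rule arg_cong)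
    then have half: "enn2real (1 / 2) = 1 / 2" by (simp only: enn2real_ennreal zero_le_divide_1_iff zero_le_numeral)
    from that have pq: "p = 2" "q = r" by simp_all
    show ?thesis using *[unfolded pq half] by (simp add: pq)
  qed
next
  fix \<sigma> :: "(real^'m) \<times> (real^'n) \<Rightarrow> real" and p q :: ennreal and \<alpha> :: real
  assume \<sigma>: "unit_cube_partition \<sigma>" and pq: "1 \<le> p" "1 \<le> q"
    and "\<exists>C::real. \<forall>f :: (real^'m) \<times> (real^'n) \<Rightarrow> complex. schwartz f \<longrightarrow>
      Lp_norm p (waveguide \<Otimes>\<^sub>M unit_time) (\<lambda>(z, t). propagator t f z) \<le> ennreal C * modulation_norm \<sigma> \<alpha> p q f"
  then obtain C where C: "\<forall>f :: (real^'m) \<times> (real^'n) \<Rightarrow> complex. schwartz f \<longrightarrow>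
      Lp_norm p (waveguide \<Otimes>\<^sub>M unit_time) (\<lambda>(z, t). propagator t f z) \<le> ennreal C * modulation_norm \<sigma> \<alpha> p q f"
    by (elim exE)
  interpret partition \<sigma> by unfold_locales (rule \<sigma>)
  have est: "modulation_estimate p q \<alpha> C" unfolding modulation_estimate_def by (rule C)
  show "\<alpha> \<ge> max 0 (real (CARD('m) + CARD('n)) * (1 - enn2real (1/p) - enn2real (1/q)) - enn2real (2/p))"
    using modulation_exponent_nonneg[OF pq est] modulation_exponent_ge[OF pq est]
    by (simp only: enn2real_divide_ge_1[OF pq(1)] max.bounded_iff)
qed


end
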